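(* Let $\{\mathcal{M}_i:R_{i-1}\to R_iL_i\}_{i=1}^n$ be channels, let $\rho\in\mathcal{D}_{=}(R_0SE)$, let $\epsilon\in[0,1)$ and $\alpha>1$. Then $$I_{\max}^{\downarrow\downarrow,\epsilon}(SE:L_1^n)_{\mathcal{M}_n\circ\cdots\circ\mathcal{M}_1(\rho_{R_0SE})}\le\sum_{i=1}^n\sup_{\sigma\in\mathcal{D}_{=}(R_{i-1}L_1^{i-1}SE)}I^\downarrow_\alpha(L_1^{i-1}SE;L_i)_{\mathcal{M}_i(\sigma)}-\frac{g(\epsilon)}{\alpha-1},$$ where $g(\epsilon)=\log(1-\sqrt{1-\epsilon^2})$ (so that the right-hand side is $+\infty$ for $\epsilon=0$).
   Context: All registers finite-dimensional, $\log$ base 2; $\mathcal{D}_{=}(A)$, $\mathcal{D}_{\le}(A)$, $\mathrm{Pos}(A)$: normalized states, subnormalized states, positive semidefinite operators on $A$; $L_1^{k}$ denotes $L_1\cdots L_k$. Channels act as identity on registers not named (registers $S,E,L_1,\dots$ are carried along). Sandwiched Rényi divergence: $D_\alpha(\rho\|\sigma)=\frac{1}{\alpha-1}\log\frac{\mathrm{Tr}[(\sigma^{\frac{1-\alpha}{2\alpha}}\rho\sigma^{\frac{1-\alpha}{2\alpha}})^\alpha]}{\mathrm{Tr}\rho}$ if $\mathrm{supp}\rho\subseteq\mathrm{supp}\sigma$ (for $\alpha>1$), else $+\infty$; $D_\infty(\rho\|\sigma)=\log\inf\{\mu\ge0:\rho\le\mu\sigma\}$. $I^\downarrow_\alpha(A;B)_\rho=\inf_{\sigma_B\in\mathcal{D}_{\le}(B)}D_\alpha(\rho_{AB}\|\rho_A\otimes\sigma_B)$.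 Generalized fidelity $F(\rho,\sigma)=\|\sqrt\rho\sqrt\sigma\|_1+\sqrt{(1-\mathrm{Tr}\rho)(1-\mathrm{Tr}\sigma)}$, purified distance $P=\sqrt{1-F^2}$. $I^{\downarrow\downarrow}_\infty(A:B)_\rho=\inf_{\omega_A\in\mathcal{D}_{\le}(A),\sigma_B\in\mathcal{D}_{\le}(B)}D_\infty(\rho_{AB}\|\omega_A\otimes\sigma_B)$ and $I_{\max}^{\downarrow\downarrow,\epsilon}(A:B)_\rho=\inf\{I^{\downarrow\downarrow}_\infty(A:B)_{\tilde\rho}:\tilde\rho\in\mathcal{D}_{\le}(AB),P(\tilde\rho,\rho)\le\epsilon\}$. *)

theory Defs
  imports "Jordan_Normal_Form.Matrix" "HOL-Library.Extended_Real"
begin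

text \<open>Finite-dimensional quantum information on complex matrices.
  A register of dimension d is the space C^d; operators are d x d complex matrices.
  Composite registers A B use the Kronecker index convention (a,b) = a * dB + b.\<close>

definition trace :: "complex mat \<Rightarrow> complex" where
  "trace A = (\<Sum>i<dim_row A. A $$ (i,i))"

definition adj :: "complex mat \<Rightarrow> complex mat" where
  "adj A = mat (dim_col A) (dim_row A) (\<lambda>(i,j). cnj (A $$ (j,i)))"

definition hermitian :: "complex mat \<Rightarrow> bool" where
  "hermitian A \<longleftrightarrow> adj A = A"

definition psd :: "nat \<Rightarrow> complex mat \<Rightarrow> bool" where
  "psd d A \<longleftrightarrow> A \<in> carrier_mat d d \<and> hermitian A \<and>
     (\<forall>v \<in> carrier_vec d. 0 \<le> Re (\<Sum>i<d. cnj (v $ i) * (A *\<^sub>v v) $ i))"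

definition dens :: "nat \<Rightarrow> complex mat \<Rightarrow> bool" where
  "dens d A \<longleftrightarrow> psd d A \<and> trace A = 1"

definition subdens :: "nat \<Rightarrow> complex mat \<Rightarrow> bool" where
  "subdens d A \<longleftrightarrow> psd d A \<and> Re (trace A) \<le> 1"

definition unitary_mat :: "nat \<Rightarrow> complex mat \<Rightarrow> bool" where
  "unitary_mat d U \<longleftrightarrow> U \<in> carrier_mat d d \<and> U * adj U = 1\<^sub>m d"

definition diag_of :: "nat \<Rightarrow> (nat \<Rightarrow> complex) \<Rightarrow> complex mat" where
  "diag_of d f = mat d d (\<lambda>(i,j). if i = j then f i else 0)"

text \<open>Functional calculus for PSD matrices: A^p = U diag(lambda_i^p) U^*, with the
  convention 0^p = 0 (i.e. powers, including negative ones, are taken on the support).\<close>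
definition mpow :: "complex mat \<Rightarrow> real \<Rightarrow> complex mat" where
  "mpow A p = (SOME B. \<exists>U lam. unitary_mat (dim_row A) U \<and> (\<forall>i. 0 \<le> lam i) \<and>
      A = U * diag_of (dim_row A) (\<lambda>i. complex_of_real (lam i)) * adj U \<and>
      B = U * diag_of (dim_row A) (\<lambda>i. complex_of_real (lam i powr p)) * adj U)"

definition msqrt :: "complex mat \<Rightarrow> complex mat" where
  "msqrt A = mpow A (1/2)"

definition tnorm :: "complex mat \<Rightarrow> real" where
  "tnorm X = Re (trace (msqrt (adj X * X)))"

definition kron :: "complex mat \<Rightarrow> complex mat \<Rightarrow> complex mat" where
  "kron A B = mat (dim_row A * dim_row B) (dim_col A * dim_col B)
     (\<lambda>(i,j). A $$ (i div dim_row B, j div dim_col B) * B $$ (i mod dim_row B, j mod dim_col B))"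

definition ptrace_snd :: "nat \<Rightarrow> nat \<Rightarrow> complex mat \<Rightarrow> complex mat" where
  "ptrace_snd dA dB X = mat dA dA (\<lambda>(a,a'). \<Sum>b<dB. X $$ (a * dB + b, a' * dB + b))"

definition ptrace_fst :: "nat \<Rightarrow> nat \<Rightarrow> complex mat \<Rightarrow> complex mat" where
  "ptrace_fst dA dB X = mat dB dB (\<lambda>(b,b'). \<Sum>a<dA. X $$ (a * dB + b, a * dB + b'))"

definition unit_op :: "nat \<Rightarrow> nat \<Rightarrow> nat \<Rightarrow> complex mat" where
  "unit_op d a a' = mat d d (\<lambda>(i,j). if i = a \<and> j = a' then 1 else 0)"

text \<open>(Phi \<otimes> id_K)(X) for a map Phi from A (dim dA) to B (dim dB) and X on A K.
  Output on B K.\<close>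
definition ext_id :: "(complex mat \<Rightarrow> complex mat) \<Rightarrow> nat \<Rightarrow> nat \<Rightarrow> nat \<Rightarrow> complex mat \<Rightarrow> complex mat" where
  "ext_id Phi dA dB dK X = mat (dB * dK) (dB * dK) (\<lambda>(i,j).
      \<Sum>a<dA. \<Sum>a'<dA. Phi (unit_op dA a a') $$ (i div dK, j div dK) *
                       X $$ (a * dK + i mod dK, a' * dK + j mod dK))"

definition channel :: "nat \<Rightarrow> nat \<Rightarrow> (complex mat \<Rightarrow> complex mat) \<Rightarrow> bool" where
  "channel dA dB Phi \<longleftrightarrow>
     (\<forall>X \<in> carrier_mat dA dA. Phi X \<in> carrier_mat dB dB) \<and>
     (\<forall>X \<in> carrier_mat dA dA. \<forall>Y \<in> carrier_mat dA dA. Phi (X + Y) = Phi X + Phi Y) \<and>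
     (\<forall>X \<in> carrier_mat dA dA. \<forall>c. Phi (c \<cdot>\<^sub>m X) = c \<cdot>\<^sub>m Phi X) \<and>
     (\<forall>X \<in> carrier_mat dA dA. trace (Phi X) = trace X) \<and>
     (\<forall>k>0. \<forall>X. psd (dA * k) X \<longrightarrow> psd (dB * k) (ext_id Phi dA dB k X))"

definition elog2 :: "real \<Rightarrow> ereal" where
  "elog2 x = (if x = 0 then -\<infinity> else ereal (log 2 x))"

text \<open>Support inclusion supp rho \<subseteq> supp sigma (for PSD operators: ker sigma \<subseteq> ker rho).\<close>
definition supp_le :: "complex mat \<Rightarrow> complex mat \<Rightarrow> bool" where
  "supp_le \<rho> \<sigma> \<longleftrightarrow> (\<forall>v \<in> carrier_vec (dim_row \<sigma>). \<sigma> *\<^sub>v v = 0\<^sub>v (dim_row \<sigma>) \<longrightarrow> \<rho> *\<^sub>v v = 0\<^sub>v (dim_row \<rho>))"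

text \<open>Sandwiched Renyi divergence (for alpha > 1).\<close>
definition sandD :: "real \<Rightarrow> complex mat \<Rightarrow> complex mat \<Rightarrow> ereal" where
  "sandD \<alpha> \<rho> \<sigma> = (if supp_le \<rho> \<sigma> then
      (let s = mpow \<sigma> ((1 - \<alpha>) / (2 * \<alpha>)) in
        elog2 (Re (trace (mpow (s * \<rho> * s) \<alpha>)) / Re (trace \<rho>)) / ereal (\<alpha> - 1))
     else \<infinity>)"

definition Dmax :: "nat \<Rightarrow> complex mat \<Rightarrow> complex mat \<Rightarrow> ereal" where
  "Dmax d \<rho> \<sigma> = (let S = {\<mu>::real. 0 \<le> \<mu> \<and> psd d (complex_of_real \<mu> \<cdot>\<^sub>m \<sigma> - \<rho>)} in
      if S = {} then \<infinity> else elog2 (Inf S))"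

text \<open>I^down_alpha(A;B) for a state on the register B A (B first, dims dB, dA):
  inf over sigma_B in D_<=(B) of D_alpha(rho_BA || sigma_B \<otimes> rho_A).\<close>
definition Idown :: "real \<Rightarrow> nat \<Rightarrow> nat \<Rightarrow> complex mat \<Rightarrow> ereal" where
  "Idown \<alpha> dB dA \<rho> = (INF \<sigma>B \<in> {\<sigma>. subdens dB \<sigma>}. sandD \<alpha> \<rho> (kron \<sigma>B (ptrace_fst dB dA \<rho>)))"

definition Iddmax :: "nat \<Rightarrow> nat \<Rightarrow> complex mat \<Rightarrow> ereal" where
  "Iddmax dA dB \<rho> = (INF p \<in> {(\<omega>, \<sigma>). subdens dA \<omega> \<and> subdens dB \<sigma>}.
      Dmax (dA * dB) \<rho> (kron (fst p) (snd p)))"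

definition gen_fidelity :: "complex mat \<Rightarrow> complex mat \<Rightarrow> real" where
  "gen_fidelity \<rho> \<sigma> = tnorm (msqrt \<rho> * msqrt \<sigma>) +
     sqrt ((1 - Re (trace \<rho>)) * (1 - Re (trace \<sigma>)))"

definition purified_distance :: "complex mat \<Rightarrow> complex mat \<Rightarrow> real" where
  "purified_distance \<rho> \<sigma> = sqrt (1 - (gen_fidelity \<rho> \<sigma>)\<^sup>2)"

definition Imax_smooth :: "real \<Rightarrow> nat \<Rightarrow> nat \<Rightarrow> complex mat \<Rightarrow> ereal" where
  "Imax_smooth \<epsilon> dA dB \<rho> = (INF \<rho>' \<in> {\<tau>. subdens (dA * dB) \<tau> \<and> purified_distance \<tau> \<rho> \<le> \<epsilon>}.
      Iddmax dA dB \<rho>')"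

text \<open>Dimension of the register L_i ... L_1 S E (the L registers are stacked in front).\<close>
definition dimK :: "(nat \<Rightarrow> nat) \<Rightarrow> nat \<Rightarrow> nat \<Rightarrow> nat \<Rightarrow> nat" where
  "dimK dL dS dE i = (\<Prod>j\<in>{1..i}. dL j) * (dS * dE)"

text \<open>State after applying M_1,...,M_i to rho on R_0 S E; lives on R_i (L_i ... L_1 S E).
  M_i maps R_{i-1} to R_i L_i (output layout R_i first).\<close>
primrec evolve :: "(nat \<Rightarrow> complex mat \<Rightarrow> complex mat) \<Rightarrow> (nat \<Rightarrow> nat) \<Rightarrow> (nat \<Rightarrow> nat) \<Rightarrow>
    nat \<Rightarrow> nat \<Rightarrow> complex mat \<Rightarrow> nat \<Rightarrow> complex mat" where
  "evolve M dR dL dS dE \<rho> 0 = \<rho>"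
| "evolve M dR dL dS dE \<rho> (Suc i) =
     ext_id (M (Suc i)) (dR i) (dR (Suc i) * dL (Suc i)) (dimK dL dS dE i) (evolve M dR dL dS dE \<rho> i)"

definition g_eps :: "real \<Rightarrow> ereal" where
  "g_eps \<epsilon> = elog2 (1 - sqrt (1 - \<epsilon>\<^sup>2))"

end

theory Submission
  imports Defs "Jordan_Normal_Form.Spectral_Radius" "Jordan_Normal_Form.Schur_Decomposition" "HOL-Analysis.Convex"
begin

text \<open>Write \<open>Q\<^sub>\<alpha>(\<rho>, \<sigma>) = Tr (s \<rho> s)\<^sup>\<alpha>\<close> with \<open>s = \<sigma>\<^bsup>(1-\<alpha>)/(2\<alpha>)\<^esup>\<close>. For \<open>\<rho>\<close> on \<open>K L\<close>, put \<open>Y = s \<rho>\<^sub>K s\<close> and let \<open>\<nu>\<close> be the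
  normalisation of \<open>A \<rho> A\<^sup>*\<close> with \<open>A = Y\<^bsup>(\<alpha>-1)/2\<^esup> s\<close> acting on \<open>K\<close>. Then
  \<open>Q\<^sub>\<alpha>(\<rho>, \<sigma>\<^sub>K \<otimes> \<omega>\<^sub>L) = Q\<^sub>\<alpha>(\<rho>\<^sub>K, \<sigma>\<^sub>K) Q\<^sub>\<alpha>(\<nu>, \<nu>\<^sub>K \<otimes> \<omega>\<^sub>L)\<close> for every \<open>\<omega>\<^sub>L\<close>. As \<open>A\<close> commutes with a channel that
  does not touch \<open>K\<close>, \<open>\<nu>\<close> is again an output of the channel, so a near-optimal \<open>\<omega>\<^sub>L\<close> for \<open>\<nu>\<close> costs at most the
  supremum of the single-step informations. Iterating from \<open>\<sigma> = \<rho>\<^sub>S\<^sub>E\<close>, where \<open>Q\<^sub>\<alpha> = 1\<close>, produces a product reference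
  state. Finally \<open>D\<^sub>m\<^sub>a\<^sub>x\<close> smoothed by \<open>\<epsilon>\<close> is at most \<open>D\<^sub>\<alpha> - g(\<epsilon>) / (\<alpha> - 1)\<close>: the positive part of
  \<open>\<rho> - l \<sigma>\<close> has trace at most \<open>l\<^bsup>1-\<alpha>\<^esup> Q\<^sub>\<alpha>\<close>, and removing it costs no more fidelity than that.\<close>

section \<open>Adjoint, trace and positivity\<close>

text \<open>\<open>Idown\<close> compares a state only with a reference whose K part is the state's
  own marginal, while the iteration carries a different K part, the product built so far. Tilting
  removes this mismatch: the marginal of \<nu> is Y^\<alpha> divided by its trace, so its power
  (1-\<alpha>)/(2\<alpha>) is Y^((1-\<alpha>)/2) up to a scalar and cancels the factor
  Y^((\<alpha>-1)/2) in A. What remains is the original sandwiched operator. The tilted state may be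
  far from the given one, which is where the supremum over all inputs is used. Since powers vanish
  on kernels, each cancellation produces only a support projection, and much of the work lies in
  showing that these projections act trivially. For the smoothing, data processing is needed only
  for a two-outcome test, where Young's and Jensen's inequalities for eigenvalues suffice. The term
  with g(\<epsilon>) comes from choosing l such that l^(1-\<alpha>) times the bound on Q equals 1 -
  sqrt(1 - \<epsilon>^2), the loss of fidelity that purified distance \<epsilon> tolerates.\<close>

lemma mult_square_carrier [simp]:
  "A \<in> carrier_mat d d \<Longrightarrow> B \<in> carrier_mat d d \<Longrightarrow> A * B \<in> carrier_mat d d"
  by simp

lemma adj_carrier [simp]: "A \<in> carrier_mat n m \<Longrightarrow> adj A \<in> carrier_mat m n"
  unfolding adj_def by auto

lemma dim_adj [simp]: "dim_row (adj A) = dim_col A" "dim_col (adj A) = dim_row A"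
  unfolding adj_def by auto

lemma index_adj [simp]: "i < dim_col A \<Longrightarrow> j < dim_row A \<Longrightarrow> adj A $$ (i,j) = cnj (A $$ (j,i))"
  unfolding adj_def by auto

lemma adj_adj [simp]: "adj (adj A) = A"
  by (rule eq_matI) auto

lemma adj_mult: "A \<in> carrier_mat n m \<Longrightarrow> B \<in> carrier_mat m k \<Longrightarrow> adj (A * B) = adj B * adj A"
  by (rule eq_matI) (auto simp: scalar_prod_def intro!: sum.cong)

lemma adj_add: "A \<in> carrier_mat n m \<Longrightarrow> B \<in> carrier_mat n m \<Longrightarrow> adj (A + B) = adj A + adj B"
  by (rule eq_matI) auto

lemma adj_minus: "A \<in> carrier_mat n m \<Longrightarrow> B \<in> carrier_mat n m \<Longrightarrow> adj (A - B) = adj A - adj B"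
  by (rule eq_matI) auto

lemma adj_smult: "adj (c \<cdot>\<^sub>m A) = cnj c \<cdot>\<^sub>m adj A"
  by (rule eq_matI) auto

lemma adj_one [simp]: "adj (1\<^sub>m d) = 1\<^sub>m d"
  by (rule eq_matI) auto

lemma trace_mult:
  "A \<in> carrier_mat n m \<Longrightarrow> B \<in> carrier_mat m n \<Longrightarrow> trace (A * B) = (\<Sum>i<n. \<Sum>j<m. A $$ (i,j) * B $$ (j,i))"
  by (auto simp: trace_def scalar_prod_def atLeast0LessThan)

lemma trace_comm:
  assumes "A \<in> carrier_mat n m" "B \<in> carrier_mat m n" shows "trace (A * B) = trace (B * A)"
  unfolding trace_mult[OF assms] trace_mult[OF assms(2,1)]
  by (subst sum.swap) (simp add: mult.commute)

lemma trace_add: "A \<in> carrier_mat d d \<Longrightarrow> B \<in> carrier_mat d d \<Longrightarrow> trace (A + B) = trace A + trace B"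
  by (auto simp: trace_def sum.distrib)

lemma trace_minus: "A \<in> carrier_mat d d \<Longrightarrow> B \<in> carrier_mat d d \<Longrightarrow> trace (A - B) = trace A - trace B"
  by (auto simp: trace_def sum_subtractf)

lemma trace_smult: "A \<in> carrier_mat d d \<Longrightarrow> trace (c \<cdot>\<^sub>m A) = c * trace A"
  by (auto simp: trace_def sum_distrib_left)

lemma trace_adj: "A \<in> carrier_mat d d \<Longrightarrow> trace (adj A) = cnj (trace A)"
  by (auto simp: trace_def)

lemma trace_conj_left:
  assumes "A \<in> carrier_mat d d" "B \<in> carrier_mat d d" "C \<in> carrier_mat d d"
  shows "trace (A * B * C) = trace (C * A * B)"
  using trace_comm[of "A * B" d d C] assms by (simp add: assoc_mult_mat[of C d d A d B d])

text \<open>The sum in \<open>psd_def\<close> as an inner product, conjugate linear in its first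
  argument, so that adjoints can be moved across it.\<close>

definition cip :: "complex vec \<Rightarrow> complex vec \<Rightarrow> complex" where
  "cip v w = (\<Sum>i<dim_vec w. cnj (v $ i) * w $ i)"

lemma cip_adj:
  assumes "X \<in> carrier_mat n m" "v \<in> carrier_vec n" "w \<in> carrier_vec m"
  shows "cip v (X *\<^sub>v w) = cip (adj X *\<^sub>v v) w"
proof -
  have "cip v (X *\<^sub>v w) = (\<Sum>i<n. \<Sum>j<m. cnj (v $ i) * (X $$ (i,j) * w $ j))"
    using assms by (simp add: cip_def scalar_prod_def atLeast0LessThan sum_distrib_left)
  also have "\<dots> = (\<Sum>j<m. \<Sum>i<n. cnj (v $ i) * (X $$ (i,j) * w $ j))"
    by (rule sum.swap)
  also have "\<dots> = cip (adj X *\<^sub>v v) w"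
    using assms by (simp add: cip_def scalar_prod_def atLeast0LessThan sum_distrib_left sum_distrib_right mult_ac)
  finally show ?thesis .
qed

lemma psd_iff:
  "psd d A \<longleftrightarrow> A \<in> carrier_mat d d \<and> adj A = A \<and> (\<forall>v\<in>carrier_vec d. 0 \<le> Re (cip v (A *\<^sub>v v)))"
  by (auto simp: psd_def hermitian_def cip_def)

lemma psd_carrier: "psd d A \<Longrightarrow> A \<in> carrier_mat d d"
  by (simp add: psd_def)

lemma psd_adj: "psd d A \<Longrightarrow> adj A = A"
  by (simp add: psd_iff)

lemma psd_congruence:
  assumes "psd n A" "X \<in> carrier_mat m n"
  shows "psd m (X * A * adj X)"
  unfolding psd_iff
proof (intro conjI ballI)
  have A: "A \<in> carrier_mat n n" "adj A = A" and pos: "\<And>v. v \<in> carrier_vec n \<Longrightarrow> 0 \<le> Re (cip v (A *\<^sub>v v))"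
    using assms(1) by (auto simp: psd_iff)
  show "X * A * adj X \<in> carrier_mat m m" using A assms by auto
  show "adj (X * A * adj X) = X * A * adj X"
    unfolding adj_mult[OF mult_carrier_mat[OF assms(2) A(1)] adj_carrier[OF assms(2)]] adj_mult[OF assms(2) A(1)]
      A(2) adj_adj by (rule assoc_mult_mat[OF assms(2) A(1) adj_carrier[OF assms(2)], symmetric])
  fix v :: "complex vec" assume v: "v \<in> carrier_vec m"
  have "(X * A * adj X) *\<^sub>v v = X *\<^sub>v (A *\<^sub>v (adj X *\<^sub>v v))"
    unfolding assoc_mult_mat_vec[OF mult_carrier_mat[OF assms(2) A(1)] adj_carrier[OF assms(2)] v]
    by (rule assoc_mult_mat_vec[OF assms(2) A(1) mult_mat_vec_carrier[OF adj_carrier[OF assms(2)] v]])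
  then have "cip v ((X * A * adj X) *\<^sub>v v) = cip (adj X *\<^sub>v v) (A *\<^sub>v (adj X *\<^sub>v v))"
    using cip_adj[OF assms(2) v mult_mat_vec_carrier[OF A(1) mult_mat_vec_carrier[OF adj_carrier[OF assms(2)] v]]] by simp
  then show "0 \<le> Re (cip v ((X * A * adj X) *\<^sub>v v))"
    using pos[OF mult_mat_vec_carrier[OF adj_carrier[OF assms(2)] v]] by simp
qed

lemma psd_congruence_adj: "psd n A \<Longrightarrow> X \<in> carrier_mat n m \<Longrightarrow> psd m (adj X * A * X)"
  using psd_congruence[of n A "adj X" m] by simp

lemma cip_add: "v \<in> carrier_vec d \<Longrightarrow> w \<in> carrier_vec d \<Longrightarrow> cip u (v + w) = cip u v + cip u w"
  by (auto simp: cip_def algebra_simps sum.distrib)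

lemma psd_add:
  assumes "psd d A" "psd d B" shows "psd d (A + B)"
  using assms unfolding psd_iff
  by (auto simp: adj_add[of _ d d] add_mult_distrib_mat_vec[of _ d d] cip_add[of _ d])

lemma cip_smult: "cip u (c \<cdot>\<^sub>v v) = c * cip u v"
  by (simp add: cip_def sum_distrib_left mult_ac)

lemma smult_mat_mult_vec: "A \<in> carrier_mat n m \<Longrightarrow> v \<in> carrier_vec m \<Longrightarrow> (c \<cdot>\<^sub>m A) *\<^sub>v v = c \<cdot>\<^sub>v (A *\<^sub>v v)"
  by (rule eq_vecI) (auto simp: scalar_prod_def sum_distrib_left mult_ac)

lemma psd_smult:
  assumes "psd d A" "0 \<le> c" shows "psd d (complex_of_real c \<cdot>\<^sub>m A)"
  using assms unfolding psd_iff by (auto simp: adj_smult smult_mat_mult_vec[of _ d d] cip_smult)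

lemma psd_diag_entry:
  assumes "psd d A" "i < d" shows "0 \<le> Re (A $$ (i,i))"
proof -
  have A: "A \<in> carrier_mat d d" and pos: "0 \<le> Re (cip (unit_vec d i) (A *\<^sub>v unit_vec d i))"
    using assms by (auto simp: psd_iff)
  have "cip (unit_vec d i) (A *\<^sub>v unit_vec d i) = (\<Sum>k<d. if k = i then A $$ (i,i) else 0)"
    unfolding cip_def using A assms(2) by (intro sum.cong) auto
  then show ?thesis using pos assms(2) by (simp add: sum.delta)
qed

lemma psd_diag_real: "psd d A \<Longrightarrow> i < d \<Longrightarrow> Im (A $$ (i,i)) = 0"
  by (metis Reals_cnj_iff complex_is_Real_iff index_adj carrier_matD psd_adj psd_carrier)

lemma psd_trace: "psd d A \<Longrightarrow> 0 \<le> Re (trace A)"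
  using psd_diag_entry psd_carrier[of d A] by (auto simp: trace_def intro!: sum_nonneg)

lemma psd_trace_real: "psd d A \<Longrightarrow> trace A = complex_of_real (Re (trace A))"
  using psd_diag_real psd_carrier[of d A] by (auto simp: trace_def complex_eq_iff intro!: sum.neutral)

section \<open>Unitary and diagonal matrices\<close>

lemma unitary_matD:
  assumes "unitary_mat d U"
  shows "U \<in> carrier_mat d d" "U * adj U = 1\<^sub>m d" "adj U * U = 1\<^sub>m d"
  using assms mat_mult_left_right_inverse[of U d "adj U"] by (auto simp: unitary_mat_def)

lemma unitary_mat_mult:
  assumes "unitary_mat d U" "unitary_mat d V" shows "unitary_mat d (U * V)"
proof -
  note [simp] = assoc_mult_mat[of _ d d _ d _ d]
  have U: "U \<in> carrier_mat d d" "V \<in> carrier_mat d d" "U * adj U = 1\<^sub>m d" "V * adj V = 1\<^sub>m d"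
    using assms by (auto simp: unitary_mat_def)
  have "(U * V) * (adj V * adj U) = U * ((V * adj V) * adj U)" using U(1,2) by (simp add: mult_carrier_mat[of _ d d _ d])
  then show ?thesis using U by (simp add: unitary_mat_def adj_mult[of _ d d _ d])
qed

lemma diag_of_carrier [simp]: "diag_of d f \<in> carrier_mat d d"
  by (simp add: diag_of_def)

lemma dim_diag_of [simp]: "dim_row (diag_of d f) = d" "dim_col (diag_of d f) = d"
  by (simp_all add: diag_of_def)

lemma index_mult_diag:
  assumes "A \<in> carrier_mat n d" "i < n" "j < d"
  shows "(A * diag_of d f) $$ (i,j) = A $$ (i,j) * f j"
proof -
  have "(A * diag_of d f) $$ (i,j) = (\<Sum>k<d. A $$ (i,k) * diag_of d f $$ (k,j))"
    using assms by (simp add: scalar_prod_def atLeast0LessThan)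
  also have "\<dots> = (\<Sum>k<d. if k = j then A $$ (i,j) * f j else 0)"
    using assms by (intro sum.cong refl) (auto simp: diag_of_def)
  finally have "(A * diag_of d f) $$ (i,j) = (\<Sum>k<d. if k = j then A $$ (i,j) * f j else 0)" .
  then show ?thesis using assms by simp
qed

lemma index_conj_diag:
  assumes "A \<in> carrier_mat n d" "B \<in> carrier_mat m d" "i < n" "j < m"
  shows "(A * diag_of d f * adj B) $$ (i,j) = (\<Sum>k<d. A $$ (i,k) * f k * cnj (B $$ (j,k)))"
proof -
  define X where "X = A * diag_of d f"
  have X: "X \<in> carrier_mat n d" using assms by (simp add: X_def)
  have "(X * adj B) $$ (i,j) = (\<Sum>k<d. X $$ (i,k) * cnj (B $$ (j,k)))"
    using assms X by (simp add: scalar_prod_def atLeast0LessThan)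
  then show ?thesis
    unfolding X_def using assms by (simp add: index_mult_diag del: index_mult_mat(1))
qed

lemma index_diag_mult:
  assumes "A \<in> carrier_mat d n" "i < d" "j < n"
  shows "(diag_of d f * A) $$ (i,j) = f i * A $$ (i,j)"
proof -
  have "(diag_of d f * A) $$ (i,j) = (\<Sum>k<d. diag_of d f $$ (i,k) * A $$ (k,j))"
    using assms by (simp add: scalar_prod_def atLeast0LessThan)
  also have "\<dots> = (\<Sum>k<d. if k = i then f i * A $$ (i,j) else 0)"
    using assms by (intro sum.cong refl) (auto simp: diag_of_def)
  finally have "(diag_of d f * A) $$ (i,j) = (\<Sum>k<d. if k = i then f i * A $$ (i,j) else 0)" .
  then show ?thesis using assms by simp
qed

lemma diag_of_mult: "diag_of d f * diag_of d g = diag_of d (\<lambda>i. f i * g i)"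
  by (rule eq_matI) (auto simp: index_mult_diag[of _ d] diag_of_def[of d "\<lambda>i. f i * g i"] diag_of_def[of d f]
      simp del: index_mult_mat(1))

lemma adj_diag_of: "adj (diag_of d f) = diag_of d (\<lambda>i. cnj (f i))"
  by (rule eq_matI) (auto simp: diag_of_def)

lemma trace_diag_of: "trace (diag_of d f) = (\<Sum>i<d. f i)"
  by (simp add: trace_def diag_of_def)

section \<open>Spectral theorem\<close>

lemma exists_eigenvector:
  fixes A :: "complex mat"
  assumes "A \<in> carrier_mat n n" "n \<noteq> 0"
  shows "\<exists>v e. v \<in> carrier_vec n \<and> v \<noteq> 0\<^sub>v n \<and> A *\<^sub>v v = e \<cdot>\<^sub>v v"
proof -
  obtain e where "eigenvalue A e"
    using spectrum_non_empty[OF assms(1)] assms(2) by (auto simp: spectrum_def)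
  then show ?thesis using assms(1) by (auto simp: eigenvalue_def eigenvector_def)
qed

text \<open>Basis completion followed by Gram-Schmidt keeps v as the first vector. The resulting
  vectors are orthogonal but not normalised, so each column is divided by its norm; this is the
  origin of the factor c.\<close>

lemma exists_unitary_first_col:
  fixes v :: "complex vec"
  assumes v: "v \<in> carrier_vec n" "v \<noteq> 0\<^sub>v n" and n: "n \<noteq> 0"
  shows "\<exists>U c. unitary_mat n U \<and> col U 0 = c \<cdot>\<^sub>v v"
proof -
  interpret cof_vec_space n "TYPE(complex)" .
  define b where "b = basis_completion v"
  define ws where "ws = gram_schmidt n b"
  from basis_completion[OF v, folded b_def]
  have dist_b: "distinct b" and indep: "\<not> lin_dep (set b)" and b: "set b \<subseteq> carrier_vec n"
    and hdb: "hd b = v" and len_b: "length b = n" by auto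
  from hdb len_b n obtain vs where bv: "b = v # vs" by (cases b, auto)
  from gram_schmidt_result[OF b dist_b indep refl, folded ws_def]
  have ws: "set ws \<subseteq> carrier_vec n" "corthogonal ws" "length ws = n" by (auto simp: len_b)
  from gram_schmidt_hd[OF v(1), of vs, folded bv] have hdws: "hd ws = v" unfolding ws_def .
  have wsc: "ws ! i \<in> carrier_vec n" if "i < n" for i using that ws by auto
  define N where "N i = (\<Sum>k<n. (cmod (ws ! i $ k))\<^sup>2)" for i
  have cprod: "ws ! i \<bullet>c ws ! j = (\<Sum>k<n. ws ! i $ k * cnj (ws ! j $ k))" if "i < n" "j < n" for i j
    using wsc[OF that(1)] wsc[OF that(2)] by (simp add: scalar_prod_def atLeast0LessThan)
  have NN: "ws ! i \<bullet>c ws ! i = complex_of_real (N i)" if "i < n" for i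
    unfolding cprod[OF that that] N_def of_real_sum
    by (intro sum.cong refl) (simp only: complex_norm_square)
  have N: "N i > 0" if "i < n" for i
  proof -
    have "ws ! i \<bullet>c ws ! i \<noteq> 0" using corthogonalD[OF ws(2), of i i] that ws by auto
    then have "N i \<noteq> 0" using NN[OF that] by auto
    moreover have "N i \<ge> 0" unfolding N_def by (intro sum_nonneg) auto
    ultimately show ?thesis by simp
  qed
  define U where "U = mat n n (\<lambda>(i,j). ws ! j $ i / sqrt (N j))"
  have U: "U \<in> carrier_mat n n" by (simp add: U_def)
  have "adj U * U = 1\<^sub>m n"
  proof (rule eq_matI)
    fix i j assume ij: "i < dim_row (1\<^sub>m n)" "j < dim_col (1\<^sub>m n)"
    then have "(adj U * U) $$ (i,j) = (ws ! j \<bullet>c ws ! i) / (sqrt (N i) * sqrt (N j))"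
      using U wsc[of i] by (simp add: scalar_prod_def atLeast0LessThan sum_divide_distrib U_def mult_ac)
    also have "\<dots> = 1\<^sub>m n $$ (i,j)"
    proof (cases "i = j")
      case True
      have "complex_of_real (sqrt (N j)) * complex_of_real (sqrt (N j)) = complex_of_real (N j)"
        using N[of j] ij by (simp flip: of_real_mult)
      then show ?thesis using True NN[of j] N[of j] ij by simp
    next
      case False
      then have "ws ! j \<bullet>c ws ! i = 0" using corthogonalD[OF ws(2), of j i] ij ws by auto
      then show ?thesis using False ij by simp
    qed
    finally show "(adj U * U) $$ (i,j) = 1\<^sub>m n $$ (i,j)" .
  qed (use U in auto)
  then have "unitary_mat n U"
    using mat_mult_left_right_inverse[of "adj U" n U] U by (auto simp: unitary_mat_def)
  moreover have "col U 0 = (1 / complex_of_real (sqrt (N 0))) \<cdot>\<^sub>v v"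
  proof -
    have "ws ! 0 = v" using hdws ws(3) n by (metis hd_conv_nth list.size(3))
    then show ?thesis using n v by (intro eq_vecI) (auto simp: U_def)
  qed
  ultimately show ?thesis by blast
qed

text \<open>Deflation: rotate an eigenvector to the first basis vector. The first column of
  \<open>B\<close> then vanishes below the diagonal, hermiticity clears the first row as well, and
  the remaining block \<open>C\<close> is handled by induction.\<close>

theorem hermitian_spectral:
  assumes "A \<in> carrier_mat n n" "adj A = A"
  shows "\<exists>U lam. unitary_mat n U \<and> A = U * diag_of n (\<lambda>i. complex_of_real (lam i)) * adj U"
  using assms
proof (induction n arbitrary: A)
  case 0
  then show ?case by (intro exI[of _ "1\<^sub>m 0"] exI[of _ "\<lambda>_. 0"]) (auto simp: unitary_mat_def)
next
  case (Suc n)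
  note [simp] = assoc_mult_mat[of _ "Suc n" "Suc n" _ "Suc n" _ "Suc n"]
  obtain v e where v: "v \<in> carrier_vec (Suc n)" "v \<noteq> 0\<^sub>v (Suc n)" "A *\<^sub>v v = e \<cdot>\<^sub>v v"
    using exists_eigenvector[OF Suc.prems(1)] by auto
  obtain U c where U: "unitary_mat (Suc n) U" and col: "col U 0 = c \<cdot>\<^sub>v v"
    using exists_unitary_first_col[OF v(1,2)] by auto
  note UD = unitary_matD[OF U]
  define B where "B = adj U * A * U"
  have B: "B \<in> carrier_mat (Suc n) (Suc n)" using UD(1) Suc.prems by (simp add: B_def)
  have Bh: "adj B = B" using UD(1) Suc.prems by (simp add: B_def adj_mult[of _ "Suc n" "Suc n" _ "Suc n"])
  have AB: "A = U * B * adj U"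
  proof -
    have "U * B * adj U = (U * adj U) * A * (U * adj U)" using UD(1) Suc.prems B_def by simp
    then show ?thesis using UD Suc.prems by simp
  qed
  have "A *\<^sub>v col U 0 = e \<cdot>\<^sub>v col U 0"
    using v Suc.prems by (simp add: col mult_mat_vec[of _ "Suc n" "Suc n"] smult_smult_assoc mult.commute)
  then have "col (A * U) 0 = e \<cdot>\<^sub>v col U 0"
    using UD(1) Suc.prems by (simp only: col_mult2[of A "Suc n" "Suc n" U "Suc n" 0])
  moreover have "B = adj U * (A * U)" using UD(1) Suc.prems by (simp add: B_def)
  ultimately have colB: "col B 0 = e \<cdot>\<^sub>v col (adj U * U) 0"
    using UD(1) Suc.prems mult_mat_vec[of "adj U" "Suc n" "Suc n" "col U 0" e] col_carrier_vec[of 0 "Suc n" U "Suc n"]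
    by (simp add: col_mult2[of "adj U" "Suc n" "Suc n" _ "Suc n" 0])
  have B0: "B $$ (i, 0) = (if i = 0 then e else 0)" if "i < Suc n" for i
  proof -
    have "B $$ (i,0) = col B 0 $ i" using B that by simp
    then show ?thesis unfolding colB UD(3) using that by simp
  qed
  have B0': "B $$ (0, j) = (if j = 0 then cnj e else 0)" if "j < Suc n" for j
    using B0[OF that] index_adj[of 0 B j] B that Bh by auto
  define C where "C = mat n n (\<lambda>(i,j). B $$ (Suc i, Suc j))"
  have C: "C \<in> carrier_mat n n" by (simp add: C_def)
  have "adj C = C"
  proof (rule eq_matI)
    fix i j assume "i < dim_row C" "j < dim_col C"
    then show "adj C $$ (i,j) = C $$ (i,j)"
      using index_adj[of "Suc i" B "Suc j"] B Bh by (simp add: C_def)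
  qed (simp_all add: C_def)
  then obtain V lam where V: "unitary_mat n V" and Ceq: "C = V * diag_of n (\<lambda>i. complex_of_real (lam i)) * adj V"
    using Suc.IH[OF C] by auto
  note VD = unitary_matD[OF V]
  define W where "W = mat (Suc n) (Suc n) (\<lambda>(i,j). if i = 0 \<and> j = 0 then 1 else if i = 0 \<or> j = 0 then 0 else V $$ (i-1,j-1))"
  have Wc: "W \<in> carrier_mat (Suc n) (Suc n)" by (simp add: W_def)
  have Wi: "W $$ (0,0) = 1" "\<And>j. j < n \<Longrightarrow> W $$ (0, Suc j) = 0" "\<And>i. i < n \<Longrightarrow> W $$ (Suc i, 0) = 0"
    "\<And>i j. i < n \<Longrightarrow> j < n \<Longrightarrow> W $$ (Suc i, Suc j) = V $$ (i,j)"
    by (simp_all add: W_def)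
  \<comment> \<open>The corner entry of \<open>B\<close> equals both e and its conjugate, so e is
    real and nothing is lost by taking \<open>Re e\<close>.\<close>
  define mu where "mu i = (if i = 0 then Re e else lam (i - 1))" for i
  let ?D = "diag_of (Suc n) (\<lambda>i. complex_of_real (mu i))"
  have sumS: "(\<Sum>k<Suc n. f k) = f 0 + (\<Sum>k<n. f (Suc k))" for f :: "nat \<Rightarrow> complex"
    by (rule sum.lessThan_Suc_shift)
  have "W * adj W = 1\<^sub>m (Suc n)"
  proof (rule eq_matI)
    fix i j assume ij: "i < dim_row (1\<^sub>m (Suc n))" "j < dim_col (1\<^sub>m (Suc n))"
    have *: "(W * adj W) $$ (i,j) = (\<Sum>k<Suc n. W $$ (i,k) * cnj (W $$ (j,k)))"
      using ij Wc by (simp add: scalar_prod_def atLeast0LessThan)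
    show "(W * adj W) $$ (i,j) = 1\<^sub>m (Suc n) $$ (i,j)"
    proof (cases i; cases j)
      fix i' j' assume [simp]: "i = Suc i'" "j = Suc j'"
      have "(V * adj V) $$ (i',j') = (\<Sum>k<n. V $$ (i',k) * cnj (V $$ (j',k)))"
        using ij VD(1) by (simp add: scalar_prod_def atLeast0LessThan)
      then show ?thesis unfolding * sumS VD(2) using ij by (simp add: Wi)
    qed (use ij * in \<open>simp_all add: sumS Wi del: sum.lessThan_Suc index_mult_mat(1)\<close>)
  qed (use Wc in auto)
  then have W: "unitary_mat (Suc n) W" using Wc by (simp add: unitary_mat_def)
  have "W * ?D * adj W = B"
  proof (rule eq_matI)
    fix i j assume ij: "i < dim_row B" "j < dim_col B"
    then have ij': "i < Suc n" "j < Suc n" using B by auto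
    have WD: "W * ?D \<in> carrier_mat (Suc n) (Suc n)" using Wc by simp
    have *: "(W * ?D * adj W) $$ (i,j) = (\<Sum>k<Suc n. W $$ (i,k) * mu k * cnj (W $$ (j,k)))"
      by (rule index_conj_diag[OF Wc Wc ij'])
    have ereal: "complex_of_real (Re e) = e" "cnj e = e"
      using B0[of 0] B0'[of 0] by (auto simp: complex_eq_iff)
    show "(W * ?D * adj W) $$ (i,j) = B $$ (i,j)"
    proof (cases i; cases j)
      fix i' j' assume [simp]: "i = Suc i'" "j = Suc j'"
      have "C $$ (i',j') = (\<Sum>k<n. V $$ (i',k) * lam k * cnj (V $$ (j',k)))"
        unfolding Ceq
        using ij' by (intro index_conj_diag[OF VD(1) VD(1)]) auto
      moreover have "C $$ (i',j') = B $$ (i,j)" using ij' by (simp add: C_def)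
      ultimately show ?thesis unfolding * sumS using ij' by (simp add: Wi mu_def)
    qed (use ij' ereal * in \<open>simp_all add: sumS Wi mu_def B0 B0' del: sum.lessThan_Suc index_mult_mat(1)\<close>)
  qed (use Wc B in auto)
  then have "A = (U * W) * ?D * adj (U * W)"
    unfolding AB using UD(1) Wc by (simp add: adj_mult[of _ "Suc n" "Suc n" _ "Suc n"] flip: \<open>W * ?D * adj W = B\<close>)
  then show ?case using unitary_mat_mult[OF U W] by blast
qed

section \<open>Powers of positive semidefinite matrices\<close>

definition spec :: "nat \<Rightarrow> complex mat \<Rightarrow> (nat \<Rightarrow> real) \<Rightarrow> complex mat" where
  "spec d U lam = U * diag_of d (\<lambda>i. complex_of_real (lam i)) * adj U"

lemma spec_carrier: "unitary_mat d U \<Longrightarrow> spec d U lam \<in> carrier_mat d d"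
  unfolding spec_def using unitary_matD[of d U] by auto

lemma spec_cong: "(\<And>i. i < d \<Longrightarrow> a i = b i) \<Longrightarrow> spec d U a = spec d U b"
  unfolding spec_def diag_of_def by (intro arg_cong2[of _ _ _ _ "(*)"] refl cong_mat) auto

lemma adj_conj_spec:
  assumes "unitary_mat d U"
  shows "adj U * spec d U a * U = diag_of d (\<lambda>i. complex_of_real (a i))"
proof -
  note [simp] = assoc_mult_mat[of _ d d _ d _ d]
  note U = unitary_matD[OF assms]
  let ?D = "diag_of d (\<lambda>i. complex_of_real (a i))"
  have "adj U * spec d U a * U = (adj U * U) * ?D * (adj U * U)"
    unfolding spec_def using U(1) by simp
  also have "\<dots> = ?D" unfolding U(3) by simp
  finally show ?thesis .
qed

lemma spec_mult:
  assumes "unitary_mat d U"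
  shows "spec d U a * spec d U b = spec d U (\<lambda>i. a i * b i)"
proof -
  note [simp] = assoc_mult_mat[of _ d d _ d _ d]
  note U = unitary_matD[OF assms]
  let ?D = "\<lambda>a. diag_of d (\<lambda>i. complex_of_real (a i))"
  have "spec d U a * spec d U b = U * (?D a * (adj U * U) * ?D b) * adj U"
    unfolding spec_def using U(1) by simp
  also have "\<dots> = spec d U (\<lambda>i. a i * b i)"
    unfolding U(3) spec_def by (simp add: diag_of_mult)
  finally show ?thesis .
qed

lemma trace_spec:
  assumes "unitary_mat d U" shows "trace (spec d U a) = complex_of_real (\<Sum>i<d. a i)"
proof -
  note U = unitary_matD[OF assms]
  have "trace (spec d U a) = trace (adj U * (U * diag_of d (\<lambda>i. complex_of_real (a i))))"
    unfolding spec_def using U(1) by (intro trace_comm[of _ d d]) auto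
  also have "\<dots> = trace ((adj U * U) * diag_of d (\<lambda>i. complex_of_real (a i)))"
    using U(1) by (subst assoc_mult_mat[of _ d d _ d _ d]) auto
  also have "\<dots> = complex_of_real (\<Sum>i<d. a i)" unfolding U(3) by (simp add: trace_diag_of)
  finally show ?thesis .
qed

lemma psd_diag_of:
  assumes "\<And>i. i < d \<Longrightarrow> 0 \<le> a i" shows "psd d (diag_of d (\<lambda>i. complex_of_real (a i)))"
  unfolding psd_iff
proof (intro conjI ballI)
  show "adj (diag_of d (\<lambda>i. complex_of_real (a i))) = diag_of d (\<lambda>i. complex_of_real (a i))"
    by (simp add: adj_diag_of)
  fix v :: "complex vec" assume v: "v \<in> carrier_vec d"
  have "(diag_of d (\<lambda>i. complex_of_real (a i)) *\<^sub>v v) $ i = a i * v $ i" if i: "i < d" for i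
  proof -
    have "(diag_of d (\<lambda>i. complex_of_real (a i)) *\<^sub>v v) $ i = (\<Sum>k<d. if k = i then a i * v $ i else 0)"
    proof -
      have "(diag_of d (\<lambda>i. complex_of_real (a i)) *\<^sub>v v) $ i
          = (\<Sum>k<d. diag_of d (\<lambda>i. complex_of_real (a i)) $$ (i,k) * v $ k)"
        using i v by (simp add: scalar_prod_def atLeast0LessThan)
      also have "\<dots> = (\<Sum>k<d. if k = i then a i * v $ i else 0)"
        using i by (intro sum.cong refl) (auto simp: diag_of_def)
      finally show ?thesis .
    qed
    then show ?thesis using i by simp
  qed
  then have "cip v (diag_of d (\<lambda>i. complex_of_real (a i)) *\<^sub>v v) = (\<Sum>i<d. a i * (cnj (v $ i) * v $ i))"
    using v by (simp add: cip_def mult_ac)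
  then show "0 \<le> Re (cip v (diag_of d (\<lambda>i. complex_of_real (a i)) *\<^sub>v v))"
    using assms by (auto intro!: sum_nonneg mult_nonneg_nonneg)
qed simp

lemma psd_spec: "unitary_mat d U \<Longrightarrow> (\<And>i. i < d \<Longrightarrow> 0 \<le> a i) \<Longrightarrow> psd d (spec d U a)"
  unfolding spec_def by (rule psd_congruence[OF psd_diag_of unitary_matD(1)])

lemma psd_one: "psd d (1\<^sub>m d)"
proof -
  have "1\<^sub>m d = diag_of d (\<lambda>i. complex_of_real 1)" by (rule eq_matI) (auto simp: diag_of_def)
  then show ?thesis using psd_diag_of[of d "\<lambda>_. 1"] by simp
qed

lemma hermitian_spec:
  assumes "A \<in> carrier_mat d d" "adj A = A"
  obtains U lam where "unitary_mat d U" "A = spec d U lam"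
  using hermitian_spectral[OF assms] by (auto simp: spec_def)

lemma psd_spectral:
  assumes "psd d A"
  obtains U lam where "unitary_mat d U" "\<forall>i. 0 \<le> lam i" "A = spec d U lam"
proof -
  obtain U lam where U: "unitary_mat d U" and A: "A = spec d U lam"
    using hermitian_spec[OF psd_carrier[OF assms] psd_adj[OF assms]] .
  have "0 \<le> lam i" if "i < d" for i
    using psd_diag_entry[OF psd_congruence_adj[OF assms unitary_matD(1)[OF U]] that] that
    unfolding A adj_conj_spec[OF U] by (simp add: diag_of_def)
  \<comment> \<open>\<open>mpow_def\<close> asks for nonnegativity at every index, also beyond the
    dimension, hence the extension by zero.\<close>
  then have "\<forall>i. 0 \<le> (if i < d then lam i else 0)" by simp
  moreover have "A = spec d U (\<lambda>i. if i < d then lam i else 0)"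
    unfolding A by (rule spec_cong) simp
  ultimately show thesis by (rule that[OF U])
qed

text \<open>Every functional calculus on hermitian matrices respects intertwining relations; this is
  where well-definedness of \<open>mpow\<close> comes from.\<close>

lemma spec_intertwine:
  assumes U: "unitary_mat d U" and V: "unitary_mat e V" and X: "X \<in> carrier_mat e d"
    and eq: "X * spec d U a = spec e V b * X"
  shows "X * spec d U (\<lambda>i. f (a i)) = spec e V (\<lambda>i. f (b i)) * X"
proof -
  note UD = unitary_matD[OF U] and VD = unitary_matD[OF V]
  let ?D = "\<lambda>d a. diag_of d (\<lambda>i. complex_of_real (a i))"
  define W where "W = adj V * X * U"
  have W: "W \<in> carrier_mat e d" using UD(1) VD(1) X by (auto simp: W_def)
  have rot: "adj V * (X * spec d U a) * U = W * ?D d a" "adj V * (spec e V b * X) * U = ?D e b * W" for a b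
  proof -
    have "adj V * (X * spec d U a) * U = (adj V * X) * (spec d U a * U)"
    proof -
      have S: "spec d U a \<in> carrier_mat d d" and V': "adj V \<in> carrier_mat e e"
        using spec_carrier[OF U] VD(1) by auto
      show ?thesis
        unfolding assoc_mult_mat[OF V' X S, symmetric]
        by (rule assoc_mult_mat[OF mult_carrier_mat[OF V' X] S UD(1)])
    qed
    also have "spec d U a * U = U * ?D d a"
    proof -
      have "spec d U a * U = U * ?D d a * (adj U * U)"
        unfolding spec_def using UD(1) by (simp add: assoc_mult_mat[of _ d d _ d _ d])
      then show ?thesis unfolding UD(3) using UD(1) by (simp add: right_mult_one_mat[of _ d d])
    qed
    also have "(adj V * X) * (U * ?D d a) = W * ?D d a"
      unfolding W_def using UD(1) VD(1) X assoc_mult_mat[of "adj V * X" e d U d "?D d a" d] mult_carrier_mat[of "adj V" e e X d] by simp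
    finally show "adj V * (X * spec d U a) * U = W * ?D d a" .
    have "adj V * spec e V b = ?D e b * adj V"
    proof -
      have "adj V * spec e V b = (adj V * V) * (?D e b * adj V)"
        unfolding spec_def using VD(1) by (simp add: assoc_mult_mat[of _ e e _ e _ e])
      then show ?thesis unfolding VD(3) using VD(1) by (simp add: left_mult_one_mat[of _ e e])
    qed
    moreover have "adj V * (spec e V b * X) * U = (adj V * spec e V b) * X * U"
      using UD(1) VD(1) X spec_carrier[OF V, of b] assoc_mult_mat[of "adj V" e e "spec e V b" e X d] by simp
    ultimately have "adj V * (spec e V b * X) * U = ?D e b * adj V * X * U" by simp
    also have "\<dots> = ?D e b * W"
      unfolding W_def using UD(1) VD(1) X assoc_mult_mat[of "?D e b" e e "adj V" e X d]
        assoc_mult_mat[of "?D e b" e e "adj V * X" d U d] mult_carrier_mat[of "adj V" e e X d] by simp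
    finally show "adj V * (spec e V b * X) * U = ?D e b * W" .
  qed
  have WD: "W * ?D d a = ?D e b * W" using eq rot(1)[of a] rot(2)[of b] by simp
  have "W * ?D d (\<lambda>i. f (a i)) = ?D e (\<lambda>i. f (b i)) * W"
  proof (rule eq_matI)
    fix i j assume "i < dim_row (?D e (\<lambda>i. f (b i)) * W)" "j < dim_col (?D e (\<lambda>i. f (b i)) * W)"
    then have ij: "i < e" "j < d" using W by auto
    have "(W * ?D d a) $$ (i,j) = (?D e b * W) $$ (i,j)" by (simp only: WD)
    then have "W $$ (i,j) * a j = b i * W $$ (i,j)"
      using W ij by (simp add: index_mult_diag index_diag_mult del: index_mult_mat(1))
    \<comment> \<open>In the two eigenbases intertwining is an entrywise condition: where W does not
      vanish the eigenvalues agree, and then so do their images under any f.\<close>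
    then have "W $$ (i,j) = 0 \<or> a j = b i" by auto
    then show "(W * ?D d (\<lambda>i. f (a i))) $$ (i,j) = (?D e (\<lambda>i. f (b i)) * W) $$ (i,j)"
      using W ij by (auto simp: index_mult_diag index_diag_mult simp del: index_mult_mat(1))
  qed (use W in auto)
  then have *: "adj V * (X * spec d U (\<lambda>i. f (a i))) * U = adj V * (spec e V (\<lambda>i. f (b i)) * X) * U"
    unfolding rot .
  have cancel: "V * (adj V * Z * U) * adj U = Z" if Z: "Z \<in> carrier_mat e d" for Z
  proof -
    have "V * (adj V * Z * U) * adj U = V * (adj V * Z) * (U * adj U)"
      using UD(1) VD(1) Z assoc_mult_mat[of V e e "adj V * Z" d U d] assoc_mult_mat[of "V * (adj V * Z)" e d U d "adj U" d]
        mult_carrier_mat[of "adj V" e e Z d] mult_carrier_mat[of V e e "adj V * Z" d] by simp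
    also have "\<dots> = (V * adj V) * Z"
      unfolding UD(2) using VD(1) Z assoc_mult_mat[of V e e "adj V" e Z d] mult_carrier_mat[of V e e "adj V * Z" d]
        mult_carrier_mat[of "adj V" e e Z d] by simp
    finally show ?thesis unfolding VD(2) using Z by simp
  qed
  show ?thesis
    using arg_cong[OF *, of "\<lambda>Z. V * Z * adj U"]
    unfolding cancel[OF mult_carrier_mat[OF X spec_carrier[OF U]]] cancel[OF mult_carrier_mat[OF spec_carrier[OF V] X]] .
qed

text \<open>The choice in \<open>mpow_def\<close> may return a power computed from another
  diagonalisation of the same matrix; intertwining through the identity matrix shows that all
  diagonalisations give the same power.\<close>

lemma mpow_spec:
  assumes U: "unitary_mat d U" and pos: "\<forall>i. 0 \<le> lam i"
  shows "mpow (spec d U lam) p = spec d U (\<lambda>i. lam i powr p)"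
proof -
  let ?A = "spec d U lam"
  have dim: "dim_row ?A = d" using spec_carrier[OF U] by auto
  let ?P = "\<lambda>B. \<exists>V mu. unitary_mat d V \<and> (\<forall>i. 0 \<le> mu i) \<and> ?A = spec d V mu \<and> B = spec d V (\<lambda>i. mu i powr p)"
  have "mpow ?A p = (SOME B. ?P B)"
    unfolding mpow_def dim unfolding spec_def ..
  moreover have "?P (SOME B. ?P B)"
    by (rule someI_ex) (use U pos in blast)
  ultimately have "?P (mpow ?A p)" by simp
  then obtain V mu where V: "unitary_mat d V" and A: "?A = spec d V mu"
    and eq: "mpow ?A p = spec d V (\<lambda>i. mu i powr p)" by auto
  have "1\<^sub>m d * spec d U (\<lambda>i. lam i powr p) = spec d V (\<lambda>i. mu i powr p) * 1\<^sub>m d"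
    by (rule spec_intertwine[OF U V, of _ lam mu "\<lambda>x. x powr p"])
      (use left_mult_one_mat[OF spec_carrier[OF V]] right_mult_one_mat[OF spec_carrier[OF V]] in \<open>simp_all add: A\<close>)
  then show ?thesis
    using eq spec_carrier[OF U, of "\<lambda>i. lam i powr p"] spec_carrier[OF V, of "\<lambda>i. mu i powr p"] by simp
qed

lemma mpow_psd: assumes "psd d A" shows "psd d (mpow A p)"
proof -
  obtain U lam where U: "unitary_mat d U" "\<forall>i. 0 \<le> lam i" "A = spec d U lam" using psd_spectral[OF assms] .
  show ?thesis unfolding U(3) mpow_spec[OF U(1,2)] by (rule psd_spec[OF U(1)]) simp
qed

lemma mpow_carrier: "psd d A \<Longrightarrow> mpow A p \<in> carrier_mat d d"
  by (rule psd_carrier[OF mpow_psd])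

lemma mpow_adj: "psd d A \<Longrightarrow> adj (mpow A p) = mpow A p"
  by (rule psd_adj[OF mpow_psd])

text \<open>Exponents of either sign may be added, because \<open>0 powr p = 0\<close> for every p:
  a negative power is the inverse on the support, and opposite powers multiply to the support
  projection instead of the identity.\<close>

lemma mpow_mult: assumes "psd d A" shows "mpow A p * mpow A q = mpow A (p + q)"
proof -
  obtain U lam where U: "unitary_mat d U" "\<forall>i. 0 \<le> lam i" "A = spec d U lam" using psd_spectral[OF assms] .
  show ?thesis unfolding U(3) mpow_spec[OF U(1,2)] spec_mult[OF U(1)] by (simp add: powr_add)
qed

lemma mpow_mpow: assumes "psd d A" shows "mpow (mpow A p) q = mpow A (p * q)"
proof -
  obtain U lam where U: "unitary_mat d U" "\<forall>i. 0 \<le> lam i" "A = spec d U lam" using psd_spectral[OF assms] .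
  show ?thesis unfolding U(3) mpow_spec[OF U(1,2)] by (subst mpow_spec[OF U(1)]) (simp_all add: powr_powr)
qed

lemma mpow_one: assumes "psd d A" shows "mpow A 1 = A"
proof -
  obtain U lam where U: "unitary_mat d U" "\<forall>i. 0 \<le> lam i" "A = spec d U lam" using psd_spectral[OF assms] .
  show ?thesis unfolding U(3) mpow_spec[OF U(1,2)] using U(2) by simp
qed

lemma msqrt_mult: "psd d A \<Longrightarrow> msqrt A * msqrt A = A"
  unfolding msqrt_def by (simp add: mpow_mult mpow_one)

lemma smult_spec:
  assumes "unitary_mat d U"
  shows "complex_of_real c \<cdot>\<^sub>m spec d U a = spec d U (\<lambda>i. c * a i)"
proof -
  have "diag_of d (\<lambda>i. complex_of_real (c * a i)) = complex_of_real c \<cdot>\<^sub>m diag_of d (\<lambda>i. complex_of_real (a i))"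
    by (rule eq_matI) (auto simp: diag_of_def)
  then show ?thesis
    using unitary_matD(1)[OF assms]
    by (simp add: spec_def mult_smult_distrib[of _ d d _ d] mult_smult_assoc_mat[of _ d d _ d])
qed

lemma mpow_smult:
  assumes "psd d A" "0 \<le> c"
  shows "mpow (complex_of_real c \<cdot>\<^sub>m A) p = complex_of_real (c powr p) \<cdot>\<^sub>m mpow A p"
proof -
  obtain U lam where U: "unitary_mat d U" "\<forall>i. 0 \<le> lam i" "A = spec d U lam" using psd_spectral[OF assms(1)] .
  show ?thesis unfolding U(3) mpow_spec[OF U(1,2)] smult_spec[OF U(1)]
    by (subst mpow_spec[OF U(1)]) (use assms U in \<open>simp_all add: powr_mult\<close>)
qed

lemma mpow_intertwine:
  assumes "psd d A" "psd e B" "X \<in> carrier_mat e d" "X * A = B * X"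
  shows "X * mpow A p = mpow B p * X"
proof -
  obtain U a where U: "unitary_mat d U" "\<forall>i. 0 \<le> a i" "A = spec d U a" using psd_spectral[OF assms(1)] .
  obtain V b where V: "unitary_mat e V" "\<forall>i. 0 \<le> b i" "B = spec e V b" using psd_spectral[OF assms(2)] .
  show ?thesis
    using spec_intertwine[OF U(1) V(1) assms(3), of a b "\<lambda>x. x powr p"] assms(4)
    unfolding U(3) V(3) mpow_spec[OF U(1,2)] mpow_spec[OF V(1,2)] by simp
qed

lemma psd_adj_mult: assumes "Z \<in> carrier_mat n d" shows "psd d (adj Z * Z)"
  using psd_congruence_adj[OF psd_one assms] assms by simp

lemma psd_mult_adj: assumes "Z \<in> carrier_mat n d" shows "psd n (Z * adj Z)"
  using psd_congruence[OF psd_one assms] assms by simp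

text \<open>The two products have the same nonzero spectrum. Splitting off one factor of the power
  and intertwining the rest through Z shows this without comparing eigenvalues; zero eigenvalues
  contribute nothing for any p.\<close>

lemma trace_mpow_swap:
  assumes Z: "Z \<in> carrier_mat d d"
  shows "trace (mpow (adj Z * Z) p) = trace (mpow (Z * adj Z) p)"
proof -
  note [simp] = assoc_mult_mat[of _ d d _ d _ d]
  note P = psd_adj_mult[OF Z] and Q = psd_mult_adj[OF Z]
  have c: "mpow (adj Z * Z) q \<in> carrier_mat d d" "mpow (Z * adj Z) q \<in> carrier_mat d d" for q
    using mpow_carrier[OF P] mpow_carrier[OF Q] by auto
  have "mpow (adj Z * Z) p = (adj Z * Z) * mpow (adj Z * Z) (p - 1)"
    using mpow_mult[OF P, of 1 "p - 1"] by (simp add: mpow_one[OF P])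
  also have "\<dots> = adj Z * (Z * mpow (adj Z * Z) (p - 1))" using Z c by simp
  also have "Z * mpow (adj Z * Z) (p - 1) = mpow (Z * adj Z) (p - 1) * Z"
    by (rule mpow_intertwine[OF P Q Z]) (use Z in simp)
  finally have "trace (mpow (adj Z * Z) p) = trace (adj Z * (mpow (Z * adj Z) (p - 1) * Z))" by simp
  also have "\<dots> = trace ((mpow (Z * adj Z) (p - 1) * Z) * adj Z)"
    using Z c by (intro trace_comm[of _ d d]) auto
  also have "(mpow (Z * adj Z) (p - 1) * Z) * adj Z = mpow (Z * adj Z) (p - 1) * (Z * adj Z)"
    using Z c by simp
  also have "\<dots> = mpow (Z * adj Z) p"
    using mpow_mult[OF Q, of "p - 1" 1] by (simp add: mpow_one[OF Q])
  finally show ?thesis .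
qed

text \<open>By cyclicity the trace is that of A conjugated by the square root of B.\<close>

lemma psd_trace_mult_nonneg:
  assumes A: "psd d A" and B: "psd d B" shows "0 \<le> Re (trace (A * B))"
proof -
  note [simp] = assoc_mult_mat[of _ d d _ d _ d]
  have c: "A \<in> carrier_mat d d" "msqrt B \<in> carrier_mat d d" "adj (msqrt B) = msqrt B"
    using A psd_carrier mpow_carrier[OF B] mpow_adj[OF B] by (auto simp: msqrt_def)
  have "A * B = A * msqrt B * msqrt B" using c msqrt_mult[OF B] by simp
  then have "trace (A * B) = trace (msqrt B * A * adj (msqrt B))"
    using c trace_conj_left[of A d "msqrt B" "msqrt B"] by simp
  then show ?thesis using psd_trace[OF psd_congruence[OF A c(2)]] by simp
qed

lemma psd_trace_zero:
  assumes "psd d A" "Re (trace A) = 0" shows "A = 0\<^sub>m d d"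
proof -
  obtain U lam where U: "unitary_mat d U" "\<forall>i. 0 \<le> lam i" "A = spec d U lam" using psd_spectral[OF assms(1)] .
  have "(\<Sum>i<d. lam i) = 0" using assms(2) unfolding U(3) trace_spec[OF U(1)] by simp
  then have "\<forall>i<d. lam i = 0" using U(2) by (simp add: sum_nonneg_eq_0_iff)
  then have "diag_of d (\<lambda>i. complex_of_real (lam i)) = 0\<^sub>m d d"
    by (intro eq_matI) (auto simp: diag_of_def)
  then show ?thesis unfolding U(3) spec_def using unitary_matD(1)[OF U(1)] by simp
qed

lemma adj_mult_zero:
  assumes "X \<in> carrier_mat n d" "adj X * X = 0\<^sub>m d d" shows "X = 0\<^sub>m n d"
proof (rule eq_matI)
  fix i j assume "i < dim_row (0\<^sub>m n d :: complex mat)" "j < dim_col (0\<^sub>m n d :: complex mat)"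
  then have ij: "i < n" "j < d" by auto
  have "complex_of_real (\<Sum>k<n. (cmod (X $$ (k,j)))\<^sup>2) = (\<Sum>k<n. cnj (X $$ (k,j)) * X $$ (k,j))"
    by (simp add: complex_norm_square mult.commute del: of_real_power)
  also have "\<dots> = (adj X * X) $$ (j,j)"
    using assms(1) ij by (simp add: scalar_prod_def atLeast0LessThan)
  also have "\<dots> = 0" using assms ij by simp
  finally have "(\<Sum>k<n. (cmod (X $$ (k,j)))\<^sup>2) = 0" by (simp only: of_real_eq_0_iff)
  then show "X $$ (i,j) = 0\<^sub>m n d $$ (i,j)" using ij by (simp add: sum_nonneg_eq_0_iff)
qed (use assms in auto)

text \<open>With Q = 1 - P, the operator sqrt(T) Q has squared Hilbert-Schmidt norm Tr(Q T) = 0.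
  This lifts a statement about traces, which is all that a marginal provides, to an operator
  identity.\<close>

lemma psd_supported:
  assumes T: "psd d T" and P: "psd d P" "P * P = P" and tr: "Re (trace (P * T)) = Re (trace T)"
  shows "P * T = T"
proof -
  note [simp] = assoc_mult_mat[of _ d d _ d _ d]
  define Q where "Q = 1\<^sub>m d - P"
  define X where "X = msqrt T * Q"
  have c: "T \<in> carrier_mat d d" "P \<in> carrier_mat d d" "Q \<in> carrier_mat d d" "msqrt T \<in> carrier_mat d d" "X \<in> carrier_mat d d"
    using psd_carrier[OF T] psd_carrier[OF P(1)] mpow_carrier[OF T] minus_carrier_mat[of P d d]
    by (auto simp: Q_def X_def msqrt_def)
  have aQ: "adj Q = Q" using c psd_adj[OF P(1)] by (simp add: Q_def adj_minus[of _ d d])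
  have at: "adj (msqrt T) = msqrt T" using mpow_adj[OF T] by (simp add: msqrt_def)
  have QQ: "Q * Q = Q"
  proof -
    have "Q * Q = Q - P * Q"
      using c unfolding Q_def by (subst minus_mult_distrib_mat[of _ d d _ _ d]) auto
    also have "P * Q = P - P * P"
      using c unfolding Q_def by (subst mult_minus_distrib_mat[of _ d d _ d]) auto
    finally show ?thesis using c by (simp add: P(2)) (rule eq_matI, auto)
  qed
  have XX: "adj X * X = Q * T * Q"
  proof -
    have "adj X * X = Q * (msqrt T * msqrt T) * Q"
      using c aQ at by (simp add: X_def adj_mult[of _ d d _ d])
    then show ?thesis using msqrt_mult[OF T] by simp
  qed
  have "trace (Q * T * Q) = trace (Q * T)"
    using c QQ trace_conj_left[of Q d T Q] by simp
  also have "\<dots> = trace T - trace (P * T)"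
    using c by (simp add: Q_def minus_mult_distrib_mat[of _ d d] trace_minus[of _ d])
  finally have "Re (trace (adj X * X)) = 0" using tr XX by simp
  then have "adj X * X = 0\<^sub>m d d" using psd_trace_zero[OF psd_adj_mult[OF c(5)]] by simp
  then have "X = 0\<^sub>m d d" by (rule adj_mult_zero[OF c(5)])
  moreover have "adj (0\<^sub>m d d) = 0\<^sub>m d d" by (rule eq_matI) auto
  ultimately have "adj X * msqrt T = 0\<^sub>m d d" using c by simp
  moreover have "adj X * msqrt T = Q * T"
    using c aQ at msqrt_mult[OF T] by (simp add: X_def adj_mult[of _ d d _ d])
  ultimately have "Q * T = 0\<^sub>m d d" by simp
  then have "T - P * T = 0\<^sub>m d d"
    using c by (simp add: Q_def minus_mult_distrib_mat[of _ d d])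
  then have "(T - P * T) $$ (i,j) = 0" if "i < d" "j < d" for i j using that by simp
  then show ?thesis using c by (intro eq_matI) auto
qed

lemmas square_distribs =
  add_mult_distrib_mat[of _ d d _ _ d] mult_add_distrib_mat[of _ d d _ d]
  minus_mult_distrib_mat[of _ d d _ _ d] mult_minus_distrib_mat[of _ d d _ d] for d

lemmas square_assoc = assoc_mult_mat[of _ d d _ d _ d] for d

section \<open>Trace inequalities\<close>

lemma conj_diag_entry:
  assumes "X \<in> carrier_mat n d" "i < n"
  shows "(X * diag_of d (\<lambda>k. complex_of_real (b k)) * adj X) $$ (i,i) = complex_of_real (\<Sum>k<d. (cmod (X $$ (i,k)))\<^sup>2 * b k)"
  unfolding index_conj_diag[OF assms(1) assms(1) assms(2) assms(2)] of_real_sum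
  by (intro sum.cong refl) (simp only: of_real_mult complex_norm_square, simp add: mult_ac)

lemma mult_adj_entry:
  assumes "X \<in> carrier_mat n d" "i < n"
  shows "(X * adj X) $$ (i,i) = complex_of_real (\<Sum>k<d. (cmod (X $$ (i,k)))\<^sup>2)"
proof -
  have "diag_of d (\<lambda>k. complex_of_real 1) = 1\<^sub>m d" by (rule eq_matI) (auto simp: diag_of_def)
  then show ?thesis using conj_diag_entry[OF assms, of "\<lambda>_. 1"] assms by simp
qed

lemma unitary_mat_adj: "unitary_mat d U \<Longrightarrow> unitary_mat d (adj U)"
  unfolding unitary_mat_def[of d "adj U"] adj_adj by (blast dest: unitary_matD intro: adj_carrier)

lemma unitary_row_norm: "unitary_mat d W \<Longrightarrow> i < d \<Longrightarrow> (\<Sum>k<d. (cmod (W $$ (i,k)))\<^sup>2) = 1"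
proof -
  assume W: "unitary_mat d W" and i: "i < d"
  have "complex_of_real (\<Sum>k<d. (cmod (W $$ (i,k)))\<^sup>2) = complex_of_real 1"
    using mult_adj_entry[OF unitary_matD(1)[OF W] i] i unfolding unitary_matD(2)[OF W] by simp
  then show ?thesis by (simp only: of_real_eq_iff)
qed

lemma unitary_col_norm: "unitary_mat d W \<Longrightarrow> k < d \<Longrightarrow> (\<Sum>i<d. (cmod (W $$ (i,k)))\<^sup>2) = 1"
  using unitary_row_norm[OF unitary_mat_adj, of d W k] unitary_matD(1)[of d W] by (simp add: carrier_matD)

lemma trace_unitary_conj:
  assumes "unitary_mat d U" "A \<in> carrier_mat d d" shows "trace (adj U * A * U) = trace A"
  using trace_conj_left[of "adj U" d A U] unitary_matD[OF assms(1)] assms(2) by simp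

text \<open>In the eigenbases of A and B the trace is the sum of s(i,k) a(i) b(k), where s(i,k) are
  the squared moduli of the entries of a unitary. Scalar Young applies to each pair, and since all
  row and column sums of s are 1, the two resulting sums decouple.\<close>

lemma trace_mult_Young:
  assumes A: "psd d A" and B: "psd d B" and pq: "1 < p" "1 < q" "1 / p + 1 / q = (1::real)"
  shows "Re (trace (A * B)) \<le> Re (trace (mpow A p)) / p + Re (trace (mpow B q)) / q"
proof -
  note [simp] = square_assoc[of _ d]
  obtain U a where U: "unitary_mat d U" "\<forall>i. 0 \<le> a i" "A = spec d U a" using psd_spectral[OF A] .
  obtain V b where V: "unitary_mat d V" "\<forall>i. 0 \<le> b i" "B = spec d V b" using psd_spectral[OF B] .
  note UD = unitary_matD[OF U(1)] and VD = unitary_matD[OF V(1)]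
  define W where "W = adj U * V"
  have W: "unitary_mat d W" unfolding W_def by (rule unitary_mat_mult[OF unitary_mat_adj[OF U(1)] V(1)])
  note WD = unitary_matD[OF W]
  let ?D = "\<lambda>a. diag_of d (\<lambda>i. complex_of_real (a i))"
  define s where "s i k = (cmod (W $$ (i,k)))\<^sup>2" for i k
  have s: "s i k \<ge> 0" for i k by (simp add: s_def)
  have "trace (A * B) = trace (adj U * (A * B) * U)"
    using trace_unitary_conj[OF U(1)] psd_carrier[OF A] psd_carrier[OF B] by simp
  also have "adj U * (A * B) * U = (adj U * U) * ?D a * (W * ?D b * adj W)"
    using UD(1) VD(1) by (simp add: U(3) V(3) spec_def W_def adj_mult[of _ d d _ d])
  also have "\<dots> = ?D a * (W * ?D b * adj W)" unfolding UD(3) using WD(1) by simp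
  also have "trace \<dots> = (\<Sum>i<d. (?D a * (W * ?D b * adj W)) $$ (i,i))"
    using WD(1) by (simp add: trace_def)
  also have "\<dots> = (\<Sum>i<d. complex_of_real (a i * (\<Sum>k<d. s i k * b k)))"
  proof (intro sum.cong refl)
    fix i assume "i \<in> {..<d}"
    then have i: "i < d" by simp
    have c: "W * ?D b * adj W \<in> carrier_mat d d" using WD(1) by simp
    show "(?D a * (W * ?D b * adj W)) $$ (i,i) = complex_of_real (a i * (\<Sum>k<d. s i k * b k))"
      unfolding index_diag_mult[OF c i i] conj_diag_entry[OF WD(1) i] s_def by simp
  qed
  finally have "Re (trace (A * B)) = (\<Sum>i<d. \<Sum>k<d. s i k * (a i * b k))"
    by (simp add: sum_distrib_left mult_ac)
  also have "\<dots> \<le> (\<Sum>i<d. \<Sum>k<d. s i k * (a i powr p / p + b k powr q / q))"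
    using s U(2) V(2) pq by (intro sum_mono mult_left_mono Youngs_inequality) auto
  also have "\<dots> = (\<Sum>i<d. \<Sum>k<d. s i k * (a i powr p / p)) + (\<Sum>i<d. \<Sum>k<d. s i k * (b k powr q / q))"
    by (simp add: distrib_left sum.distrib)
  also have "(\<Sum>i<d. \<Sum>k<d. s i k * (b k powr q / q)) = (\<Sum>k<d. \<Sum>i<d. s i k * (b k powr q / q))"
    by (rule sum.swap)
  also have "\<dots> = (\<Sum>k<d. b k powr q / q)"
    unfolding sum_distrib_right[symmetric] s_def using unitary_col_norm[OF W] by simp
  also have "(\<Sum>i<d. \<Sum>k<d. s i k * (a i powr p / p)) = (\<Sum>i<d. a i powr p / p)"
    unfolding sum_distrib_right[symmetric] s_def using unitary_row_norm[OF W] by simp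
  also have "(\<Sum>i<d. a i powr p / p) + (\<Sum>k<d. b k powr q / q)
      = Re (trace (mpow A p)) / p + Re (trace (mpow B q)) / q"
    unfolding U(3) V(3) mpow_spec[OF U(1,2)] mpow_spec[OF V(1,2)] trace_spec[OF U(1)] trace_spec[OF V(1)]
    by (simp add: sum_divide_distrib)
  finally show ?thesis .
qed

text \<open>The missing weight may be thought of as sitting at 0, where the power vanishes. The
  proof takes Young's inequality with the power b - 1 of the mean as second factor, so that total
  weight at most 1 enters directly.\<close>

lemma powr_jensen_subnormalized:
  fixes b :: real
  assumes b: "1 < b" and w: "\<And>j. j \<in> I \<Longrightarrow> 0 \<le> w j" "sum w I \<le> 1" and r: "\<And>j. j \<in> I \<Longrightarrow> 0 \<le> r j"
  shows "(\<Sum>j\<in>I. w j * r j) powr b \<le> (\<Sum>j\<in>I. w j * r j powr b)"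
proof -
  define m where "m = (\<Sum>j\<in>I. w j * r j)"
  have m: "0 \<le> m" unfolding m_def using w r by (intro sum_nonneg) auto
  define c where "c = b / (b - 1)"
  have c: "1 < c" "1 / b + 1 / c = 1" using b by (auto simp: c_def field_simps)
  have mp: "m * m powr (b - 1) = m powr b" "(m powr (b - 1)) powr c = m powr b"
  proof -
    show "m * m powr (b - 1) = m powr b"
      using m by (cases "m = 0") (simp_all add: powr_mult_base)
    show "(m powr (b - 1)) powr c = m powr b"
      using b by (simp add: powr_powr c_def)
  qed
  have "m powr b = (\<Sum>j\<in>I. w j * (r j * m powr (b - 1)))"
    unfolding mp(1)[symmetric] by (simp add: m_def sum_distrib_right mult.assoc)
  also have "\<dots> \<le> (\<Sum>j\<in>I. w j * (r j powr b / b + m powr b / c))"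
    using Youngs_inequality[OF b c, of _ "m powr (b - 1)"] w r mp(2)
    by (intro sum_mono mult_left_mono) auto
  also have "\<dots> = (\<Sum>j\<in>I. w j * r j powr b) / b + sum w I * (m powr b / c)"
    by (simp add: distrib_left sum.distrib sum_distrib_right sum_divide_distrib)
  also have "\<dots> \<le> (\<Sum>j\<in>I. w j * r j powr b) / b + m powr b / c"
    using mult_right_mono[OF w(2), of "m powr b / c"] c b by simp
  finally have "m powr b * (1 - 1 / c) \<le> (\<Sum>j\<in>I. w j * r j powr b) / b" by (simp add: algebra_simps)
  moreover have "1 - 1 / c = 1 / b" using c by simp
  ultimately have "m powr b / b \<le> (\<Sum>j\<in>I. w j * r j powr b) / b" by simp
  then show ?thesis using b by (simp add: m_def divide_le_cancel)
qed

lemma psd_one_minus_projection: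
  assumes P: "psd d P" "P * P = P" shows "psd d (1\<^sub>m d - P)"
proof -
  have c: "P \<in> carrier_mat d d" using psd_carrier[OF P(1)] .
  then have c': "1\<^sub>m d - P \<in> carrier_mat d d" by (rule minus_carrier_mat)
  have "(1\<^sub>m d - P) * adj (1\<^sub>m d - P) = (1\<^sub>m d - P) * 1\<^sub>m d * (1\<^sub>m d - P)"
    using c c' psd_adj[OF P(1)] by (simp add: adj_minus[of _ d d])
  also have "\<dots> = 1\<^sub>m d - P"
    using c c' P(2) by (simp add: square_distribs[of _ d]) (rule eq_matI, auto)
  finally show ?thesis using psd_mult_adj[OF c'] by simp
qed

text \<open>Peierls--Berezin: each eigenvalue of \<open>P R P\<close> is a subnormalised average of the eigenvalues of \<open>R\<close>,
  so Jensen's inequality applies.\<close>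

lemma trace_mpow_compression:
  assumes R: "psd d R" and P: "psd d P" "P * P = P" and b: "1 < b"
  shows "Re (trace (mpow (P * R * P) b)) \<le> Re (trace (P * mpow R b))"
proof -
  note [simp] = square_assoc[of _ d]
  have Pa: "adj P = P" and Pc: "P \<in> carrier_mat d d" using psd_adj psd_carrier P by auto
  have PRP: "psd d (P * R * P)" using psd_congruence[OF R Pc] Pa by simp
  obtain U c where U: "unitary_mat d U" "\<forall>i. 0 \<le> c i" "P * R * P = spec d U c" using psd_spectral[OF PRP] .
  obtain V r where V: "unitary_mat d V" "\<forall>i. 0 \<le> r i" "R = spec d V r" using psd_spectral[OF R] .
  note UD = unitary_matD[OF U(1)] and VD = unitary_matD[OF V(1)]
  \<comment> \<open>The averaging weights are the squared moduli of the entries of K. Their row sums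
    are the diagonal of \<open>K * adj K = adj U * P * U\<close>, which lies below the
    identity.\<close>
  define K where "K = adj U * P * V"
  have K: "K \<in> carrier_mat d d" "adj K = adj V * P * U"
    using UD(1) VD(1) Pc Pa by (simp_all add: K_def adj_mult[of _ d d _ d])
  let ?D = "\<lambda>a. diag_of d (\<lambda>i. complex_of_real (a i))"
  have KR: "K * ?D a * adj K = adj U * (P * spec d V a * P) * U" for a
    unfolding K(2) unfolding K_def spec_def using UD(1) VD(1) Pc by simp
  have ci: "c i = (\<Sum>k<d. (cmod (K $$ (i,k)))\<^sup>2 * r k)" if "i < d" for i
  proof -
    have "K * ?D r * adj K = ?D c"
      unfolding KR V(3)[symmetric] U(3) adj_conj_spec[OF U(1)] ..
    then have "complex_of_real (\<Sum>k<d. (cmod (K $$ (i,k)))\<^sup>2 * r k) = complex_of_real (c i)"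
      using conj_diag_entry[OF K(1) that, of r] that by (simp add: diag_of_def)
    then show ?thesis by (simp only: of_real_eq_iff)
  qed
  have Ki: "(\<Sum>k<d. (cmod (K $$ (i,k)))\<^sup>2) \<le> 1" if "i < d" for i
  proof -
    have "K * adj K = adj U * (P * (V * adj V) * P) * U"
      unfolding K(2) unfolding K_def using UD(1) VD(1) Pc by simp
    also have "\<dots> = adj U * P * U" unfolding VD(2) using P(2) Pc UD(1) by simp
    finally have KK: "K * adj K = adj U * P * U" .
    have "adj U * (1\<^sub>m d - P) * U = adj U * U - K * adj K"
      unfolding KK using UD(1) Pc minus_carrier_mat[OF Pc, of "1\<^sub>m d"] by (simp add: square_distribs[of _ d])
    then have "psd d (1\<^sub>m d - K * adj K)"
      using psd_congruence_adj[OF psd_one_minus_projection[OF P] UD(1)] UD(3) by simp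
    from psd_diag_entry[OF this that] show ?thesis
      using mult_adj_entry[OF K(1) that] K(1) that by (simp del: index_mult_mat(1))
  qed
  have "Re (trace (mpow (P * R * P) b)) = (\<Sum>i<d. c i powr b)"
    unfolding U(3) mpow_spec[OF U(1,2)] trace_spec[OF U(1)] by simp
  also have "\<dots> \<le> (\<Sum>i<d. \<Sum>k<d. (cmod (K $$ (i,k)))\<^sup>2 * r k powr b)"
    using ci powr_jensen_subnormalized[OF b, of "{..<d}" _ r] Ki V(2) by (intro sum_mono) simp
  also have "\<dots> = Re (\<Sum>i<d. (K * ?D (\<lambda>k. r k powr b) * adj K) $$ (i,i))"
    using conj_diag_entry[OF K(1), of _ "\<lambda>k. r k powr b"] by (simp del: index_mult_mat(1) of_real_sum)
  also have "\<dots> = Re (trace (adj U * (P * mpow R b * P) * U))"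
    unfolding KR V(3) mpow_spec[OF V(1,2)] using UD(1) Pc by (simp add: trace_def)
  also have "trace (adj U * (P * mpow R b * P) * U) = trace (P * mpow R b * P)"
    using Pc mpow_carrier[OF R] by (intro trace_unitary_conj[OF U(1)]) simp
  also have "\<dots> = trace (P * mpow R b)"
    using trace_conj_left[OF Pc mpow_carrier[OF R] Pc, of b] P(2) Pc mpow_carrier[OF R] by simp
  finally show ?thesis .
qed

text \<open>In an eigenbasis of \<open>H * adj H\<close> the i-th row of the rotated H has norm
  \<open>sqrt (lam i)\<close>, which dominates its i-th diagonal entry. This is the half of the
  variational formula for the trace norm that bounds a fidelity from below.\<close>

lemma trace_msqrt_ge:
  assumes H: "H \<in> carrier_mat d d"
  shows "Re (trace H) \<le> Re (trace (msqrt (H * adj H)))"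
proof -
  note [simp] = square_assoc[of _ d]
  obtain U lam where U: "unitary_mat d U" "\<forall>i. 0 \<le> lam i" "H * adj H = spec d U lam"
    using psd_spectral[OF psd_mult_adj[OF H]] .
  note UD = unitary_matD[OF U(1)]
  define K where "K = adj U * H * U"
  have K: "K \<in> carrier_mat d d" using UD(1) H by (simp add: K_def)
  have "K * adj K = adj U * (H * ((U * adj U) * adj H)) * U"
    using UD(1) H by (simp add: K_def adj_mult[of _ d d _ d])
  also have "\<dots> = adj U * (H * adj H) * U"
    unfolding UD(2) using H UD(1) by simp
  also have "\<dots> = diag_of d (\<lambda>i. complex_of_real (lam i))"
    unfolding U(3) by (rule adj_conj_spec[OF U(1)])
  finally have KK: "K * adj K = diag_of d (\<lambda>i. complex_of_real (lam i))" .
  have "Re (K $$ (i,i)) \<le> lam i powr (1/2)" if i: "i < d" for i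
  proof -
    have "complex_of_real (\<Sum>k<d. (cmod (K $$ (i,k)))\<^sup>2) = complex_of_real (lam i)"
      using mult_adj_entry[OF K i] i unfolding KK by (simp add: diag_of_def)
    then have "(\<Sum>k<d. (cmod (K $$ (i,k)))\<^sup>2) = lam i" by (simp only: of_real_eq_iff)
    moreover have "(cmod (K $$ (i,i)))\<^sup>2 \<le> (\<Sum>k<d. (cmod (K $$ (i,k)))\<^sup>2)"
      using i by (intro member_le_sum) auto
    ultimately have "cmod (K $$ (i,i)) \<le> sqrt (lam i)" by (simp add: real_le_rsqrt)
    then show ?thesis using complex_Re_le_cmod[of "K $$ (i,i)"] U(2) by (simp add: powr_half_sqrt)
  qed
  then have "Re (trace K) \<le> (\<Sum>i<d. lam i powr (1/2))"
    using K by (auto simp: trace_def intro!: sum_mono)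
  also have "\<dots> = Re (trace (msqrt (H * adj H)))"
    unfolding msqrt_def U(3) mpow_spec[OF U(1,2)] trace_spec[OF U(1)] by simp
  finally show ?thesis using trace_unitary_conj[OF U(1) H] by (simp add: K_def)
qed

lemma msqrt_psd: "psd d A \<Longrightarrow> psd d (msqrt A)"
  unfolding msqrt_def by (rule mpow_psd)

text \<open>Operator monotonicity of the square root: the difference D of the roots has nonnegative
  eigenvalues, so pairing it with sqrt(A) gives a nonnegative trace. Everything is computed in an
  eigenbasis of D.\<close>

lemma trace_le_trace_msqrt_mult:
  assumes A: "psd d A" and B: "psd d B" and BA: "psd d (B - A)"
  shows "Re (trace A) \<le> Re (trace (msqrt A * msqrt B))"
proof -
  note [simp] = square_assoc[of _ d]
  define D where "D = msqrt B - msqrt A"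
  have a: "psd d (msqrt A)" and b: "psd d (msqrt B)" using msqrt_psd A B by auto
  note c = psd_carrier[OF a] psd_carrier[OF b]
  have D: "D \<in> carrier_mat d d" "adj D = D"
    using c psd_adj[OF a] psd_adj[OF b] by (simp_all add: D_def adj_minus[of _ d d] minus_carrier_mat)
  obtain U m where U: "unitary_mat d U" and Dm: "D = spec d U m" using hermitian_spec[OF D] .
  note UD = unitary_matD[OF U]
  let ?M = "diag_of d (\<lambda>i. complex_of_real (m i))"
  define A' where "A' = adj U * msqrt A * U"
  define B' where "B' = adj U * msqrt B * U"
  have A': "psd d A'" and B': "psd d B'"
    unfolding A'_def B'_def using psd_congruence_adj a b UD(1) by auto
  note c' = psd_carrier[OF A'] psd_carrier[OF B']
  have M: "?M = B' - A'"
    using adj_conj_spec[OF U, of m] UD(1) c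
    unfolding Dm[symmetric] by (simp add: D_def A'_def B'_def square_distribs[of _ d] minus_carrier_mat)
  have sq: "adj U * A * U = A' * A'" "adj U * B * U = B' * B'"
  proof -
    have *: "adj U * (X * X) * U = (adj U * X * U) * (adj U * X * U)" if "X \<in> carrier_mat d d" for X
    proof -
      have "(adj U * X * U) * (adj U * X * U) = adj U * X * (U * adj U) * X * U" using that UD(1) by simp
      then show ?thesis unfolding UD(2) using that UD(1) by simp
    qed
    show "adj U * A * U = A' * A'" "adj U * B * U = B' * B'"
      using *[OF c(1)] *[OF c(2)] unfolding msqrt_mult[OF A] msqrt_mult[OF B] A'_def B'_def by auto
  qed
  \<comment> \<open>\<open>B'^2 - A'^2 = B' (B' - A') + (B' - A') A'\<close>, and the difference is
    the diagonal matrix \<open>?M\<close>, so the i-th diagonal entry is m(i) times a sum of two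
    diagonal entries.\<close>
  have split: "adj U * (B - A) * U = B' * ?M + ?M * A'"
  proof -
    have "adj U * (B - A) * U = B' * B' - A' * A'"
      using UD(1) psd_carrier[OF A] psd_carrier[OF B] sq by (simp add: square_distribs[of _ d] minus_carrier_mat)
    also have "\<dots> = B' * ?M + ?M * A'"
      unfolding M using c' by (simp add: square_distribs[of _ d]) (rule eq_matI, auto)
    finally show ?thesis .
  qed
  \<comment> \<open>A negative m(i) would force both nonnegative diagonal entries to vanish, but
    m(i) is their difference.\<close>
  have m: "0 \<le> m i" if i: "i < d" for i
  proof -
    have "0 \<le> Re ((adj U * (B - A) * U) $$ (i,i))"
      by (rule psd_diag_entry[OF psd_congruence_adj[OF BA UD(1)] i])
    then have "0 \<le> m i * (Re (B' $$ (i,i)) + Re (A' $$ (i,i)))"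
      unfolding split using c' i
      by (simp add: index_mult_diag index_diag_mult algebra_simps del: index_mult_mat(1))
    moreover have "m i = Re (B' $$ (i,i)) - Re (A' $$ (i,i))"
    proof -
      have "?M $$ (i,i) = (B' - A') $$ (i,i)" by (simp only: M)
      then show ?thesis using c' i by (simp add: diag_of_def complex_eq_iff)
    qed
    moreover have "0 \<le> Re (A' $$ (i,i))" "0 \<le> Re (B' $$ (i,i))"
      using psd_diag_entry[OF A' i] psd_diag_entry[OF B' i] by auto
    ultimately show ?thesis by (smt (verit) mult_neg_pos)
  qed
  have "trace (msqrt A * D) = trace (adj U * (msqrt A * D) * U)"
    using trace_unitary_conj[OF U, of "msqrt A * D"] c D by simp
  also have "adj U * (msqrt A * D) * U = adj U * msqrt A * (U * adj U) * D * U"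
    unfolding UD(2) using c D UD(1) by simp
  also have "\<dots> = A' * (adj U * D * U)" using c D UD(1) by (simp add: A'_def)
  also have "\<dots> = A' * ?M" unfolding Dm adj_conj_spec[OF U] ..
  also have "trace \<dots> = (\<Sum>i<d. A' $$ (i,i) * m i)"
    using c' by (simp add: trace_def index_mult_diag del: index_mult_mat(1))
  finally have "0 \<le> Re (trace (msqrt A * D))"
    using psd_diag_entry[OF A'] m by (auto intro!: sum_nonneg mult_nonneg_nonneg)
  moreover have "msqrt A * D = msqrt A * msqrt B - A"
    using c msqrt_mult[OF A] by (simp add: D_def square_distribs[of _ d])
  ultimately show ?thesis using c psd_carrier[OF A] by (simp add: trace_minus[of _ d])
qed

section \<open>From the sandwiched divergence to a smoothed operator inequality\<close>

lemma minus_add_cancel_mat: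
  fixes A :: "complex mat"
  assumes "A \<in> carrier_mat n m" "X \<in> carrier_mat n m" "Y \<in> carrier_mat n m"
  shows "A - (X + Y) + Y = A - X"
  using assms by (intro eq_matI) auto

text \<open>The chain rule is a multiplicative identity for this trace, so it is kept apart from the
  logarithm in \<open>sandD\<close>. The support condition travels separately as
  \<open>supp_le\<close>: without it the power on the support still gives a finite value, which may
  miss part of the state.\<close>

definition sandwich :: "real \<Rightarrow> complex mat \<Rightarrow> complex mat \<Rightarrow> real" where
  "sandwich \<alpha> \<rho> \<sigma> = (let s = mpow \<sigma> ((1 - \<alpha>) / (2 * \<alpha>)) in Re (trace (mpow (s * \<rho> * s) \<alpha>)))"

text \<open>Since \<open>0 powr 0 = 0\<close>, \<open>mpow A 0\<close> is the projection onto the support of \<open>A\<close>.\<close>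

lemma support_projection:
  assumes "psd d A"
  shows "psd d (mpow A 0)" "mpow A 0 * mpow A 0 = mpow A 0" "mpow A 0 * A = A" "A * mpow A 0 = A"
  using mpow_psd[OF assms, of 0] mpow_mult[OF assms, of 0 0] mpow_mult[OF assms, of 0 1] mpow_mult[OF assms, of 1 0]
  by (simp_all add: mpow_one[OF assms])

text \<open>Turns an inclusion of kernels into an identity that can be multiplied and conjugated.
  The columns of 1 - B^0 lie in the kernel of B; conversely B^0 = B^(-1) B kills that
  kernel.\<close>

lemma supp_le_iff:
  assumes A: "A \<in> carrier_mat d d" and B: "psd d B"
  shows "supp_le A B \<longleftrightarrow> A * mpow B 0 = A"
proof
  note S = support_projection[OF B] and Bc = psd_carrier[OF B]
  note Pc = psd_carrier[OF S(1)]
  have Qc: "1\<^sub>m d - mpow B 0 \<in> carrier_mat d d" using Pc by (rule minus_carrier_mat)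
  {
    assume supp: "supp_le A B"
    have BQ: "B * (1\<^sub>m d - mpow B 0) = 0\<^sub>m d d"
      using Bc Pc S(4) by (simp add: square_distribs[of _ d])
    have "A * (1\<^sub>m d - mpow B 0) = 0\<^sub>m d d"
    proof (rule mat_col_eqI)
      fix j assume "j < dim_col (0\<^sub>m d d :: complex mat)"
      then have j: "j < d" by simp
      let ?v = "col (1\<^sub>m d - mpow B 0) j"
      have v: "?v \<in> carrier_vec d" using Qc j by auto
      have "B *\<^sub>v ?v = 0\<^sub>v d"
        using col_mult2[OF Bc Qc j] j unfolding BQ by simp
      then have "A *\<^sub>v ?v = 0\<^sub>v d" using supp v A Bc by (auto simp: supp_le_def)
      then show "col (A * (1\<^sub>m d - mpow B 0)) j = col (0\<^sub>m d d) j"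
        using col_mult2[OF A Qc j] j by simp
    qed (use A Pc in auto)
    then have "A - A * mpow B 0 = 0\<^sub>m d d"
      using A Pc by (simp add: square_distribs[of _ d])
    then have "(A - A * mpow B 0) $$ (i,j) = 0" if "i < d" "j < d" for i j using that by simp
    then show "A * mpow B 0 = A" using A Pc by (intro eq_matI) auto
  }
  assume AP: "A * mpow B 0 = A"
  show "supp_le A B" unfolding supp_le_def
  proof (intro ballI impI)
    fix v assume v: "v \<in> carrier_vec (dim_row B)" "B *\<^sub>v v = 0\<^sub>v (dim_row B)"
    have "mpow B 0 = mpow B (-1) * B" using mpow_mult[OF B, of "-1" 1] mpow_one[OF B] by simp
    then have "mpow B 0 *\<^sub>v v = mpow B (-1) *\<^sub>v (B *\<^sub>v v)"
      using v Bc mpow_carrier[OF B, of "-1"] by (simp add: assoc_mult_mat_vec[of _ d d _ d])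
    also have "\<dots> = 0\<^sub>v d" using v Bc mpow_carrier[OF B, of "-1"] by auto
    finally have "A *\<^sub>v (mpow B 0 *\<^sub>v v) = 0\<^sub>v d" using A by auto
    then have "(A * mpow B 0) *\<^sub>v v = 0\<^sub>v d"
      using v A Bc Pc by (simp add: assoc_mult_mat_vec[of _ d d _ d])
    then show "A *\<^sub>v v = 0\<^sub>v (dim_row A)" unfolding AP using A by simp
  qed
qed

text \<open>The consequence of data processing for a test \<open>P\<close>, obtained from Young's inequality applied to
  \<open>Tr P \<rho> = Tr (r P r) (s \<rho> s)\<close> where \<open>r\<close> is the pseudo-inverse of \<open>s\<close>.\<close>

lemma sandwich_test_bound:
  assumes \<rho>: "psd d \<rho>" and \<sigma>: "psd d \<sigma>" and supp: "supp_le \<rho> \<sigma>" and P: "psd d P" "P * P = P"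
    and \<alpha>: "1 < \<alpha>" and l: "0 < l" and le: "l * Re (trace (P * \<sigma>)) \<le> Re (trace (P * \<rho>))"
  shows "Re (trace (P * \<rho>)) \<le> l powr (1 - \<alpha>) * sandwich \<alpha> \<rho> \<sigma>"
proof -
  note [simp] = square_assoc[of _ d]
  define s where "s = mpow \<sigma> ((1 - \<alpha>) / (2 * \<alpha>))"
  define r where "r = mpow \<sigma> ((\<alpha> - 1) / (2 * \<alpha>))"
  define W where "W = s * \<rho> * s"
  define B where "B = r * P * r"
  define b where "b = \<alpha> / (\<alpha> - 1)"
  \<comment> \<open>Young's inequality will be applied to cB and W/c. The choice c^b = l makes the
    assumption on l absorb the first term into Tr(P \<rho>), and it makes the second term carry
    (1/c)^\<alpha> = l^(1-\<alpha>).\<close>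
  define c where "c = l powr (1 / b)"
  have b: "1 < b" "1 / b + 1 / \<alpha> = 1" using \<alpha> by (auto simp: b_def field_simps)
  have c: "0 < c" "c powr b = l" "(1 / c) powr \<alpha> = l powr (1 - \<alpha>)"
  proof -
    show "0 < c" "c powr b = l" using l b by (simp_all add: c_def powr_powr)
    have "(1 / c) powr \<alpha> = l powr (- (1 / b) * \<alpha>)"
      using l by (simp add: c_def powr_minus_divide[symmetric] powr_powr)
    also have "- (1 / b) * \<alpha> = 1 - \<alpha>" using \<alpha> by (simp add: b_def field_simps)
    finally show "(1 / c) powr \<alpha> = l powr (1 - \<alpha>)" .
  qed
  have cs: "s \<in> carrier_mat d d" "r \<in> carrier_mat d d" "\<rho> \<in> carrier_mat d d" "\<sigma> \<in> carrier_mat d d" "P \<in> carrier_mat d d"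
    "mpow \<sigma> 0 \<in> carrier_mat d d"
    using mpow_carrier[OF \<sigma>] psd_carrier \<rho> \<sigma> P by (auto simp: s_def r_def)
  have adjs: "adj s = s" "adj r = r" "adj P = P"
    using mpow_adj[OF \<sigma>] psd_adj[OF P(1)] by (auto simp: s_def r_def)
  have W: "psd d W" unfolding W_def using psd_congruence[OF \<rho> cs(1)] adjs by simp
  have B: "psd d B" unfolding B_def using psd_congruence[OF P(1) cs(2)] adjs by simp
  note Wc = psd_carrier[OF W] and Bc = psd_carrier[OF B]
  have rs: "r * s = mpow \<sigma> 0" "s * r = mpow \<sigma> 0"
    using \<alpha> by (simp_all add: r_def s_def mpow_mult[OF \<sigma>] flip: add_divide_distrib)
  have \<rho>0: "\<rho> * mpow \<sigma> 0 = \<rho>" using supp supp_le_iff[OF cs(3) \<sigma>] by simp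
  have "adj (\<rho> * mpow \<sigma> 0) = mpow \<sigma> 0 * \<rho>"
    using adj_mult[OF cs(3,6)] psd_adj[OF \<rho>] mpow_adj[OF \<sigma>] by simp
  then have \<rho>0': "mpow \<sigma> 0 * \<rho> = \<rho>" using \<rho>0 psd_adj[OF \<rho>] by simp
  have "r * W * r = (r * s) * \<rho> * (s * r)" using cs by (simp add: W_def)
  then have rWr: "r * W * r = \<rho>" using \<rho>0 \<rho>0' cs by (simp add: rs)
  have "trace (P * \<rho>) = trace ((P * (r * W)) * r)" using cs Wc by (simp add: rWr[symmetric])
  also have "\<dots> = trace (r * (P * (r * W)))" using cs Wc by (intro trace_comm[of _ d d]) auto
  also have "r * (P * (r * W)) = B * W" using cs Wc by (simp add: B_def)
  finally have "trace (P * \<rho>) = trace ((complex_of_real c \<cdot>\<^sub>m B) * (complex_of_real (1 / c) \<cdot>\<^sub>m W))"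
    using Wc Bc c(1)
    by (simp add: mult_smult_distrib[of _ d d _ d] mult_smult_assoc_mat[of _ d d _ d] trace_smult[of _ d])
  also have "Re \<dots> \<le> Re (trace (mpow (complex_of_real c \<cdot>\<^sub>m B) b)) / b
      + Re (trace (mpow (complex_of_real (1 / c) \<cdot>\<^sub>m W) \<alpha>)) / \<alpha>"
    using c(1) b \<alpha> by (intro trace_mult_Young[OF psd_smult[OF B] psd_smult[OF W]]) auto
  also have "Re (trace (mpow (complex_of_real c \<cdot>\<^sub>m B) b)) = l * Re (trace (mpow B b))"
    using c mpow_carrier[OF B] by (simp add: mpow_smult[OF B] trace_smult[of _ d])
  also have "Re (trace (mpow (complex_of_real (1 / c) \<cdot>\<^sub>m W) \<alpha>)) = l powr (1 - \<alpha>) * sandwich \<alpha> \<rho> \<sigma>"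
    using c mpow_carrier[OF W] unfolding sandwich_def Let_def s_def[symmetric] W_def[symmetric]
    by (subst mpow_smult[OF W]) (simp_all add: trace_smult[of _ d])
  \<comment> \<open>B = r P r has the same power traces as P r^2 P; compression moves the power b
    onto r^2, and b is the exponent for which this power is \<sigma> again.\<close>
  also have "l * Re (trace (mpow B b)) \<le> Re (trace (P * \<rho>))"
  proof -
    define Z where "Z = P * r"
    have Z: "Z \<in> carrier_mat d d" using cs by (simp add: Z_def)
    have "B = adj Z * Z"
    proof -
      have "adj Z * Z = r * (P * P) * r" using cs adjs by (simp add: Z_def adj_mult[of _ d d _ d])
      then show ?thesis unfolding P(2) B_def by simp
    qed
    then have "trace (mpow B b) = trace (mpow (Z * adj Z) b)" using trace_mpow_swap[OF Z] by simp
    also have "Z * adj Z = P * (r * r) * P" using cs adjs by (simp add: Z_def adj_mult[of _ d d _ d])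
    also have "r * r = mpow \<sigma> ((\<alpha> - 1) / \<alpha>)"
    proof -
      have "(\<alpha> - 1) / (2 * \<alpha>) + (\<alpha> - 1) / (2 * \<alpha>) = (\<alpha> - 1) / \<alpha>" using \<alpha> by simp
      then show ?thesis unfolding r_def mpow_mult[OF \<sigma>] by simp
    qed
    finally have "Re (trace (mpow B b)) \<le> Re (trace (P * mpow (mpow \<sigma> ((\<alpha> - 1) / \<alpha>)) b))"
      using trace_mpow_compression[OF mpow_psd[OF \<sigma>] P b(1)] by simp
    also have "mpow (mpow \<sigma> ((\<alpha> - 1) / \<alpha>)) b = \<sigma>"
      using \<alpha> by (simp add: mpow_mpow[OF \<sigma>] b_def mpow_one[OF \<sigma>])
    finally show ?thesis using l le by (smt (verit) mult_left_mono)
  qed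
  finally have "Re (trace (P * \<rho>)) \<le> Re (trace (P * \<rho>)) / b + l powr (1 - \<alpha>) * sandwich \<alpha> \<rho> \<sigma> / \<alpha>"
    using b by (simp add: divide_right_mono)
  then have "Re (trace (P * \<rho>)) * (1 - 1 / b) \<le> l powr (1 - \<alpha>) * sandwich \<alpha> \<rho> \<sigma> / \<alpha>"
    by (simp add: algebra_simps)
  moreover have "1 - 1 / b = 1 / \<alpha>" using b by simp
  ultimately have "Re (trace (P * \<rho>)) / \<alpha> \<le> l powr (1 - \<alpha>) * sandwich \<alpha> \<rho> \<sigma> / \<alpha>" by simp
  then show ?thesis using \<alpha> by (simp add: divide_le_cancel)
qed

text \<open>The trivial test P = 1 with l = 1; this is nonnegativity of the divergence.\<close>

lemma sandwich_ge_one: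
  assumes \<rho>: "dens d \<rho>" and \<sigma>: "subdens d \<sigma>" and supp: "supp_le \<rho> \<sigma>" and \<alpha>: "1 < \<alpha>"
  shows "1 \<le> sandwich \<alpha> \<rho> \<sigma>"
proof -
  have r: "psd d \<rho>" "trace \<rho> = 1" and s: "psd d \<sigma>" "Re (trace \<sigma>) \<le> 1"
    using \<rho> \<sigma> by (auto simp: dens_def subdens_def)
  show ?thesis
    using sandwich_test_bound[OF r(1) s(1) supp psd_one _ \<alpha>, of 1] r(2) s(2)
    unfolding left_mult_one_mat[OF psd_carrier[OF r(1)]] left_mult_one_mat[OF psd_carrier[OF s(1)]] by simp
qed

text \<open>With \<open>\<Delta>\<close> the positive part of \<open>\<rho> - l \<sigma>\<close>, \<open>A = l \<sigma>\<close> and \<open>B = A + \<Delta> \<ge> \<rho>\<close>, the contraction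
  \<open>G = A\<^sup>1\<^sup>/\<^sup>2 B\<^sup>-\<^sup>1\<^sup>/\<^sup>2\<close> maps \<open>\<rho>\<close> below \<open>G B G\<^sup>* \<le> A\<close> and loses at most \<open>Tr \<Delta>\<close> of fidelity.\<close>

lemma exists_smoothed_state:
  assumes \<rho>: "dens d \<rho>" and \<sigma>: "psd d \<sigma>" and l: "0 \<le> l"
  obtains P \<rho>' where "psd d P" "P * P = P" "l * Re (trace (P * \<sigma>)) \<le> Re (trace (P * \<rho>))"
    "subdens d \<rho>'" "psd d (complex_of_real l \<cdot>\<^sub>m \<sigma> - \<rho>')" "1 - Re (trace (P * \<rho>)) \<le> gen_fidelity \<rho>' \<rho>"
proof -
  note [simp] = square_assoc[of _ d] minus_carrier_mat
  have r: "psd d \<rho>" "trace \<rho> = 1" using \<rho> by (auto simp: dens_def)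
  define A where "A = complex_of_real l \<cdot>\<^sub>m \<sigma>"
  have A: "psd d A" unfolding A_def by (rule psd_smult[OF \<sigma> l])
  note Ac = psd_carrier[OF A] and rc = psd_carrier[OF r(1)] and sc = psd_carrier[OF \<sigma>]
  have "\<rho> - A \<in> carrier_mat d d" "adj (\<rho> - A) = \<rho> - A"
    using Ac rc psd_adj[OF A] psd_adj[OF r(1)] by (simp_all add: adj_minus[of _ d d])
  then obtain U k where U: "unitary_mat d U" and Uk: "\<rho> - A = spec d U k" by (rule hermitian_spec)
  define P where "P = spec d U (\<lambda>i. if k i > 0 then 1 else 0)"
  define \<Delta> where "\<Delta> = spec d U (\<lambda>i. max (k i) 0)"
  \<comment> \<open>The negative part of \<rho> - A, so that A + \<Delta> = \<rho> + N: this single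
    operator B dominates both A and \<rho>.\<close>
  define N where "N = spec d U (\<lambda>i. max (k i) 0 - k i)"
  define B where "B = A + \<Delta>"
  have P: "psd d P" "P * P = P"
    unfolding P_def spec_mult[OF U] by (auto intro!: psd_spec[OF U] spec_cong)
  have D: "psd d \<Delta>" unfolding \<Delta>_def by (rule psd_spec[OF U]) simp
  have N: "psd d N" unfolding N_def by (rule psd_spec[OF U]) simp
  have B: "psd d B" unfolding B_def by (rule psd_add[OF A D])
  note cs = psd_carrier[OF P(1)] psd_carrier[OF D] psd_carrier[OF N] psd_carrier[OF B] Ac rc sc
  have PD: "P * (\<rho> - A) = \<Delta>"
    unfolding Uk P_def \<Delta>_def spec_mult[OF U] by (rule spec_cong) simp
  have "N + (\<rho> - A) = \<Delta>"
    unfolding N_def Uk \<Delta>_def spec_def using unitary_matD(1)[OF U]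
    by (subst square_distribs(1)[symmetric, of _ d], simp_all, subst square_distribs(2)[symmetric, of _ d])
      (simp_all, intro arg_cong2[of _ _ _ _ "(*)"] refl eq_matI, auto simp: diag_of_def)
  then have BN: "B = \<rho> + N"
  proof -
    have "B $$ (i,j) = (\<rho> + N) $$ (i,j)" if "i < d" "j < d" for i j
      unfolding B_def \<open>N + (\<rho> - A) = \<Delta>\<close>[symmetric] using cs that by simp
    then show ?thesis using cs by (intro eq_matI) auto
  qed
  have trD: "Re (trace \<Delta>) = Re (trace (P * \<rho>)) - l * Re (trace (P * \<sigma>))"
    unfolding PD[symmetric] A_def using cs
    by (simp add: square_distribs[of _ d] trace_minus[of _ d] trace_smult[of _ d] mult_smult_distrib[of _ d d _ d])
  have leP: "l * Re (trace (P * \<sigma>)) \<le> Re (trace (P * \<rho>))" using trD psd_trace[OF D] by simp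
  have trD_le: "Re (trace \<Delta>) \<le> Re (trace (P * \<rho>))"
    using trD l psd_trace_mult_nonneg[OF P(1) \<sigma>] by simp
  define C where "C = mpow B (- 1 / 2)"
  define G where "G = msqrt A * C"
  have C: "psd d C" unfolding C_def by (rule mpow_psd[OF B])
  have a: "psd d (msqrt A)" by (rule msqrt_psd[OF A])
  note gs = psd_carrier[OF C] psd_carrier[OF a] psd_adj[OF C] psd_adj[OF a]
  have G: "G \<in> carrier_mat d d" "adj G = C * msqrt A"
    using gs by (simp_all add: G_def adj_mult[of _ d d _ d])
  define S where "S = mpow B 0"
  note S = support_projection[OF B, folded S_def]
  note Sc = psd_carrier[OF S(1)]
  have CBC: "C * B * C = S" "C * B = msqrt B"
    using mpow_mult[OF B, of "-1/2" 1] mpow_mult[OF B, of "1/2" "-1/2"]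
    by (simp_all add: C_def S_def mpow_one[OF B] msqrt_def)
  have S1: "psd d (1\<^sub>m d - S)" by (rule psd_one_minus_projection[OF S(1,2)])
  have "G * B * adj G = msqrt A * (C * B * C) * msqrt A" unfolding G(2) unfolding G_def using gs cs by simp
  then have GBG: "G * B * adj G = msqrt A * S * msqrt A" unfolding CBC(1) .
  have "adj G * G = C * (msqrt A * msqrt A) * C" unfolding G(2) unfolding G_def using gs by simp
  then have GG: "adj G * G = C * A * C" unfolding msqrt_mult[OF A] .
  \<comment> \<open>C B C = S and B = A + \<Delta> give 1 - G*G = (1 - S) + C \<Delta> C, a sum of
    two positive operators.\<close>
  have contr: "psd d (1\<^sub>m d - adj G * G)"
  proof -
    have "psd d ((1\<^sub>m d - S) + C * \<Delta> * adj C)" by (rule psd_add[OF S1 psd_congruence[OF D gs(1)]])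
    moreover have "(1\<^sub>m d - S) + C * \<Delta> * adj C = 1\<^sub>m d - adj G * G"
    proof -
      have "C * B * C = C * A * C + C * \<Delta> * C"
        unfolding B_def using cs gs by (simp add: square_distribs[of _ d])
      then have "S = adj G * G + C * \<Delta> * adj C" unfolding CBC(1) GG gs(3) .
      moreover have "C * \<Delta> * adj C \<in> carrier_mat d d" "adj G * G \<in> carrier_mat d d" using cs gs G by auto
      ultimately show ?thesis using minus_add_cancel_mat[of "1\<^sub>m d" d d] by simp
    qed
    ultimately show ?thesis by simp
  qed
  define \<rho>' where "\<rho>' = G * \<rho> * adj G"
  have r': "psd d \<rho>'" unfolding \<rho>'_def by (rule psd_congruence[OF r(1) G(1)])
  have trGXG: "Re (trace (G * X * adj G)) \<le> Re (trace X)" if X: "psd d X" for X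
  proof -
    have Xc: "X \<in> carrier_mat d d" using psd_carrier[OF X] .
    have "trace (G * X * adj G) = trace (adj G * G * X)"
      by (rule trace_conj_left[OF G(1) Xc adj_carrier[OF G(1)]])
    moreover have "0 \<le> Re (trace ((1\<^sub>m d - adj G * G) * X))"
      by (rule psd_trace_mult_nonneg[OF contr X])
    moreover have "(1\<^sub>m d - adj G * G) * X = X - adj G * G * X"
      using G(1) Xc by (subst minus_mult_distrib_mat[of _ d d _ _ d]) auto
    ultimately show ?thesis using G(1) Xc by (simp add: trace_minus[of _ d])
  qed
  have sub: "subdens d \<rho>'"
    using r' trGXG[OF r(1)] r(2) by (simp add: subdens_def \<rho>'_def)
  \<comment> \<open>Writing B = \<rho> + N in G B G* = sqrt(A) S sqrt(A) gives A - \<rho>' = sqrt(A)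
    (1 - S) sqrt(A) + G N G*.\<close>
  have le: "psd d (A - \<rho>')"
  proof -
    have "psd d (msqrt A * (1\<^sub>m d - S) * adj (msqrt A) + G * N * adj G)"
      by (rule psd_add[OF psd_congruence[OF S1 gs(2)] psd_congruence[OF N G(1)]])
    moreover have "msqrt A * (1\<^sub>m d - S) * adj (msqrt A) + G * N * adj G = A - \<rho>'"
    proof -
      have "msqrt A * (1\<^sub>m d - S) * adj (msqrt A) = A - msqrt A * S * msqrt A"
        using gs Sc msqrt_mult[OF A] by (simp add: square_distribs[of _ d])
      moreover have "msqrt A * S * msqrt A = \<rho>' + G * N * adj G"
        unfolding GBG[symmetric] BN \<rho>'_def using G(1) cs by (simp add: square_distribs[of _ d])
      moreover have "G * N * adj G \<in> carrier_mat d d" "\<rho>' \<in> carrier_mat d d" using psd_carrier[OF psd_congruence[OF N G(1)]] psd_carrier[OF r'] by auto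
      ultimately show ?thesis using minus_add_cancel_mat[OF Ac] by simp
    qed
    ultimately show ?thesis by simp
  qed
  have GN: "Re (trace (G * N)) \<le> Re (trace N)"
  proof -
    let ?E = "1\<^sub>m d - G"
    have E: "?E \<in> carrier_mat d d" "adj ?E = 1\<^sub>m d - adj G"
      using G(1) by (simp_all add: adj_minus[of _ d d])
    have "?E * N * adj ?E = N - G * N - (N * adj G - G * N * adj G)"
      unfolding E(2) using G(1) cs by (simp add: square_distribs[of _ d])
    then have "Re (trace (?E * N * adj ?E))
        = Re (trace N) - Re (trace (G * N)) - (Re (trace (N * adj G)) - Re (trace (G * N * adj G)))"
      using G(1) cs by (simp add: trace_minus[of _ d] del: square_assoc)
    moreover have "N * adj G = adj (G * N)" using G(1) cs psd_adj[OF N] by (simp add: adj_mult[of _ d d _ d])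
    then have "Re (trace (N * adj G)) = Re (trace (G * N))" using G(1) cs by (simp add: trace_adj[of _ d])
    moreover have "0 \<le> Re (trace (?E * N * adj ?E))" by (rule psd_trace[OF psd_congruence[OF N E(1)]])
    ultimately show ?thesis using trGXG[OF N] by linarith
  qed
  \<comment> \<open>C B is the square root of B, so G B = sqrt(A) sqrt(B), and A \<le> B.\<close>
  have GB: "Re (trace A) \<le> Re (trace (G * B))"
  proof -
    have "G * B = msqrt A * (C * B)" unfolding G_def using gs cs by simp
    moreover have "B - A = \<Delta>" unfolding B_def using cs by (intro eq_matI) auto
    ultimately show ?thesis using trace_le_trace_msqrt_mult[OF A B] D unfolding CBC(2) by simp
  qed
  have "G * B = G * \<rho> + G * N" unfolding BN using G(1) cs by (simp add: square_distribs[of _ d])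
  then have "Re (trace (G * B)) = Re (trace (G * \<rho>)) + Re (trace (G * N))"
    using G(1) cs by (simp add: trace_add[of _ d])
  moreover have "Re (trace A) + Re (trace \<Delta>) = 1 + Re (trace N)"
  proof -
    have "trace B = trace A + trace \<Delta>" "trace B = trace \<rho> + trace N"
      using cs trace_add[of A d \<Delta>] trace_add[of \<rho> d N] BN by (auto simp: B_def)
    then show ?thesis using r(2) by (metis add.commute one_complex.simps(1) plus_complex.simps(1))
  qed
  \<comment> \<open>Re Tr(G \<rho>) = Re Tr(G B) - Re Tr(G N) is at least Tr A - Tr N, and comparing
    the two expressions for Tr B identifies this as 1 - Tr \<Delta>.\<close>
  ultimately have G\<rho>: "1 - Re (trace \<Delta>) \<le> Re (trace (G * \<rho>))" using GB GN by linarith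
  have q: "msqrt \<rho> \<in> carrier_mat d d" "adj (msqrt \<rho>) = msqrt \<rho>"
    using psd_carrier[OF msqrt_psd[OF r(1)]] psd_adj[OF msqrt_psd[OF r(1)]] by auto
  have q': "msqrt \<rho>' \<in> carrier_mat d d" "adj (msqrt \<rho>') = msqrt \<rho>'"
    using psd_carrier[OF msqrt_psd[OF r']] psd_adj[OF msqrt_psd[OF r']] by auto
  \<comment> \<open>The squared modulus of sqrt(\<rho>') sqrt(\<rho>) equals H H*, so its trace norm
    is at least Re Tr H = Re Tr(G \<rho>). Because \<rho> has trace 1, the correction term in
    \<open>gen_fidelity\<close> is zero.\<close>
  define H where "H = msqrt \<rho> * G * msqrt \<rho>"
  have H: "H \<in> carrier_mat d d" using q G(1) by (simp add: H_def)
  have "adj (msqrt \<rho>' * msqrt \<rho>) * (msqrt \<rho>' * msqrt \<rho>) = msqrt \<rho> * (msqrt \<rho>' * msqrt \<rho>') * msqrt \<rho>"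
    using q q' by (simp add: adj_mult[of _ d d _ d])
  also have "\<dots> = msqrt \<rho> * (G * (msqrt \<rho> * msqrt \<rho>) * adj G) * msqrt \<rho>"
    unfolding msqrt_mult[OF r'] msqrt_mult[OF r(1)] unfolding \<rho>'_def ..
  also have "\<dots> = H * adj H"
    using q G(1) by (simp add: H_def adj_mult[of _ d d _ d])
  finally have "tnorm (msqrt \<rho>' * msqrt \<rho>) = Re (trace (msqrt (H * adj H)))" by (simp add: tnorm_def)
  moreover have "trace H = trace (G * \<rho>)"
  proof -
    have "trace H = trace (msqrt \<rho> * (msqrt \<rho> * G))"
      using trace_conj_left[of "msqrt \<rho>" d G "msqrt \<rho>"] q G(1) by (simp add: H_def)
    also have "\<dots> = trace (\<rho> * G)" using q G(1) msqrt_mult[OF r(1)] assoc_mult_mat[of "msqrt \<rho>" d d "msqrt \<rho>" d G d] by simp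
    also have "\<dots> = trace (G * \<rho>)" using rc G(1) by (rule trace_comm)
    finally show ?thesis .
  qed
  ultimately have "Re (trace (G * \<rho>)) \<le> gen_fidelity \<rho>' \<rho>"
    using trace_msqrt_ge[OF H] r(2) by (simp add: gen_fidelity_def)
  then show thesis using G\<rho> trD_le by (intro that[OF P leP sub le[unfolded A_def]]) simp
qed

section \<open>Tensor products and partial traces\<close>

lemma sum_lessThan_add:
  fixes f :: "nat \<Rightarrow> 'a::comm_monoid_add"
  shows "(\<Sum>i<m + n. f i) = (\<Sum>i<m. f i) + (\<Sum>b<n. f (m + b))"
  by (induction n) (simp_all add: add.assoc)

lemma sum_lessThan_mult:
  fixes f :: "nat \<Rightarrow> 'a::comm_monoid_add"
  shows "(\<Sum>i<m * n. f i) = (\<Sum>a<m. \<Sum>b<n. f (a * n + b))"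
proof (induction m)
  case (Suc m)
  have "(\<Sum>i<Suc m * n. f i) = (\<Sum>i<m * n + n. f i)" by (simp add: add.commute)
  then show ?case using Suc by (simp add: sum_lessThan_add)
qed simp

lemma mult_add_less: "a < m \<Longrightarrow> b < n \<Longrightarrow> a * n + b < m * (n::nat)"
  by (metis add_mult_distrib2 add_less_cancel_left less_le_trans mult.commute mult_Suc mult_le_mono1 nat_add_left_cancel_less Suc_leI add.commute)

lemma div_mod_less: "i < m * n \<Longrightarrow> i div n < m" "i < m * n \<Longrightarrow> i mod n < (n::nat)"
  by (auto simp: less_mult_imp_div_less) (metis mod_less_divisor mult_0_right not_gr_zero not_less_zero)

lemma div_mod_add [simp]: "b < n \<Longrightarrow> (a * n + b) div n = (a::nat)" "b < n \<Longrightarrow> (a * n + b) mod n = b"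
  by auto

lemma kron_carrier: "A \<in> carrier_mat n m \<Longrightarrow> B \<in> carrier_mat p q \<Longrightarrow> kron A B \<in> carrier_mat (n * p) (m * q)"
  by (simp add: kron_def)

lemma kron_square_carrier [simp]:
  "A \<in> carrier_mat n n \<Longrightarrow> B \<in> carrier_mat m m \<Longrightarrow> kron A B \<in> carrier_mat (n * m) (n * m)"
  by (rule kron_carrier)

lemma index_kron:
  "A \<in> carrier_mat n m \<Longrightarrow> B \<in> carrier_mat p q \<Longrightarrow> i < n * p \<Longrightarrow> j < m * q \<Longrightarrow>
    kron A B $$ (i,j) = A $$ (i div p, j div q) * B $$ (i mod p, j mod q)"
  by (auto simp: kron_def)

lemma kron_mult:
  assumes A: "A \<in> carrier_mat n n" and B: "B \<in> carrier_mat m m" and C: "C \<in> carrier_mat n n" and D: "D \<in> carrier_mat m m"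
  shows "kron A B * kron C D = kron (A * C) (B * D)"
proof (rule eq_matI)
  fix i j assume "i < dim_row (kron (A * C) (B * D))" "j < dim_col (kron (A * C) (B * D))"
  then have ij: "i < n * m" "j < n * m" using assms by (auto simp: kron_def)
  note ij' = div_mod_less[OF ij(1)] div_mod_less[OF ij(2)]
  have "(kron A B * kron C D) $$ (i,j) = (\<Sum>k<n * m. kron A B $$ (i,k) * kron C D $$ (k,j))"
    using ij kron_square_carrier[OF A B] kron_square_carrier[OF C D] by (simp add: scalar_prod_def atLeast0LessThan)
  also have "\<dots> = (\<Sum>a<n. \<Sum>b<m. kron A B $$ (i,a * m + b) * kron C D $$ (a * m + b,j))"
    by (rule sum_lessThan_mult)
  also have "\<dots> = (\<Sum>a<n. \<Sum>b<m. (A $$ (i div m, a) * C $$ (a, j div m)) * (B $$ (i mod m, b) * D $$ (b, j mod m)))"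
    using ij by (intro sum.cong refl) (simp add: index_kron[OF A B] index_kron[OF C D] mult_add_less)
  also have "\<dots> = (\<Sum>a<n. A $$ (i div m, a) * C $$ (a, j div m)) * (\<Sum>b<m. B $$ (i mod m, b) * D $$ (b, j mod m))"
    by (simp add: sum_product)
  also have "\<dots> = kron (A * C) (B * D) $$ (i,j)"
    using assms ij ij' index_kron[of "A * C" n n "B * D" m m i j] by (simp add: scalar_prod_def atLeast0LessThan)
  finally show "(kron A B * kron C D) $$ (i,j) = kron (A * C) (B * D) $$ (i,j)" .
qed (use assms in \<open>auto simp: kron_def\<close>)

lemma adj_kron:
  assumes "A \<in> carrier_mat n m" "B \<in> carrier_mat p q" shows "adj (kron A B) = kron (adj A) (adj B)"
proof (rule eq_matI)
  fix i j assume "i < dim_row (kron (adj A) (adj B))" "j < dim_col (kron (adj A) (adj B))"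
  then have ij: "i < m * q" "j < n * p" using assms by (auto simp: kron_def)
  then show "adj (kron A B) $$ (i,j) = kron (adj A) (adj B) $$ (i,j)"
    using assms kron_carrier[OF assms] div_mod_less[OF ij(1)] div_mod_less[OF ij(2)]
    by (simp add: index_kron[OF assms] index_kron[OF adj_carrier[OF assms(1)] adj_carrier[OF assms(2)]])
qed (use assms in \<open>auto simp: kron_def\<close>)

lemma trace_kron:
  assumes "A \<in> carrier_mat n n" "B \<in> carrier_mat m m" shows "trace (kron A B) = trace A * trace B"
proof -
  have "trace (kron A B) = (\<Sum>a<n. \<Sum>b<m. kron A B $$ (a * m + b, a * m + b))"
    using kron_square_carrier[OF assms] by (simp add: trace_def sum_lessThan_mult)
  also have "\<dots> = (\<Sum>a<n. \<Sum>b<m. A $$ (a,a) * B $$ (b,b))"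
    by (intro sum.cong refl) (simp add: index_kron[OF assms] mult_add_less)
  finally show ?thesis using assms by (simp add: trace_def sum_product)
qed

lemma kron_diag_of: "kron (diag_of n f) (diag_of m g) = diag_of (n * m) (\<lambda>i. f (i div m) * g (i mod m))"
proof (rule eq_matI)
  fix i j assume "i < dim_row (diag_of (n * m) (\<lambda>i. f (i div m) * g (i mod m)))"
    "j < dim_col (diag_of (n * m) (\<lambda>i. f (i div m) * g (i mod m)))"
  then have ij: "i < n * m" "j < n * m" by auto
  have "i div m = j div m \<and> i mod m = j mod m \<longleftrightarrow> i = j" by (metis div_mult_mod_eq)
  then show "kron (diag_of n f) (diag_of m g) $$ (i,j) = diag_of (n * m) (\<lambda>i. f (i div m) * g (i mod m)) $$ (i,j)"
    using ij div_mod_less[OF ij(1)] div_mod_less[OF ij(2)]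
    unfolding index_kron[OF diag_of_carrier diag_of_carrier ij] by (auto simp: diag_of_def)
qed (auto simp: kron_def)

lemma one_mat_diag_of: "1\<^sub>m n = diag_of n (\<lambda>_. 1)"
  by (rule eq_matI) (auto simp: diag_of_def)

lemma kron_one: "kron (1\<^sub>m n) (1\<^sub>m m) = 1\<^sub>m (n * m)"
  unfolding one_mat_diag_of kron_diag_of by simp

lemma kron_smult: "kron A (c \<cdot>\<^sub>m B) = c \<cdot>\<^sub>m kron A B"
proof (rule eq_matI)
  fix i j assume "i < dim_row (c \<cdot>\<^sub>m kron A B)" "j < dim_col (c \<cdot>\<^sub>m kron A B)"
  then have ij: "i < dim_row A * dim_row B" "j < dim_col A * dim_col B" by (auto simp: kron_def)
  then show "kron A (c \<cdot>\<^sub>m B) $$ (i,j) = (c \<cdot>\<^sub>m kron A B) $$ (i,j)"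
    using div_mod_less[OF ij(1)] div_mod_less[OF ij(2)] by (simp add: kron_def)
qed (auto simp: kron_def)

lemma kron_assoc:
  assumes A: "A \<in> carrier_mat n n" and B: "B \<in> carrier_mat m m" and C: "C \<in> carrier_mat p p"
  shows "kron (kron A B) C = kron A (kron B C)"
proof (rule eq_matI)
  fix i j assume "i < dim_row (kron A (kron B C))" "j < dim_col (kron A (kron B C))"
  then have ij: "i < (n * m) * p" "j < (n * m) * p" using assms by (auto simp: kron_def)
  have split: "i div p < n * m" "i div p mod m < m" "i mod p < p" "i mod (m * p) < m * p"
    "i div p div m = i div (m * p)" "i mod (m * p) div p = i div p mod m" "i mod (m * p) mod p = i mod p"
    if "i < (n * m) * p" for i
  proof -
    show "i div p < n * m" "i mod p < p" using div_mod_less[OF that] by auto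
    then show "i div p mod m < m" using div_mod_less(2) by blast
    show "i mod (m * p) < m * p" using that div_mod_less(2)[of i n "m * p"] by (simp add: mult.assoc)
    show "i div p div m = i div (m * p)" by (metis div_mult2_eq mult.commute)
    have "i mod (p * m) = p * (i div p mod m) + i mod p" by (rule mod_mult2_eq)
    then have *: "i mod (m * p) = (i div p mod m) * p + i mod p" by (simp add: mult.commute)
    show "i mod (m * p) div p = i div p mod m" "i mod (m * p) mod p = i mod p"
      unfolding * using \<open>i mod p < p\<close> by simp_all
  qed
  note s = split[OF ij(1)] split[OF ij(2)]
  have ij': "i < n * (m * p)" "j < n * (m * p)" using ij by (auto simp: mult.assoc)
  show "kron (kron A B) C $$ (i,j) = kron A (kron B C) $$ (i,j)"
    unfolding index_kron[OF kron_square_carrier[OF A B] C ij] index_kron[OF A kron_square_carrier[OF B C] ij']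
      index_kron[OF A B s(1) s(8)] index_kron[OF B C s(4) s(11)] s(5-7) s(12-14) by simp
qed (use assms in \<open>auto simp: kron_def mult.assoc\<close>)

lemma unitary_mat_kron:
  assumes "unitary_mat n U" "unitary_mat m V" shows "unitary_mat (n * m) (kron U V)"
proof -
  note U = unitary_matD[OF assms(1)] and V = unitary_matD[OF assms(2)]
  have "kron U V * adj (kron U V) = kron (U * adj U) (V * adj V)"
    unfolding adj_kron[OF U(1) V(1)] by (rule kron_mult[OF U(1) V(1) adj_carrier[OF U(1)] adj_carrier[OF V(1)]])
  then show ?thesis unfolding unitary_mat_def U(2) V(2) kron_one using U(1) V(1) by auto
qed

lemma kron_spec:
  assumes "unitary_mat n U" "unitary_mat m V"
  shows "kron (spec n U a) (spec m V b) = spec (n * m) (kron U V) (\<lambda>i. a (i div m) * b (i mod m))"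
proof -
  note U = unitary_matD(1)[OF assms(1)] and V = unitary_matD(1)[OF assms(2)]
  let ?a = "diag_of n (\<lambda>i. complex_of_real (a i))" and ?b = "diag_of m (\<lambda>i. complex_of_real (b i))"
  have "kron (spec n U a) (spec m V b) = kron (U * ?a) (V * ?b) * kron (adj U) (adj V)"
    unfolding spec_def by (rule kron_mult[symmetric]) (use U V in auto)
  also have "kron (U * ?a) (V * ?b) = kron U V * kron ?a ?b"
    by (rule kron_mult[symmetric]) (use U V in auto)
  finally show ?thesis by (simp add: spec_def kron_diag_of adj_kron[OF U V])
qed

text \<open>Eigenvalues of the product are products of nonnegative numbers, on which
  \<open>powr\<close> is multiplicative.\<close>

lemma mpow_kron:
  assumes "psd n A" "psd m B" shows "mpow (kron A B) p = kron (mpow A p) (mpow B p)"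
proof -
  obtain U a where U: "unitary_mat n U" "\<forall>i. 0 \<le> a i" "A = spec n U a" using psd_spectral[OF assms(1)] .
  obtain V b where V: "unitary_mat m V" "\<forall>i. 0 \<le> b i" "B = spec m V b" using psd_spectral[OF assms(2)] .
  have pos: "\<forall>i. 0 \<le> a (i div m) * b (i mod m)" using U(2) V(2) by simp
  show ?thesis
    unfolding U(3) V(3) mpow_spec[OF U(1,2)] mpow_spec[OF V(1,2)] kron_spec[OF U(1) V(1)]
      mpow_spec[OF unitary_mat_kron[OF U(1) V(1)] pos] using U(2) V(2) by (simp add: powr_mult)
qed

lemma psd_kron: assumes "psd n A" "psd m B" shows "psd (n * m) (kron A B)"
proof -
  obtain U a where U: "unitary_mat n U" "\<forall>i. 0 \<le> a i" "A = spec n U a" using psd_spectral[OF assms(1)] .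
  obtain V b where V: "unitary_mat m V" "\<forall>i. 0 \<le> b i" "B = spec m V b" using psd_spectral[OF assms(2)] .
  show ?thesis unfolding U(3) V(3) kron_spec[OF U(1) V(1)]
    by (rule psd_spec[OF unitary_mat_kron[OF U(1) V(1)]]) (use U(2) V(2) in simp)
qed

lemma subdens_kron: assumes "subdens n A" "subdens m B" shows "subdens (n * m) (kron A B)"
proof -
  have A: "psd n A" "Re (trace A) \<le> 1" and B: "psd m B" "Re (trace B) \<le> 1" using assms by (auto simp: subdens_def)
  have "Re (trace (kron A B)) = Re (trace A) * Re (trace B)"
    unfolding trace_kron[OF psd_carrier[OF A(1)] psd_carrier[OF B(1)]]
    by (subst psd_trace_real[OF A(1)], subst psd_trace_real[OF B(1)]) simp
  also have "\<dots> \<le> 1" using A(2) B(2) psd_trace[OF A(1)] psd_trace[OF B(1)] by (intro mult_le_one) auto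
  finally show ?thesis using psd_kron[OF A(1) B(1)] by (simp add: subdens_def)
qed

section \<open>Operators on the second factor and partial traces over the first\<close>

lemma index_local_mult:
  assumes Z: "Z \<in> carrier_mat m m" and X: "X \<in> carrier_mat (n * m) k" and i: "a < n" "b < m" and j: "j < k"
  shows "(kron (1\<^sub>m n) Z * X) $$ (a * m + b, j) = (\<Sum>c<m. Z $$ (b,c) * X $$ (a * m + c, j))"
proof -
  have K: "kron (1\<^sub>m n) Z \<in> carrier_mat (n * m) (n * m)" using Z by auto
  have "(kron (1\<^sub>m n) Z * X) $$ (a * m + b, j) = (\<Sum>l<n * m. kron (1\<^sub>m n) Z $$ (a * m + b, l) * X $$ (l,j))"
    using K X mult_add_less[OF i] j by (simp add: scalar_prod_def atLeast0LessThan)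
  also have "\<dots> = (\<Sum>e<n. \<Sum>c<m. kron (1\<^sub>m n) Z $$ (a * m + b, e * m + c) * X $$ (e * m + c,j))"
    by (rule sum_lessThan_mult)
  also have "\<dots> = (\<Sum>e<n. if e = a then (\<Sum>c<m. Z $$ (b,c) * X $$ (a * m + c, j)) else 0)"
    using i by (intro sum.cong refl)
      (auto simp: index_kron[OF one_carrier_mat Z mult_add_less[OF i] mult_add_less] intro!: sum.cong sum.neutral)
  finally show ?thesis using i by simp
qed

lemma index_mult_local:
  assumes Z: "Z \<in> carrier_mat m m" and X: "X \<in> carrier_mat k (n * m)" and j: "a < n" "b < m" and i: "i < k"
  shows "(X * kron (1\<^sub>m n) Z) $$ (i, a * m + b) = (\<Sum>c<m. X $$ (i, a * m + c) * Z $$ (c,b))"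
proof -
  have K: "kron (1\<^sub>m n) Z \<in> carrier_mat (n * m) (n * m)" using Z by auto
  have "(X * kron (1\<^sub>m n) Z) $$ (i, a * m + b) = (\<Sum>l<n * m. X $$ (i,l) * kron (1\<^sub>m n) Z $$ (l, a * m + b))"
    using K X mult_add_less[OF j] i by (simp add: scalar_prod_def atLeast0LessThan)
  also have "\<dots> = (\<Sum>e<n. \<Sum>c<m. X $$ (i, e * m + c) * kron (1\<^sub>m n) Z $$ (e * m + c, a * m + b))"
    by (rule sum_lessThan_mult)
  also have "\<dots> = (\<Sum>e<n. if e = a then (\<Sum>c<m. X $$ (i, a * m + c) * Z $$ (c,b)) else 0)"
    using j by (intro sum.cong refl)
      (auto simp: index_kron[OF one_carrier_mat Z mult_add_less mult_add_less[OF j]] intro!: sum.cong sum.neutral)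
  finally show ?thesis using j by simp
qed

lemma ptrace_fst_carrier [simp]: "ptrace_fst n m X \<in> carrier_mat m m"
  by (simp add: ptrace_fst_def)

lemma ptrace_fst_local_mult:
  assumes Z: "Z \<in> carrier_mat m m" and X: "X \<in> carrier_mat (n * m) (n * m)"
  shows "ptrace_fst n m (kron (1\<^sub>m n) Z * X) = Z * ptrace_fst n m X"
proof (rule eq_matI)
  fix b b' assume "b < dim_row (Z * ptrace_fst n m X)" "b' < dim_col (Z * ptrace_fst n m X)"
  then have b: "b < m" "b' < m" using Z by (auto simp: ptrace_fst_def)
  have "ptrace_fst n m (kron (1\<^sub>m n) Z * X) $$ (b,b') = (\<Sum>a<n. \<Sum>c<m. Z $$ (b,c) * X $$ (a * m + c, a * m + b'))"
    using b by (simp add: ptrace_fst_def index_local_mult[OF Z X] mult_add_less del: index_mult_mat(1))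
  also have "\<dots> = (\<Sum>c<m. \<Sum>a<n. Z $$ (b,c) * X $$ (a * m + c, a * m + b'))" by (rule sum.swap)
  also have "\<dots> = (Z * ptrace_fst n m X) $$ (b,b')"
    using b Z by (simp add: scalar_prod_def atLeast0LessThan ptrace_fst_def sum_distrib_left)
  finally show "ptrace_fst n m (kron (1\<^sub>m n) Z * X) $$ (b,b') = (Z * ptrace_fst n m X) $$ (b,b')" .
qed (use Z in \<open>auto simp: ptrace_fst_def\<close>)

lemma ptrace_fst_mult_local:
  assumes Z: "Z \<in> carrier_mat m m" and X: "X \<in> carrier_mat (n * m) (n * m)"
  shows "ptrace_fst n m (X * kron (1\<^sub>m n) Z) = ptrace_fst n m X * Z"
proof (rule eq_matI)
  fix b b' assume "b < dim_row (ptrace_fst n m X * Z)" "b' < dim_col (ptrace_fst n m X * Z)"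
  then have b: "b < m" "b' < m" using Z by (auto simp: ptrace_fst_def)
  have "ptrace_fst n m (X * kron (1\<^sub>m n) Z) $$ (b,b') = (\<Sum>a<n. \<Sum>c<m. X $$ (a * m + b, a * m + c) * Z $$ (c,b'))"
    using b by (simp add: ptrace_fst_def index_mult_local[OF Z X] mult_add_less del: index_mult_mat(1))
  also have "\<dots> = (\<Sum>c<m. \<Sum>a<n. X $$ (a * m + b, a * m + c) * Z $$ (c,b'))" by (rule sum.swap)
  also have "\<dots> = (ptrace_fst n m X * Z) $$ (b,b')"
    using b Z by (simp add: scalar_prod_def atLeast0LessThan ptrace_fst_def sum_distrib_right)
  finally show "ptrace_fst n m (X * kron (1\<^sub>m n) Z) $$ (b,b') = (ptrace_fst n m X * Z) $$ (b,b')" .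
qed (use Z in \<open>auto simp: ptrace_fst_def\<close>)

lemma ptrace_fst_smult:
  "X \<in> carrier_mat (n * m) (n * m) \<Longrightarrow> ptrace_fst n m (c \<cdot>\<^sub>m X) = c \<cdot>\<^sub>m ptrace_fst n m X"
  by (rule eq_matI) (auto simp: ptrace_fst_def sum_distrib_left mult_add_less)

lemma trace_ptrace_fst: "X \<in> carrier_mat (n * m) (n * m) \<Longrightarrow> trace (ptrace_fst n m X) = trace X"
proof -
  assume X: "X \<in> carrier_mat (n * m) (n * m)"
  have "trace (ptrace_fst n m X) = (\<Sum>b<m. \<Sum>a<n. X $$ (a * m + b, a * m + b))"
    by (simp add: trace_def ptrace_fst_def)
  also have "\<dots> = (\<Sum>a<n. \<Sum>b<m. X $$ (a * m + b, a * m + b))" by (rule sum.swap)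
  finally show ?thesis using X by (simp add: trace_def sum_lessThan_mult)
qed

lemma ptrace_fst_ptrace_fst:
  "ptrace_fst n m (ptrace_fst k (n * m) X) = ptrace_fst (k * n) m X"
proof (rule eq_matI)
  fix b b' assume "b < dim_row (ptrace_fst (k * n) m X)" "b' < dim_col (ptrace_fst (k * n) m X)"
  then have b: "b < m" "b' < m" by (auto simp: ptrace_fst_def)
  have "ptrace_fst n m (ptrace_fst k (n * m) X) $$ (b,b')
      = (\<Sum>a<n. \<Sum>e<k. X $$ (e * (n * m) + (a * m + b), e * (n * m) + (a * m + b')))"
    using b by (simp add: ptrace_fst_def mult_add_less)
  also have "\<dots> = (\<Sum>e<k. \<Sum>a<n. X $$ ((e * n + a) * m + b, (e * n + a) * m + b'))"
    by (subst sum.swap) (simp add: algebra_simps)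
  finally show "ptrace_fst n m (ptrace_fst k (n * m) X) $$ (b,b') = ptrace_fst (k * n) m X $$ (b,b')"
    using b by (simp add: ptrace_fst_def sum_lessThan_mult)
qed (auto simp: ptrace_fst_def)

lemma cip_mat:
  assumes "A \<in> carrier_mat n m" "w \<in> carrier_vec m"
  shows "cip v (A *\<^sub>v w) = (\<Sum>i<n. \<Sum>j<m. cnj (v $ i) * A $$ (i,j) * w $ j)"
  using assms by (simp add: cip_def scalar_prod_def atLeast0LessThan sum_distrib_left mult.assoc)

text \<open>The quadratic form of the marginal at v is the sum over a of the form of X at the
  product vector of the a-th basis vector and v; \<open>w a\<close> is that product vector.\<close>

lemma psd_ptrace_fst:
  assumes X: "psd (n * m) X" shows "psd m (ptrace_fst n m X)"
  unfolding psd_iff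
proof (intro conjI ballI)
  note Xc = psd_carrier[OF X]
  have Xa: "cnj (X $$ (i,j)) = X $$ (j,i)" if "i < n * m" "j < n * m" for i j
    using index_adj[of j X i] psd_adj[OF X] Xc that by simp
  show "adj (ptrace_fst n m X) = ptrace_fst n m X"
    by (rule eq_matI) (auto simp: ptrace_fst_def Xa mult_add_less)
  fix v :: "complex vec" assume v: "v \<in> carrier_vec m"
  define w where "w a = vec (n * m) (\<lambda>i. if i div m = a then v $ (i mod m) else 0)" for a
  have w: "w a \<in> carrier_vec (n * m)" for a by (simp add: w_def)
  have w_at: "w a $ (e * m + b) = (if e = a then v $ b else 0)" if "e < n" "b < m" for a e b
    using that by (simp add: w_def mult_add_less)
  have "cip (w a) (X *\<^sub>v w a) = (\<Sum>b<m. \<Sum>b'<m. cnj (v $ b) * X $$ (a * m + b, a * m + b') * v $ b')"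
    if a: "a < n" for a
  proof -
    have inner: "(\<Sum>j<n * m. cnj (w a $ i) * X $$ (i,j) * w a $ j) = (\<Sum>b'<m. cnj (w a $ i) * X $$ (i, a * m + b') * v $ b')" for i
    proof -
      have "(\<Sum>j<n * m. cnj (w a $ i) * X $$ (i,j) * w a $ j)
          = (\<Sum>e<n. if e = a then (\<Sum>b'<m. cnj (w a $ i) * X $$ (i, a * m + b') * v $ b') else 0)"
        unfolding sum_lessThan_mult by (intro sum.cong refl) (auto simp: w_at)
      then show ?thesis using a by simp
    qed
    have "cip (w a) (X *\<^sub>v w a) = (\<Sum>e<n. \<Sum>b<m. \<Sum>b'<m. cnj (w a $ (e * m + b)) * X $$ (e * m + b, a * m + b') * v $ b')"
      unfolding cip_mat[OF Xc w] inner by (rule sum_lessThan_mult)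
    also have "\<dots> = (\<Sum>e<n. if e = a then (\<Sum>b<m. \<Sum>b'<m. cnj (v $ b) * X $$ (a * m + b, a * m + b') * v $ b') else 0)"
      by (intro sum.cong refl) (auto simp: w_at)
    finally show ?thesis using a by simp
  qed
  then have "(\<Sum>a<n. cip (w a) (X *\<^sub>v w a)) = (\<Sum>a<n. \<Sum>b<m. \<Sum>b'<m. cnj (v $ b) * X $$ (a * m + b, a * m + b') * v $ b')"
    by simp
  also have "\<dots> = (\<Sum>b<m. \<Sum>b'<m. \<Sum>a<n. cnj (v $ b) * X $$ (a * m + b, a * m + b') * v $ b')"
    by (subst sum.swap, rule sum.cong[OF refl], rule sum.swap)
  also have "\<dots> = cip v (ptrace_fst n m X *\<^sub>v v)"
    unfolding cip_mat[OF ptrace_fst_carrier v]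
    by (simp add: ptrace_fst_def sum_distrib_left sum_distrib_right)
  finally have "cip v (ptrace_fst n m X *\<^sub>v v) = (\<Sum>a<n. cip (w a) (X *\<^sub>v w a))" by simp
  moreover have "0 \<le> Re (cip (w a) (X *\<^sub>v w a))" for a using X w by (auto simp: psd_iff)
  ultimately show "0 \<le> Re (cip v (ptrace_fst n m X *\<^sub>v v))" by (simp add: sum_nonneg)
qed simp

lemma dens_ptrace_fst: "dens (n * m) X \<Longrightarrow> dens m (ptrace_fst n m X)"
  using psd_ptrace_fst trace_ptrace_fst psd_carrier by (auto simp: dens_def)

section \<open>Channels acting on one register\<close>

lemma ext_id_carrier [simp]: "ext_id Phi dA dB dK X \<in> carrier_mat (dB * dK) (dB * dK)"
  by (simp add: ext_id_def)

lemma dim_ext_id [simp]: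
  "dim_row (ext_id Phi dA dB dK X) = dB * dK" "dim_col (ext_id Phi dA dB dK X) = dB * dK"
  by (simp_all add: ext_id_def)

lemma index_ext_id:
  assumes "b < dB" "b' < dB" "k < dK" "k' < dK"
  shows "ext_id Phi dA dB dK X $$ (b * dK + k, b' * dK + k')
    = (\<Sum>a<dA. \<Sum>a'<dA. Phi (unit_op dA a a') $$ (b,b') * X $$ (a * dK + k, a' * dK + k'))"
  using assms by (simp add: ext_id_def mult_add_less)

lemma eq_mat_prodI:
  assumes "A \<in> carrier_mat (n * m) (n * m)" "B \<in> carrier_mat (n * m) (n * m)"
    "\<And>a a' b b'. a < n \<Longrightarrow> a' < n \<Longrightarrow> b < m \<Longrightarrow> b' < m \<Longrightarrow> A $$ (a * m + b, a' * m + b') = B $$ (a * m + b, a' * m + b')"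
  shows "A = B"
proof (rule eq_matI)
  fix i j assume "i < dim_row B" "j < dim_col B"
  then have "i < n * m" "j < n * m" using assms(2) by auto
  from assms(3)[OF div_mod_less(1)[OF this(1)] div_mod_less(1)[OF this(2)] div_mod_less(2)[OF this(1)] div_mod_less(2)[OF this(2)]]
  show "A $$ (i,j) = B $$ (i,j)" by simp
qed (use assms in auto)

text \<open>\<open>ext_id\<close> sums over indices of the first factor and Z over indices of the
  second, so the sums may be exchanged.\<close>

lemma ext_id_local_mult:
  assumes Z: "Z \<in> carrier_mat dK dK" and X: "X \<in> carrier_mat (dA * dK) (dA * dK)"
  shows "ext_id Phi dA dB dK (kron (1\<^sub>m dA) Z * X) = kron (1\<^sub>m dB) Z * ext_id Phi dA dB dK X"
proof (rule eq_mat_prodI)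
  fix b b' k k' assume b: "b < dB" "b' < dB" "k < dK" "k' < dK"
  have "ext_id Phi dA dB dK (kron (1\<^sub>m dA) Z * X) $$ (b * dK + k, b' * dK + k')
      = (\<Sum>a<dA. \<Sum>a'<dA. \<Sum>c<dK. Phi (unit_op dA a a') $$ (b,b') * (Z $$ (k,c) * X $$ (a * dK + c, a' * dK + k')))"
    unfolding index_ext_id[OF b] using b
    by (simp add: index_local_mult[OF Z X] mult_add_less sum_distrib_left del: index_mult_mat(1))
  also have "\<dots> = (\<Sum>a<dA. \<Sum>c<dK. \<Sum>a'<dA. Phi (unit_op dA a a') $$ (b,b') * (Z $$ (k,c) * X $$ (a * dK + c, a' * dK + k')))"
    by (intro sum.cong refl sum.swap)
  also have "\<dots> = (\<Sum>c<dK. \<Sum>a<dA. \<Sum>a'<dA. Phi (unit_op dA a a') $$ (b,b') * (Z $$ (k,c) * X $$ (a * dK + c, a' * dK + k')))"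
    by (rule sum.swap)
  also have "\<dots> = (kron (1\<^sub>m dB) Z * ext_id Phi dA dB dK X) $$ (b * dK + k, b' * dK + k')"
    unfolding index_local_mult[OF Z ext_id_carrier b(1,3) mult_add_less[OF b(2,4)]]
    using b by (simp add: index_ext_id sum_distrib_left mult_ac)
  finally show "ext_id Phi dA dB dK (kron (1\<^sub>m dA) Z * X) $$ (b * dK + k, b' * dK + k')
      = (kron (1\<^sub>m dB) Z * ext_id Phi dA dB dK X) $$ (b * dK + k, b' * dK + k')" .
qed (use Z in auto)

lemma ext_id_mult_local:
  assumes Z: "Z \<in> carrier_mat dK dK" and X: "X \<in> carrier_mat (dA * dK) (dA * dK)"
  shows "ext_id Phi dA dB dK (X * kron (1\<^sub>m dA) Z) = ext_id Phi dA dB dK X * kron (1\<^sub>m dB) Z"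
proof (rule eq_mat_prodI)
  fix b b' k k' assume b: "b < dB" "b' < dB" "k < dK" "k' < dK"
  have "ext_id Phi dA dB dK (X * kron (1\<^sub>m dA) Z) $$ (b * dK + k, b' * dK + k')
      = (\<Sum>a<dA. \<Sum>a'<dA. \<Sum>c<dK. Phi (unit_op dA a a') $$ (b,b') * (X $$ (a * dK + k, a' * dK + c) * Z $$ (c,k')))"
    unfolding index_ext_id[OF b] using b
    by (simp add: index_mult_local[OF Z X] mult_add_less sum_distrib_left del: index_mult_mat(1))
  also have "\<dots> = (\<Sum>a<dA. \<Sum>c<dK. \<Sum>a'<dA. Phi (unit_op dA a a') $$ (b,b') * (X $$ (a * dK + k, a' * dK + c) * Z $$ (c,k')))"
    by (intro sum.cong refl sum.swap)
  also have "\<dots> = (\<Sum>c<dK. \<Sum>a<dA. \<Sum>a'<dA. Phi (unit_op dA a a') $$ (b,b') * (X $$ (a * dK + k, a' * dK + c) * Z $$ (c,k')))"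
    by (rule sum.swap)
  also have "\<dots> = (ext_id Phi dA dB dK X * kron (1\<^sub>m dB) Z) $$ (b * dK + k, b' * dK + k')"
    unfolding index_mult_local[OF Z ext_id_carrier b(2,4) mult_add_less[OF b(1,3)]]
    using b by (simp add: index_ext_id sum_distrib_left sum_distrib_right mult_ac)
  finally show "ext_id Phi dA dB dK (X * kron (1\<^sub>m dA) Z) $$ (b * dK + k, b' * dK + k')
      = (ext_id Phi dA dB dK X * kron (1\<^sub>m dB) Z) $$ (b * dK + k, b' * dK + k')" .
qed (use Z in auto)

lemma ext_id_smult:
  assumes "X \<in> carrier_mat (dA * dK) (dA * dK)"
  shows "ext_id Phi dA dB dK (c \<cdot>\<^sub>m X) = c \<cdot>\<^sub>m ext_id Phi dA dB dK X"
  using assms by (intro eq_mat_prodI[of _ dB dK])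
    (simp_all add: index_ext_id mult_add_less sum_distrib_left mult_ac)

text \<open>No signalling: trace preservation on the matrix units gives a Kronecker delta. Hence the
  registers emitted so far, together with S and E, keep their joint state in all later
  steps.\<close>

lemma ptrace_fst_ext_id:
  assumes ch: "channel dA dB Phi"
  shows "ptrace_fst dB dK (ext_id Phi dA dB dK X) = ptrace_fst dA dK X"
proof (rule eq_matI)
  fix k k' assume "k < dim_row (ptrace_fst dA dK X)" "k' < dim_col (ptrace_fst dA dK X)"
  then have k: "k < dK" "k' < dK" by (auto simp: ptrace_fst_def)
  have U: "unit_op dA a a' \<in> carrier_mat dA dA" for a a' by (simp add: unit_op_def)
  have tr: "(\<Sum>b<dB. Phi (unit_op dA a a') $$ (b,b)) = (if a = a' then 1 else 0)" if "a < dA" for a a'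
  proof -
    have "Phi (unit_op dA a a') \<in> carrier_mat dB dB" "trace (Phi (unit_op dA a a')) = trace (unit_op dA a a')"
      using ch U by (auto simp: channel_def)
    moreover have "trace (unit_op dA a a') = (\<Sum>i<dA. if i = a then (if a = a' then 1 else 0) else 0)"
      unfolding trace_def by (intro sum.cong) (auto simp: unit_op_def)
    ultimately show ?thesis using that by (simp add: trace_def)
  qed
  have "ptrace_fst dB dK (ext_id Phi dA dB dK X) $$ (k,k')
      = (\<Sum>b<dB. \<Sum>a<dA. \<Sum>a'<dA. Phi (unit_op dA a a') $$ (b,b) * X $$ (a * dK + k, a' * dK + k'))"
    using k by (simp add: ptrace_fst_def index_ext_id)
  also have "\<dots> = (\<Sum>a<dA. \<Sum>a'<dA. \<Sum>b<dB. Phi (unit_op dA a a') $$ (b,b) * X $$ (a * dK + k, a' * dK + k'))"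
    by (subst sum.swap, rule sum.cong[OF refl], rule sum.swap)
  also have "\<dots> = (\<Sum>a<dA. \<Sum>a'<dA. if a' = a then X $$ (a * dK + k, a * dK + k') else 0)"
    by (intro sum.cong refl) (simp add: tr flip: sum_distrib_right)
  also have "\<dots> = ptrace_fst dA dK X $$ (k,k')" using k by (simp add: ptrace_fst_def)
  finally show "ptrace_fst dB dK (ext_id Phi dA dB dK X) $$ (k,k') = ptrace_fst dA dK X $$ (k,k')" .
qed (auto simp: ptrace_fst_def)

lemma psd_ext_id:
  "channel dA dB Phi \<Longrightarrow> 0 < dK \<Longrightarrow> psd (dA * dK) X \<Longrightarrow> psd (dB * dK) (ext_id Phi dA dB dK X)"
  by (simp add: channel_def)

lemma dens_ext_id:
  assumes "channel dA dB Phi" "0 < dK" "dens (dA * dK) X" shows "dens (dB * dK) (ext_id Phi dA dB dK X)"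
proof -
  have X: "psd (dA * dK) X" "trace X = 1" using assms(3) by (auto simp: dens_def)
  have "trace (ext_id Phi dA dB dK X) = trace X"
    using trace_ptrace_fst[OF ext_id_carrier[of Phi dA dB dK X]] trace_ptrace_fst[OF psd_carrier[OF X(1)]]
    by (simp add: ptrace_fst_ext_id[OF assms(1)])
  then show ?thesis using psd_ext_id[OF assms(1,2) X(1)] X(2) by (simp add: dens_def)
qed

section \<open>The chain rule for the sandwiched divergence\<close>

text \<open>The argument of \<open>Idown\<close> in the theorem: after the step the memory R' is
  discarded and the new L stands in front of the old K.\<close>

definition emit :: "(complex mat \<Rightarrow> complex mat) \<Rightarrow> nat \<Rightarrow> nat \<Rightarrow> nat \<Rightarrow> nat \<Rightarrow> complex mat \<Rightarrow> complex mat" where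
  "emit Phi dR dR' dL dK X = ptrace_fst dR' (dL * dK) (ext_id Phi dR (dR' * dL) dK X)"

lemma emit_carrier [simp]: "emit Phi dR dR' dL dK X \<in> carrier_mat (dL * dK) (dL * dK)"
  by (simp add: emit_def)

lemma ext_id_carrier' : "ext_id Phi dR (dR' * dL) dK X \<in> carrier_mat (dR' * (dL * dK)) (dR' * (dL * dK))"
  using ext_id_carrier[of Phi dR "dR' * dL" dK X] by (simp add: mult.assoc)

lemma kron_one_left_assoc:
  "Z \<in> carrier_mat k k \<Longrightarrow> kron (1\<^sub>m (n * m)) Z = kron (1\<^sub>m n) (kron (1\<^sub>m m) Z)"
  using kron_assoc[of "1\<^sub>m n" n "1\<^sub>m m" m Z k] by (simp add: kron_one)

lemma emit_conj:
  assumes Z: "Z \<in> carrier_mat dK dK" and X: "X \<in> carrier_mat (dR * dK) (dR * dK)"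
  shows "emit Phi dR dR' dL dK (kron (1\<^sub>m dR) Z * X * adj (kron (1\<^sub>m dR) Z))
    = kron (1\<^sub>m dL) Z * emit Phi dR dR' dL dK X * adj (kron (1\<^sub>m dL) Z)"
proof -
  have adjk: "adj (kron (1\<^sub>m n) Z) = kron (1\<^sub>m n) (adj Z)" for n
    using adj_kron[OF one_carrier_mat[of n] Z] by simp
  have aZ: "adj Z \<in> carrier_mat dK dK" using Z by simp
  have KX: "kron (1\<^sub>m dR) Z * X \<in> carrier_mat (dR * dK) (dR * dK)" using Z X by simp
  have kZ: "kron (1\<^sub>m dL) Z \<in> carrier_mat (dL * dK) (dL * dK)" "kron (1\<^sub>m dL) (adj Z) \<in> carrier_mat (dL * dK) (dL * dK)"
    using Z aZ by auto
  have kE: "kron (1\<^sub>m dR') (kron (1\<^sub>m dL) Z) * ext_id Phi dR (dR' * dL) dK X \<in> carrier_mat (dR' * (dL * dK)) (dR' * (dL * dK))"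
    using mult_square_carrier[OF kron_square_carrier[OF one_carrier_mat kZ(1)] ext_id_carrier'] .
  show ?thesis
    unfolding emit_def adjk ext_id_mult_local[OF aZ KX] ext_id_local_mult[OF Z X]
      kron_one_left_assoc[OF Z] kron_one_left_assoc[OF aZ]
      ptrace_fst_mult_local[OF kZ(2) kE] ptrace_fst_local_mult[OF kZ(1) ext_id_carrier'] ..
qed

lemma emit_smult:
  "X \<in> carrier_mat (dR * dK) (dR * dK) \<Longrightarrow> emit Phi dR dR' dL dK (c \<cdot>\<^sub>m X) = c \<cdot>\<^sub>m emit Phi dR dR' dL dK X"
  unfolding emit_def by (simp add: ext_id_smult ptrace_fst_smult[OF ext_id_carrier'])

lemma emit_marginal:
  "channel dR (dR' * dL) Phi \<Longrightarrow> ptrace_fst dL dK (emit Phi dR dR' dL dK X) = ptrace_fst dR dK X"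
  by (simp add: emit_def ptrace_fst_ptrace_fst ptrace_fst_ext_id)

lemma emit_dens:
  "channel dR (dR' * dL) Phi \<Longrightarrow> 0 < dK \<Longrightarrow> dens (dR * dK) X \<Longrightarrow> dens (dL * dK) (emit Phi dR dR' dL dK X)"
  unfolding emit_def by (intro dens_ptrace_fst) (simp add: dens_ext_id flip: mult.assoc)

lemma kron_split:
  assumes "X \<in> carrier_mat n n" "Z \<in> carrier_mat m m"
  shows "kron X Z = kron X (1\<^sub>m m) * kron (1\<^sub>m n) Z" "kron X Z = kron (1\<^sub>m n) Z * kron X (1\<^sub>m m)"
  using assms kron_mult[of X n "1\<^sub>m m" m "1\<^sub>m n" Z] kron_mult[of "1\<^sub>m n" n Z m X "1\<^sub>m m"] by simp_all

lemma kron_one_mult: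
  assumes "X \<in> carrier_mat m m" "Z \<in> carrier_mat m m"
  shows "kron (1\<^sub>m n) X * kron (1\<^sub>m n) Z = kron (1\<^sub>m n) (X * Z)"
  using kron_mult[OF one_carrier_mat assms(1) one_carrier_mat assms(2), of n] by simp

text \<open>With \<open>Y = s \<rho>\<^sub>K s\<close> and \<open>s = \<sigma>\<^sub>K\<^bsup>(1-\<alpha>)/(2\<alpha>)\<^esup>\<close>, the tilted state is \<open>\<nu> \<propto> A \<rho> A\<^sup>*\<close> with \<open>A = Y\<^bsup>(\<alpha>-1)/2\<^esup> s\<close>.
  Its marginal is proportional to \<open>Y\<^sup>\<alpha>\<close>, so sandwiching \<open>\<nu>\<close> with its own marginal undoes the tilt.\<close>

lemma exists_tilted_state:
  assumes ch: "channel dR (dR' * dL) Phi" and dK: "0 < dK" and \<rho>: "dens (dR * dK) \<rho>"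
    and \<sigma>: "subdens dK \<sigma>" and supp: "supp_le (ptrace_fst dR dK \<rho>) \<sigma>" and \<alpha>: "1 < \<alpha>"
  obtains \<nu> where "dens (dR * dK) \<nu>"
    "\<forall>\<omega>. psd dL \<omega> \<and> supp_le (emit Phi dR dR' dL dK \<nu>) (kron \<omega> (ptrace_fst dL dK (emit Phi dR dR' dL dK \<nu>))) \<longrightarrow>
      supp_le (emit Phi dR dR' dL dK \<rho>) (kron \<omega> \<sigma>) \<and>
      sandwich \<alpha> (emit Phi dR dR' dL dK \<rho>) (kron \<omega> \<sigma>) = sandwich \<alpha> (ptrace_fst dR dK \<rho>) \<sigma> *
        sandwich \<alpha> (emit Phi dR dR' dL dK \<nu>) (kron \<omega> (ptrace_fst dL dK (emit Phi dR dR' dL dK \<nu>)))"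
proof -
  let ?D = "dL * dK"
  let ?E = "emit Phi dR dR' dL dK"
  let ?K = "\<lambda>Z. kron (1\<^sub>m dL) Z"
  note assocK = square_assoc[of _ dK] and assocD = square_assoc[of _ ?D]
  define \<tau> where "\<tau> = ptrace_fst dR dK \<rho>"
  define s where "s = mpow \<sigma> ((1 - \<alpha>) / (2 * \<alpha>))"
  define r where "r = mpow \<sigma> ((\<alpha> - 1) / (2 * \<alpha>))"
  define Y where "Y = s * \<tau> * s"
  define c where "c = sandwich \<alpha> \<tau> \<sigma>"
  define A where "A = mpow Y ((\<alpha> - 1) / 2) * s"
  define \<nu> where "\<nu> = complex_of_real (1 / c) \<cdot>\<^sub>m (kron (1\<^sub>m dR) A * \<rho> * adj (kron (1\<^sub>m dR) A))"
  define T where "T = ?K s * ?E \<rho> * ?K s"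
  have \<rho>': "psd (dR * dK) \<rho>" "trace \<rho> = 1" using \<rho> by (auto simp: dens_def)
  note \<rho>c = psd_carrier[OF \<rho>'(1)]
  have \<tau>d: "dens dK \<tau>" unfolding \<tau>_def by (rule dens_ptrace_fst[OF \<rho>])
  then have \<tau>: "psd dK \<tau>" "trace \<tau> = 1" by (auto simp: dens_def)
  have \<sigma>p: "psd dK \<sigma>" using \<sigma> by (simp add: subdens_def)
  have s: "psd dK s" and r: "psd dK r" unfolding s_def r_def by (auto intro: mpow_psd[OF \<sigma>p])
  have Y: "psd dK Y" unfolding Y_def using psd_congruence[OF \<tau>(1) psd_carrier[OF s]] psd_adj[OF s] by simp
  have Yp: "psd dK (mpow Y p)" for p by (rule mpow_psd[OF Y])
  note kc = psd_carrier[OF \<tau>(1)] psd_carrier[OF s] psd_carrier[OF r] psd_carrier[OF Y] psd_carrier[OF Yp] psd_carrier[OF \<sigma>p]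
    mpow_carrier[OF \<sigma>p]
  note ka = psd_adj[OF s] psd_adj[OF Yp]
  have rs: "r * s = mpow \<sigma> 0" "s * r = mpow \<sigma> 0"
    using \<alpha> by (simp_all add: r_def s_def mpow_mult[OF \<sigma>p] flip: add_divide_distrib)
  \<comment> \<open>Nonnegativity of the divergence makes c positive, so the tilt does not
    annihilate the state and can be normalised.\<close>
  have c1: "1 \<le> c" unfolding c_def by (rule sandwich_ge_one[OF \<tau>d \<sigma> supp[folded \<tau>_def] \<alpha>])
  have cY: "trace (mpow Y \<alpha>) = complex_of_real c"
    using psd_trace_real[OF Yp[of \<alpha>]] by (simp add: c_def sandwich_def Let_def Y_def s_def)
  have Ac: "A \<in> carrier_mat dK dK" "adj A = s * mpow Y ((\<alpha> - 1) / 2)"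
    using kc ka by (simp_all add: A_def adj_mult[of _ dK dK _ dK])
  have kA: "kron (1\<^sub>m dR) A \<in> carrier_mat (dR * dK) (dR * dK)" using Ac by simp
  have A\<rho>: "psd (dR * dK) (kron (1\<^sub>m dR) A * \<rho> * adj (kron (1\<^sub>m dR) A))" by (rule psd_congruence[OF \<rho>'(1) kA])
  have \<nu>p: "psd (dR * dK) \<nu>" unfolding \<nu>_def using c1 by (intro psd_smult[OF A\<rho>]) simp
  \<comment> \<open>The exponents add up to (\<alpha>-1)/2 + 1 + (\<alpha>-1)/2 = \<alpha>, so the
    unnormalised marginal has trace exactly c.\<close>
  have \<nu>K: "ptrace_fst dR dK \<nu> = complex_of_real (1 / c) \<cdot>\<^sub>m mpow Y \<alpha>"
  proof -
    have "kron (1\<^sub>m dR) A * \<rho> \<in> carrier_mat (dR * dK) (dR * dK)" using kA \<rho>c by simp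
    then have "ptrace_fst dR dK (kron (1\<^sub>m dR) A * \<rho> * kron (1\<^sub>m dR) (adj A)) = A * \<tau> * adj A"
      unfolding ptrace_fst_mult_local[OF adj_carrier[OF Ac(1)] \<open>kron (1\<^sub>m dR) A * \<rho> \<in> _\<close>]
        ptrace_fst_local_mult[OF Ac(1) \<rho>c] \<tau>_def by simp
    also have "\<dots> = mpow Y ((\<alpha> - 1) / 2) * Y * mpow Y ((\<alpha> - 1) / 2)"
    proof -
      have "(w * s) * \<tau> * (s * w) = w * (s * \<tau> * s) * w" if "w \<in> carrier_mat dK dK" for w
        using kc(1,2) that by (simp add: assocK)
      from this[OF kc(5)] show ?thesis unfolding Ac(2) unfolding A_def Y_def[symmetric] .
    qed
    also have "\<dots> = mpow Y ((\<alpha> - 1) / 2 + 1 + (\<alpha> - 1) / 2)"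
      unfolding mpow_mult[OF Y, symmetric] mpow_one[OF Y] ..
    also have "(\<alpha> - 1) / 2 + 1 + (\<alpha> - 1) / 2 = \<alpha>" by simp
    finally show ?thesis
      using ptrace_fst_smult[OF psd_carrier[OF A\<rho>]] adj_kron[OF one_carrier_mat[of dR] Ac(1)] by (simp add: \<nu>_def)
  qed
  have \<nu>: "dens (dR * dK) \<nu>"
    using \<nu>p trace_ptrace_fst[OF psd_carrier[OF \<nu>p]] kc(5)[of \<alpha>] cY c1
    unfolding \<nu>K dens_def by (simp add: trace_smult[of _ dK])
  have E\<rho>: "psd ?D (?E \<rho>)" using emit_dens[OF ch dK \<rho>] by (simp add: dens_def)
  have ks: "?K s \<in> carrier_mat ?D ?D" "adj (?K s) = ?K s"
    using kc ka adj_kron[OF one_carrier_mat[of dL] kc(2)] by auto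
  have T: "psd ?D T" unfolding T_def using psd_congruence[OF E\<rho> ks(1)] ks(2) by simp
  have TK: "ptrace_fst dL dK T = Y"
    unfolding T_def Y_def \<tau>_def emit_marginal[OF ch, symmetric]
    using ptrace_fst_mult_local[OF kc(2), of "?K s * ?E \<rho>" dL] ptrace_fst_local_mult[OF kc(2) psd_carrier[OF E\<rho>]] ks(1)
    by simp
  \<comment> \<open>A projection on K that fixes the marginal preserves the trace of X, since the
    partial trace over L keeps traces; \<open>psd_supported\<close> upgrades this to an operator
    identity.\<close>
  have local_supp: "?K P * X = X"
    if X: "psd ?D X" and P: "psd dK P" "P * P = P" and PX: "P * ptrace_fst dL dK X = ptrace_fst dL dK X" for X P
  proof (rule psd_supported[OF X])
    show "psd ?D (?K P)" by (rule psd_kron[OF psd_one P(1)])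
    show "?K P * ?K P = ?K P" unfolding kron_one_mult[OF psd_carrier[OF P(1)] psd_carrier[OF P(1)]] P(2) ..
    have "trace (?K P * X) = trace (ptrace_fst dL dK (?K P * X))"
      using psd_carrier[OF X] psd_carrier[OF P(1)] by (intro trace_ptrace_fst[symmetric]) auto
    also have "\<dots> = trace (ptrace_fst dL dK X)"
      unfolding ptrace_fst_local_mult[OF psd_carrier[OF P(1)] psd_carrier[OF X]] PX ..
    also have "\<dots> = trace X" by (rule trace_ptrace_fst[OF psd_carrier[OF X]])
    finally show "Re (trace (?K P * X)) = Re (trace X)" by simp
  qed
  have local_supp': "X * ?K P = X"
    if X: "psd ?D X" and P: "psd dK P" and eq: "?K P * X = X" for X P
  proof -
    have "adj (?K P) = ?K P" using psd_adj[OF psd_kron[OF psd_one P]] .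
    moreover have "adj (?K P * X) = adj X * adj (?K P)"
      using psd_carrier[OF X] psd_carrier[OF P] by (intro adj_mult[of _ ?D ?D]) auto
    ultimately show ?thesis unfolding eq psd_adj[OF X] by simp
  qed
  define E0 where "E0 = mpow Y 0"
  note E0 = support_projection[OF Y, folded E0_def]
  have TP: "?K E0 * T = T" by (rule local_supp[OF T E0(1,2)]) (simp add: TK E0(3))
  then have TP': "T * ?K E0 = T" by (rule local_supp'[OF T E0(1)])
  define S where "S = mpow \<sigma> 0"
  note S = support_projection[OF \<sigma>p, folded S_def]
  have "\<tau> * S = \<tau>" using supp supp_le_iff[OF kc(1) \<sigma>p] by (simp add: \<tau>_def S_def)
  then have "S * \<tau> = \<tau>" using adj_mult[OF kc(1) psd_carrier[OF S(1)]] psd_adj[OF \<tau>(1)] psd_adj[OF S(1)] by simp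
  then have EP: "?K S * ?E \<rho> = ?E \<rho>"
    by (intro local_supp[OF E\<rho> S(1,2)]) (simp add: emit_marginal[OF ch] flip: \<tau>_def)
  then have EP': "?E \<rho> * ?K S = ?E \<rho>" by (rule local_supp'[OF E\<rho> S(1)])
  \<comment> \<open>The tilt y and its inverse z on the support of Y. Their product is only the
    projection \<open>E0\<close>, which T absorbs because its marginal is Y.\<close>
  define y where "y = mpow Y ((\<alpha> - 1) / 2)"
  define z where "z = mpow Y ((1 - \<alpha>) / 2)"
  have yz: "y * z = E0" "z * y = E0"
    by (simp_all add: y_def z_def E0_def mpow_mult[OF Y] flip: add_divide_distrib)
  have yc: "y \<in> carrier_mat dK dK" "z \<in> carrier_mat dK dK" "S \<in> carrier_mat dK dK" "E0 \<in> carrier_mat dK dK"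
    using kc psd_carrier[OF S(1)] by (auto simp: y_def z_def E0_def)
  note KD = kron_square_carrier[OF one_carrier_mat[of dL]]
  note Tc = psd_carrier[OF T] and Ec = psd_carrier[OF E\<rho>]
  have kAL: "?K A = ?K y * ?K s" "adj (?K A) = ?K s * ?K y"
    using adj_kron[OF one_carrier_mat[of dL] Ac(1)] Ac(2)
    unfolding kron_one_mult[OF yc(1) kc(2)] kron_one_mult[OF kc(2) yc(1)] by (simp_all add: A_def y_def)
  have E\<nu>: "?E \<nu> = complex_of_real (1 / c) \<cdot>\<^sub>m (?K y * T * ?K y)"
  proof -
    have "?E \<nu> = complex_of_real (1 / c) \<cdot>\<^sub>m (?K A * ?E \<rho> * adj (?K A))"
      unfolding \<nu>_def emit_smult[OF psd_carrier[OF A\<rho>]] emit_conj[OF Ac(1) \<rho>c] ..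
    also have "?K A * ?E \<rho> * adj (?K A) = ?K y * T * ?K y"
      unfolding kAL(2) unfolding kAL(1) T_def using KD[OF yc(1)] KD[OF kc(2)] Ec by (simp add: assocD)
    finally show ?thesis .
  qed
  have undo: "?K z * ?E \<nu> * ?K z = complex_of_real (1 / c) \<cdot>\<^sub>m T"
  proof -
    have "?K z * (?K y * T * ?K y) * ?K z = (?K z * ?K y) * T * (?K y * ?K z)"
      using KD[OF yc(1)] KD[OF yc(2)] Tc by (simp add: assocD)
    also have "\<dots> = T"
      unfolding kron_one_mult[OF yc(2,1)] kron_one_mult[OF yc(1,2)] yz TP TP' ..
    finally show ?thesis
      unfolding E\<nu> using KD[OF yc(1)] KD[OF yc(2)] Tc
      by (simp add: mult_smult_distrib[of _ ?D ?D _ ?D] mult_smult_assoc_mat[of _ ?D ?D _ ?D] del: assoc_mult_mat)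
  qed
  have "supp_le (?E \<rho>) (kron \<omega> \<sigma>) \<and> sandwich \<alpha> (?E \<rho>) (kron \<omega> \<sigma>) =
      c * sandwich \<alpha> (?E \<nu>) (kron \<omega> (ptrace_fst dL dK (?E \<nu>)))"
    if \<omega>: "psd dL \<omega>" and sup: "supp_le (?E \<nu>) (kron \<omega> (ptrace_fst dL dK (?E \<nu>)))" for \<omega>
  proof -
    let ?w = "\<lambda>p. mpow \<omega> p"
    let ?W = "\<lambda>Z. kron Z (1\<^sub>m dK)"
    note wc = mpow_carrier[OF \<omega>]
    have WD: "?W (?w p) \<in> carrier_mat ?D ?D" for p using wc by simp
    have \<nu>Kp: "mpow (ptrace_fst dL dK (?E \<nu>)) p = complex_of_real ((1 / c) powr p) \<cdot>\<^sub>m mpow Y (\<alpha> * p)" for p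
      unfolding emit_marginal[OF ch] \<nu>K using c1 by (subst mpow_smult[OF Yp]) (simp_all add: mpow_mpow[OF Y])
    have \<nu>Kpsd: "psd dK (ptrace_fst dL dK (?E \<nu>))"
      unfolding emit_marginal[OF ch] by (rule psd_ptrace_fst[OF \<nu>p])
    have E\<nu>p: "psd ?D (?E \<nu>)" using emit_dens[OF ch dK \<nu>] by (simp add: dens_def)
    note E\<nu>c = psd_carrier[OF E\<nu>p]
    note comm = kron_split[OF wc kc(2)] kron_split[OF wc yc(2)]
    have sup0: "?E \<nu> * kron (?w 0) E0 = ?E \<nu>"
    proof -
      have "mpow (kron \<omega> (ptrace_fst dL dK (?E \<nu>))) 0 = kron (?w 0) E0"
        unfolding mpow_kron[OF \<omega> \<nu>Kpsd] \<nu>Kp using c1 by (simp add: E0_def) (rule arg_cong[of _ _ "kron _"], rule eq_matI, auto)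
      then show ?thesis using sup supp_le_iff[OF E\<nu>c psd_kron[OF \<omega> \<nu>Kpsd]] by simp
    qed
    \<comment> \<open>The support hypothesis on \<nu> is carried back: the projection onto the
      support of \<omega> fixes \<open>?E \<nu>\<close>, commutes with operators on K, and so fixes
      T through z; conjugation with r later passes this on to \<open>?E \<rho>\<close>.\<close>
    have TW: "T * ?W (?w 0) = T"
    proof -
      have W0: "kron (?w 0) E0 * ?W (?w 0) = kron (?w 0) E0"
        using kron_mult[OF wc yc(4) wc one_carrier_mat, of 0 0] yc(4) by (simp add: mpow_mult[OF \<omega>])
      have "?E \<nu> * ?W (?w 0) = ?E \<nu> * kron (?w 0) E0 * ?W (?w 0)" by (simp only: sup0)
      also have "\<dots> = ?E \<nu> * kron (?w 0) E0"
        using E\<nu>c WD[of 0] kron_square_carrier[OF wc yc(4)] W0 assocD[of "?E \<nu>" "kron (?w 0) E0" "?W (?w 0)"] by simp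
      finally have EW: "?E \<nu> * ?W (?w 0) = ?E \<nu>" by (simp only: sup0)
      have "(?K z * ?E \<nu> * ?K z) * ?W (?w 0) = ?K z * (?E \<nu> * ?W (?w 0)) * ?K z"
        using KD[OF yc(2)] E\<nu>c WD[of 0] kron_split[OF wc[of 0] yc(2)] by (simp add: assocD)
      then have "(complex_of_real (1 / c) \<cdot>\<^sub>m T) * ?W (?w 0) = complex_of_real (1 / c) \<cdot>\<^sub>m T" unfolding EW undo .
      then have "complex_of_real (1 / c) \<cdot>\<^sub>m (T * ?W (?w 0)) = complex_of_real (1 / c) \<cdot>\<^sub>m T"
        using Tc WD[of 0] by (simp add: mult_smult_assoc_mat[of _ ?D ?D _ ?D])
      from arg_cong[OF this, of "\<lambda>M. complex_of_real c \<cdot>\<^sub>m M"]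
      have *: "complex_of_real c \<cdot>\<^sub>m (complex_of_real (1 / c) \<cdot>\<^sub>m (T * ?W (?w 0)))
          = complex_of_real c \<cdot>\<^sub>m (complex_of_real (1 / c) \<cdot>\<^sub>m T)" .
      have "complex_of_real c \<cdot>\<^sub>m (complex_of_real (1 / c) \<cdot>\<^sub>m M) = M" for M
        using c1 by (intro eq_matI) auto
      then show ?thesis using * by simp
    qed
    have kr: "?K r * T * ?K r = ?E \<rho>"
    proof -
      have "?K r * T * ?K r = (?K r * ?K s) * ?E \<rho> * (?K s * ?K r)"
        unfolding T_def using KD[OF kc(3)] KD[OF kc(2)] Ec by (simp add: assocD)
      then show ?thesis unfolding kron_one_mult[OF kc(3,2)] kron_one_mult[OF kc(2,3)] rs S_def[symmetric] EP EP' .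
    qed
    have "?E \<rho> * ?W (?w 0) = ?K r * (T * ?W (?w 0)) * ?K r"
      unfolding kr[symmetric] using KD[OF kc(3)] Tc WD[of 0] kron_split[OF wc[of 0] kc(3)] by (simp add: assocD)
    then have EW: "?E \<rho> * ?W (?w 0) = ?E \<rho>" unfolding TW kr .
    have "?E \<rho> * kron (?w 0) S = (?E \<rho> * ?W (?w 0)) * ?K S"
      using kron_split(1)[OF wc[of 0] yc(3)] Ec WD[of 0] KD[OF yc(3)] by (simp add: assocD)
    then have "?E \<rho> * mpow (kron \<omega> \<sigma>) 0 = ?E \<rho>" unfolding mpow_kron[OF \<omega> \<sigma>p] S_def[symmetric] EW EP' .
    then have sup\<rho>: "supp_le (?E \<rho>) (kron \<omega> \<sigma>)"
      using supp_le_iff[OF Ec psd_kron[OF \<omega> \<sigma>p]] by simp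
    define a where "a = (1 - \<alpha>) / (2 * \<alpha>)"
    define X where "X = ?W (?w a) * T * ?W (?w a)"
    have X: "psd ?D X"
      unfolding X_def using psd_congruence[OF T WD[of a]] psd_adj[OF psd_kron[OF mpow_psd[OF \<omega>] psd_one], of a] by simp
    have "kron (?w a) s * ?E \<rho> * kron (?w a) s = X"
    proof -
      have "kron (?w a) s * ?E \<rho> * kron (?w a) s = (?W (?w a) * ?K s) * ?E \<rho> * (?K s * ?W (?w a))"
        by (subst kron_split(1)[OF wc kc(2)], subst kron_split(2)[OF wc kc(2)]) (rule refl)
      then show ?thesis unfolding X_def T_def using WD[of a] KD[OF kc(2)] Ec by (simp add: assocD)
    qed
    then have sand\<rho>: "sandwich \<alpha> (?E \<rho>) (kron \<omega> \<sigma>) = Re (trace (mpow X \<alpha>))"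
      unfolding sandwich_def Let_def mpow_kron[OF \<omega> \<sigma>p] a_def[symmetric] s_def[folded a_def, symmetric] by simp
    \<comment> \<open>Each of the two sandwiching factors picks up q from the normalisation 1/c of
      the marginal. Together with the 1/c inside \<open>?E \<nu>\<close> the scalar is (1/c)^(2a+1),
      and (2a+1) \<alpha> = 1.\<close>
    define q where "q = (1 / c) powr a"
    have q: "q > 0" "(q * q * (1 / c)) powr \<alpha> = 1 / c"
    proof -
      show "q > 0" using c1 by (simp add: q_def)
      have "q * q * (1 / c) = (1 / c) powr (a + a + 1)" unfolding q_def powr_add using c1 by simp
      then have "(q * q * (1 / c)) powr \<alpha> = (1 / c) powr ((a + a + 1) * \<alpha>)" by (simp add: powr_powr)
      also have "(a + a + 1) * \<alpha> = 1" using \<alpha> by (simp add: a_def field_simps)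
      finally show "(q * q * (1 / c)) powr \<alpha> = 1 / c" using c1 by simp
    qed
    \<comment> \<open>The marginal is a multiple of Y^\<alpha>, and \<alpha> a = (1-\<alpha>)/2 is
      the exponent of z.\<close>
    have kz: "mpow (kron \<omega> (ptrace_fst dL dK (?E \<nu>))) a = complex_of_real q \<cdot>\<^sub>m kron (?w a) z"
    proof -
      have "\<alpha> * a = (1 - \<alpha>) / 2" using \<alpha> by (simp add: a_def)
      then show ?thesis unfolding mpow_kron[OF \<omega> \<nu>Kpsd] \<nu>Kp kron_smult q_def z_def by (simp only:)
    qed
    have zz: "kron (?w a) z * ?E \<nu> * kron (?w a) z = complex_of_real (1 / c) \<cdot>\<^sub>m X"
    proof -
      have "kron (?w a) z * ?E \<nu> * kron (?w a) z = (?W (?w a) * ?K z) * ?E \<nu> * (?K z * ?W (?w a))"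
        by (subst kron_split(1)[OF wc yc(2)], subst kron_split(2)[OF wc yc(2)]) (rule refl)
      also have "\<dots> = ?W (?w a) * (?K z * ?E \<nu> * ?K z) * ?W (?w a)"
        using WD[of a] KD[OF yc(2)] E\<nu>c by (simp add: assocD)
      also have "\<dots> = complex_of_real (1 / c) \<cdot>\<^sub>m X"
        unfolding undo X_def using WD[of a] Tc
        by (simp add: mult_smult_distrib[of _ ?D ?D _ ?D] mult_smult_assoc_mat[of _ ?D ?D _ ?D] del: assoc_mult_mat)
      finally show ?thesis .
    qed
    have kzc: "kron (?w a) z \<in> carrier_mat ?D ?D" using wc yc(2) by simp
    have "(complex_of_real q \<cdot>\<^sub>m kron (?w a) z) * ?E \<nu> * (complex_of_real q \<cdot>\<^sub>m kron (?w a) z)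
        = complex_of_real q \<cdot>\<^sub>m (complex_of_real q \<cdot>\<^sub>m (kron (?w a) z * ?E \<nu> * kron (?w a) z))"
      using kzc E\<nu>c
      by (simp add: mult_smult_distrib[of _ ?D ?D _ ?D] mult_smult_assoc_mat[of _ ?D ?D _ ?D] del: assoc_mult_mat)
    also have "\<dots> = complex_of_real (q * q * (1 / c)) \<cdot>\<^sub>m X"
      unfolding zz by (rule eq_matI) (auto simp: mult.assoc)
    finally have "sandwich \<alpha> (?E \<nu>) (kron \<omega> (ptrace_fst dL dK (?E \<nu>))) = Re (trace (mpow (complex_of_real (q * q * (1 / c)) \<cdot>\<^sub>m X) \<alpha>))"
      unfolding sandwich_def Let_def a_def[symmetric] kz by simp
    also have "\<dots> = (1 / c) * Re (trace (mpow X \<alpha>))"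
      using q c1 mpow_carrier[OF X, of \<alpha>] by (subst mpow_smult[OF X]) (simp_all add: trace_smult[of _ ?D])
    finally have "c * sandwich \<alpha> (?E \<nu>) (kron \<omega> (ptrace_fst dL dK (?E \<nu>))) = Re (trace (mpow X \<alpha>))"
      using c1 by simp
    then show ?thesis using sup\<rho> sand\<rho> by simp
  qed
  then show thesis using that[OF \<nu>] unfolding c_def \<tau>_def by blast
qed

section \<open>Mutual information bounds\<close>

lemma sandD_eq:
  assumes \<rho>: "dens d \<rho>" and \<sigma>: "subdens d \<sigma>" and supp: "supp_le \<rho> \<sigma>" and \<alpha>: "1 < \<alpha>"
  shows "sandD \<alpha> \<rho> \<sigma> = ereal (log 2 (sandwich \<alpha> \<rho> \<sigma>) / (\<alpha> - 1))"
  using sandwich_ge_one[OF assms] \<rho> supp \<alpha>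
  by (simp add: sandD_def sandwich_def Let_def dens_def elog2_def)

lemma sandD_nonneg:
  assumes "dens d \<rho>" "subdens d \<sigma>" "1 < \<alpha>"
  shows "0 \<le> sandD \<alpha> \<rho> \<sigma>"
proof (cases "supp_le \<rho> \<sigma>")
  case True
  then show ?thesis using sandD_eq[OF assms(1,2) True assms(3)] sandwich_ge_one[OF assms(1,2) True assms(3)] assms(3) by simp
qed (simp add: sandD_def)

lemma dens_imp_subdens: "dens d \<rho> \<Longrightarrow> subdens d \<rho>"
  by (simp add: dens_def subdens_def)

lemma Idown_nonneg:
  assumes "dens (dB * dA) \<rho>" "1 < \<alpha>" shows "0 \<le> Idown \<alpha> dB dA \<rho>"
  unfolding Idown_def
  by (intro INF_greatest sandD_nonneg[OF assms(1) subdens_kron[OF _ dens_imp_subdens[OF dens_ptrace_fst[OF assms(1)]]] assms(2)]) simp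

text \<open>A strict bound on the infimum yields an actual reference state, and finiteness of its
  divergence forces the support condition.\<close>

lemma Idown_less_witness:
  assumes \<rho>: "dens (dB * dA) \<rho>" and \<alpha>: "1 < \<alpha>" and less: "Idown \<alpha> dB dA \<rho> < ereal x"
  obtains \<omega> where "subdens dB \<omega>" "supp_le \<rho> (kron \<omega> (ptrace_fst dB dA \<rho>))"
    "sandwich \<alpha> \<rho> (kron \<omega> (ptrace_fst dB dA \<rho>)) \<le> 2 powr ((\<alpha> - 1) * x)"
proof -
  let ?\<tau> = "ptrace_fst dB dA \<rho>"
  obtain \<omega> where \<omega>: "subdens dB \<omega>" and lt: "sandD \<alpha> \<rho> (kron \<omega> ?\<tau>) < ereal x"
    using less unfolding Idown_def INF_less_iff by auto
  have supp: "supp_le \<rho> (kron \<omega> ?\<tau>)" using lt by (auto simp: sandD_def split: if_splits)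
  have sub: "subdens (dB * dA) (kron \<omega> ?\<tau>)"
    by (rule subdens_kron[OF \<omega> dens_imp_subdens[OF dens_ptrace_fst[OF \<rho>]]])
  have "log 2 (sandwich \<alpha> \<rho> (kron \<omega> ?\<tau>)) \<le> (\<alpha> - 1) * x"
    using lt \<alpha> unfolding sandD_eq[OF \<rho> sub supp \<alpha>] by (simp add: field_simps)
  then have "sandwich \<alpha> \<rho> (kron \<omega> ?\<tau>) \<le> 2 powr ((\<alpha> - 1) * x)"
    using sandwich_ge_one[OF \<rho> sub supp \<alpha>] by (simp add: log_le_iff)
  then show thesis using that \<omega> supp by blast
qed

lemma sandwich_self:
  assumes "dens d \<rho>" "1 < \<alpha>" shows "supp_le \<rho> \<rho>" "sandwich \<alpha> \<rho> \<rho> = 1"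
proof -
  have \<rho>: "psd d \<rho>" "trace \<rho> = 1" using assms(1) by (auto simp: dens_def)
  show "supp_le \<rho> \<rho>" by (simp add: supp_le_def)
  let ?a = "(1 - \<alpha>) / (2 * \<alpha>)"
  have "mpow \<rho> ?a * \<rho> * mpow \<rho> ?a = mpow \<rho> (?a + 1 + ?a)"
    unfolding mpow_mult[OF \<rho>(1), symmetric] mpow_one[OF \<rho>(1)] ..
  also have "?a + 1 + ?a = 1 / \<alpha>" using assms(2) by (simp add: field_simps)
  finally show "sandwich \<alpha> \<rho> \<rho> = 1"
    using assms(2) \<rho>(2) by (simp add: sandwich_def Let_def mpow_mpow[OF \<rho>(1)] mpow_one[OF \<rho>(1)])
qed

lemma Dmax_le:
  assumes "psd d (complex_of_real l \<cdot>\<^sub>m \<sigma> - \<rho>)" "0 < l" shows "Dmax d \<rho> \<sigma> \<le> ereal (log 2 l)"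
proof -
  let ?S = "{\<mu>::real. 0 \<le> \<mu> \<and> psd d (complex_of_real \<mu> \<cdot>\<^sub>m \<sigma> - \<rho>)}"
  have l: "l \<in> ?S" using assms by simp
  then have "Inf ?S \<le> l" by (intro cInf_lower bdd_belowI[of _ 0]) auto
  moreover have "0 \<le> Inf ?S" using l by (intro cInf_greatest) auto
  ultimately have "elog2 (Inf ?S) \<le> ereal (log 2 l)" by (auto simp: elog2_def)
  then show ?thesis using l unfolding Dmax_def Let_def by (auto split: if_splits)
qed

lemma Imax_smooth_le:
  assumes \<rho>: "dens (dA * dB) \<rho>" and \<omega>: "subdens dA \<omega>" and \<tau>: "subdens dB \<tau>"
    and supp: "supp_le \<rho> (kron \<omega> \<tau>)" and \<alpha>: "1 < \<alpha>" and \<epsilon>: "0 < \<epsilon>" "\<epsilon> < 1"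
    and Q: "sandwich \<alpha> \<rho> (kron \<omega> \<tau>) \<le> 2 powr ((\<alpha> - 1) * x)"
  shows "Imax_smooth \<epsilon> dA dB \<rho> \<le> ereal (x - log 2 (1 - sqrt (1 - \<epsilon>\<^sup>2)) / (\<alpha> - 1))"
proof -
  \<comment> \<open>The fidelity may fall to 1 - e before the purified distance exceeds
    \<epsilon>.\<close>
  define e where "e = 1 - sqrt (1 - \<epsilon>\<^sup>2)"
  have "\<epsilon>\<^sup>2 < 1" using \<epsilon> by (simp add: power_less_one_iff)
  then have e: "0 < e" "e \<le> 1" using \<epsilon> by (auto simp: e_def)
  \<comment> \<open>The solution of
    \<open>l powr (1 - \<alpha>) * 2 powr ((\<alpha> - 1) * x) = e\<close>; its logarithm is the
    claimed bound.\<close>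
  define l where "l = 2 powr x * e powr (- 1 / (\<alpha> - 1))"
  have l: "0 < l" using e by (simp add: l_def)
  have "l powr (1 - \<alpha>) = 2 powr (x * (1 - \<alpha>)) * e powr (- 1 / (\<alpha> - 1) * (1 - \<alpha>))"
    by (simp add: l_def powr_mult powr_powr)
  also have "- 1 / (\<alpha> - 1) * (1 - \<alpha>) = 1" using \<alpha> by (simp add: field_simps)
  finally have lp: "l powr (1 - \<alpha>) * 2 powr ((\<alpha> - 1) * x) = e"
    using e by (simp add: powr_add[symmetric] algebra_simps flip: mult.assoc)
  have \<sigma>: "psd (dA * dB) (kron \<omega> \<tau>)" using subdens_kron[OF \<omega> \<tau>] by (simp add: subdens_def)
  have \<rho>p: "psd (dA * dB) \<rho>" using \<rho> by (simp add: dens_def)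
  obtain P \<rho>' where P: "psd (dA * dB) P" "P * P = P"
    and le: "l * Re (trace (P * kron \<omega> \<tau>)) \<le> Re (trace (P * \<rho>))"
    and sub: "subdens (dA * dB) \<rho>'" and dom: "psd (dA * dB) (complex_of_real l \<cdot>\<^sub>m kron \<omega> \<tau> - \<rho>')"
    and fid: "1 - Re (trace (P * \<rho>)) \<le> gen_fidelity \<rho>' \<rho>"
    using exists_smoothed_state[OF \<rho> \<sigma> less_imp_le[OF l]] .
  have "Re (trace (P * \<rho>)) \<le> l powr (1 - \<alpha>) * sandwich \<alpha> \<rho> (kron \<omega> \<tau>)"
    by (rule sandwich_test_bound[OF \<rho>p \<sigma> supp P \<alpha> l le])
  also have "\<dots> \<le> l powr (1 - \<alpha>) * 2 powr ((\<alpha> - 1) * x)" using Q by (intro mult_left_mono) auto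
  finally have "sqrt (1 - \<epsilon>\<^sup>2) \<le> gen_fidelity \<rho>' \<rho>" using fid unfolding lp e_def by simp
  then have "(sqrt (1 - \<epsilon>\<^sup>2))\<^sup>2 \<le> (gen_fidelity \<rho>' \<rho>)\<^sup>2" using \<open>\<epsilon>\<^sup>2 < 1\<close> by (intro power_mono) auto
  then have "1 - (gen_fidelity \<rho>' \<rho>)\<^sup>2 \<le> \<epsilon>\<^sup>2" using \<open>\<epsilon>\<^sup>2 < 1\<close> by simp
  then have "purified_distance \<rho>' \<rho> \<le> \<epsilon>" unfolding purified_distance_def using \<epsilon> by (simp add: real_le_lsqrt)
  then have "Imax_smooth \<epsilon> dA dB \<rho> \<le> Iddmax dA dB \<rho>'"
    unfolding Imax_smooth_def using sub by (intro INF_lower) simp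
  also have "\<dots> \<le> Dmax (dA * dB) \<rho>' (kron \<omega> \<tau>)"
    unfolding Iddmax_def by (rule INF_lower2[of "(\<omega>, \<tau>)"]) (use \<omega> \<tau> in auto)
  also have "\<dots> \<le> ereal (log 2 l)" by (rule Dmax_le[OF dom l])
  also have "log 2 l = x - log 2 e / (\<alpha> - 1)"
    using e by (simp add: l_def log_mult log_powr)
  finally show ?thesis unfolding e_def .
qed

section \<open>Iterating the chain rule\<close>

lemma dimK_Suc: "dimK dL dS dE (Suc i) = dL (Suc i) * dimK dL dS dE i"
  by (simp add: dimK_def mult_ac)

lemma dimK_pos: "\<forall>i. 0 < dL i \<Longrightarrow> 0 < dS \<Longrightarrow> 0 < dE \<Longrightarrow> 0 < dimK dL dS dE i"
  by (simp add: dimK_def prod_pos)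

lemma evolve_dens:
  assumes "\<forall>i. 0 < dL i" "0 < dS" "0 < dE" "\<forall>i\<in>{1..n}. channel (dR (i - 1)) (dR i * dL i) (M i)"
    "dens (dR 0 * (dS * dE)) \<rho>" "i \<le> n"
  shows "dens (dR i * dimK dL dS dE i) (evolve M dR dL dS dE \<rho> i)"
  using assms(6)
proof (induction i)
  case 0
  then show ?case using assms(5) by (simp add: dimK_def)
next
  case (Suc i)
  have "channel (dR i) (dR (Suc i) * dL (Suc i)) (M (Suc i))" using assms(4) Suc.prems by force
  from dens_ext_id[OF this dimK_pos[OF assms(1-3)]] show ?case
    using Suc by (simp add: dimK_Suc mult.assoc)
qed

text \<open>The reference keeps the form \<omega> tensor \<tau> 0, with \<tau> 0 the initial state
  of S E; each step tensors one more factor onto \<omega> and multiplies the trace functional by at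
  most \<open>2 powr ((\<alpha> - 1) * x i)\<close>. The bounds x are strict so that each infimum
  has a witness.\<close>

lemma exists_product_reference:
  assumes dims: "\<forall>i. 0 < dL i" "0 < dS" "0 < dE"
    and chans: "\<forall>i\<in>{1..n}. channel (dR (i - 1)) (dR i * dL i) (M i)"
    and state: "dens (dR 0 * (dS * dE)) \<rho>" and \<alpha>: "1 < \<alpha>"
    and x: "\<forall>i\<in>{1..n}. \<forall>\<sigma>. dens (dR (i - 1) * dimK dL dS dE (i - 1)) \<sigma> \<longrightarrow>
      Idown \<alpha> (dL i) (dimK dL dS dE (i - 1)) (emit (M i) (dR (i - 1)) (dR i) (dL i) (dimK dL dS dE (i - 1)) \<sigma>) < ereal (x i)"
    and i: "i \<le> n"
  defines "\<tau> \<equiv> \<lambda>i. ptrace_fst (dR i) (dimK dL dS dE i) (evolve M dR dL dS dE \<rho> i)"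
  shows "\<exists>\<omega>. subdens (\<Prod>j\<in>{1..i}. dL j) \<omega> \<and> supp_le (\<tau> i) (kron \<omega> (\<tau> 0)) \<and>
    sandwich \<alpha> (\<tau> i) (kron \<omega> (\<tau> 0)) \<le> 2 powr ((\<alpha> - 1) * (\<Sum>j\<in>{1..i}. x j))"
  using i
proof (induction i)
  let ?K = "dimK dL dS dE"
  have \<tau>0: "dens (dS * dE) (\<tau> 0)"
    using dens_ptrace_fst[OF state] by (simp add: \<tau>_def dimK_def)
  {
    \<comment> \<open>Nothing has been emitted: the empty product of dimensions is 1 and the
      reference factor is the scalar 1.\<close>
    case 0
    have "kron (1\<^sub>m 1) (\<tau> 0) = \<tau> 0"
      by (rule eq_matI) (auto simp: kron_def)
    moreover have "subdens 1 (1\<^sub>m 1)" by (simp add: subdens_def psd_one trace_def)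
    ultimately show ?case
      using sandwich_self[OF \<tau>0 \<alpha>] by (intro exI[of _ "1\<^sub>m 1"]) simp
  next
    case (Suc i)
    let ?E = "emit (M (Suc i)) (dR i) (dR (Suc i)) (dL (Suc i)) (?K i)"
    obtain \<omega> where \<omega>: "subdens (\<Prod>j\<in>{1..i}. dL j) \<omega>" and supp: "supp_le (\<tau> i) (kron \<omega> (\<tau> 0))"
      and Q: "sandwich \<alpha> (\<tau> i) (kron \<omega> (\<tau> 0)) \<le> 2 powr ((\<alpha> - 1) * (\<Sum>j\<in>{1..i}. x j))"
      using Suc.IH Suc.prems by auto
    have ch: "channel (dR i) (dR (Suc i) * dL (Suc i)) (M (Suc i))" using chans Suc.prems by force
    have \<tau>S: "\<tau> (Suc i) = ?E (evolve M dR dL dS dE \<rho> i)"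
      by (simp add: \<tau>_def emit_def dimK_Suc)
    have dev: "dens (dR i * ?K i) (evolve M dR dL dS dE \<rho> i)"
      using evolve_dens[OF dims chans state] Suc.prems by simp
    have sub: "subdens (?K i) (kron \<omega> (\<tau> 0))"
      using subdens_kron[OF \<omega> dens_imp_subdens[OF \<tau>0]] by (simp add: dimK_def)
    obtain \<nu> where \<nu>: "dens (dR i * ?K i) \<nu>" and chain:
      "\<forall>\<omega>'. psd (dL (Suc i)) \<omega>' \<and> supp_le (?E \<nu>) (kron \<omega>' (ptrace_fst (dL (Suc i)) (?K i) (?E \<nu>))) \<longrightarrow>
        supp_le (\<tau> (Suc i)) (kron \<omega>' (kron \<omega> (\<tau> 0))) \<and>
        sandwich \<alpha> (\<tau> (Suc i)) (kron \<omega>' (kron \<omega> (\<tau> 0))) = sandwich \<alpha> (\<tau> i) (kron \<omega> (\<tau> 0)) *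
          sandwich \<alpha> (?E \<nu>) (kron \<omega>' (ptrace_fst (dL (Suc i)) (?K i) (?E \<nu>)))"
      using exists_tilted_state[OF ch dimK_pos[OF dims] dev sub _ \<alpha>] supp unfolding \<tau>S by (auto simp: \<tau>_def)
    have "Idown \<alpha> (dL (Suc i)) (?K i) (?E \<nu>) < ereal (x (Suc i))"
      using bspec[OF x, of "Suc i"] Suc.prems \<nu> by auto
    then obtain \<omega>' where \<omega>': "subdens (dL (Suc i)) \<omega>'"
      and supp': "supp_le (?E \<nu>) (kron \<omega>' (ptrace_fst (dL (Suc i)) (?K i) (?E \<nu>)))"
      and Q': "sandwich \<alpha> (?E \<nu>) (kron \<omega>' (ptrace_fst (dL (Suc i)) (?K i) (?E \<nu>))) \<le> 2 powr ((\<alpha> - 1) * x (Suc i))"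
      using Idown_less_witness[OF emit_dens[OF ch dimK_pos[OF dims] \<nu>] \<alpha>] by metis
    have p: "psd (dL (Suc i)) \<omega>'" "psd (\<Prod>j\<in>{1..i}. dL j) \<omega>" "psd (dS * dE) (\<tau> 0)"
      using \<omega> \<omega>' \<tau>0 by (auto simp: subdens_def dens_def)
    \<comment> \<open>The new register stands in front of the old ones, so regrouping collects all L
      factors into one operator without permuting registers.\<close>
    have assoc: "kron \<omega>' (kron \<omega> (\<tau> 0)) = kron (kron \<omega>' \<omega>) (\<tau> 0)"
      using p by (intro kron_assoc[symmetric]) (auto dest: psd_carrier)
    have "subdens (\<Prod>j\<in>{1..Suc i}. dL j) (kron \<omega>' \<omega>)"
      using subdens_kron[OF \<omega>' \<omega>] by (simp add: mult.commute)
    moreover have "sandwich \<alpha> (\<tau> i) (kron \<omega> (\<tau> 0)) *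
        sandwich \<alpha> (?E \<nu>) (kron \<omega>' (ptrace_fst (dL (Suc i)) (?K i) (?E \<nu>)))
        \<le> 2 powr ((\<alpha> - 1) * (\<Sum>j\<in>{1..i}. x j)) * 2 powr ((\<alpha> - 1) * x (Suc i))"
    proof (rule mult_mono[OF Q Q'])
      have "subdens (dL (Suc i) * ?K i) (kron \<omega>' (ptrace_fst (dL (Suc i)) (?K i) (?E \<nu>)))"
        by (rule subdens_kron[OF \<omega>' dens_imp_subdens[OF dens_ptrace_fst[OF emit_dens[OF ch dimK_pos[OF dims] \<nu>]]]])
      from sandwich_ge_one[OF emit_dens[OF ch dimK_pos[OF dims] \<nu>] this supp' \<alpha>]
      show "0 \<le> sandwich \<alpha> (?E \<nu>) (kron \<omega>' (ptrace_fst (dL (Suc i)) (?K i) (?E \<nu>)))" by simp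
    qed simp
    moreover have "2 powr ((\<alpha> - 1) * (\<Sum>j\<in>{1..i}. x j)) * 2 powr ((\<alpha> - 1) * x (Suc i)) = 2 powr ((\<alpha> - 1) * (\<Sum>j\<in>{1..Suc i}. x j))"
      by (simp add: powr_add[symmetric] distrib_left)
    moreover have "supp_le (\<tau> (Suc i)) (kron (kron \<omega>' \<omega>) (\<tau> 0)) \<and>
        sandwich \<alpha> (\<tau> (Suc i)) (kron (kron \<omega>' \<omega>) (\<tau> 0)) = sandwich \<alpha> (\<tau> i) (kron \<omega> (\<tau> 0)) *
          sandwich \<alpha> (?E \<nu>) (kron \<omega>' (ptrace_fst (dL (Suc i)) (?K i) (?E \<nu>)))"
      using chain p(1) supp' unfolding assoc[symmetric] by blast
    ultimately show ?case by (intro exI[of _ "kron \<omega>' \<omega>"]) (simp only: simp_thms)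
  }
qed

theorem mainTheorem7:
  fixes n :: nat and dR dL :: "nat \<Rightarrow> nat" and dS dE :: nat
    and M :: "nat \<Rightarrow> complex mat \<Rightarrow> complex mat"
    and \<rho> :: "complex mat" and \<epsilon> \<alpha> :: real
  assumes dims: "\<forall>i. 0 < dR i" "\<forall>i. 0 < dL i" "0 < dS" "0 < dE"
    and chans: "\<forall>i\<in>{1..n}. channel (dR (i - 1)) (dR i * dL i) (M i)"
    and state: "dens (dR 0 * (dS * dE)) \<rho>"
    and eps: "0 \<le> \<epsilon>" "\<epsilon> < 1"
    and alpha: "1 < \<alpha>"
  shows "Imax_smooth \<epsilon> (\<Prod>j\<in>{1..n}. dL j) (dS * dE)
           (ptrace_fst (dR n) (dimK dL dS dE n) (evolve M dR dL dS dE \<rho> n))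
         \<le> (\<Sum>i\<in>{1..n}. SUP \<sigma> \<in> {\<sigma>. dens (dR (i - 1) * dimK dL dS dE (i - 1)) \<sigma>}.
               Idown \<alpha> (dL i) (dimK dL dS dE (i - 1))
                 (ptrace_fst (dR i) (dL i * dimK dL dS dE (i - 1))
                   (ext_id (M i) (dR (i - 1)) (dR i * dL i) (dimK dL dS dE (i - 1)) \<sigma>)))
           - g_eps \<epsilon> / ereal (\<alpha> - 1)"
proof -
  let ?K = "dimK dL dS dE"
  define \<tau> where "\<tau> = (\<lambda>i. ptrace_fst (dR i) (?K i) (evolve M dR dL dS dE \<rho> i))"
  define S where "S i = (SUP \<sigma> \<in> {\<sigma>. dens (dR (i - 1) * ?K (i - 1)) \<sigma>}.
    Idown \<alpha> (dL i) (?K (i - 1)) (emit (M i) (dR (i - 1)) (dR i) (dL i) (?K (i - 1)) \<sigma>))" for i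
  let ?I = "Imax_smooth \<epsilon> (\<Prod>j\<in>{1..n}. dL j) (dS * dE) (\<tau> n)"
  note ev = evolve_dens[OF dims(2-4) chans state]
  have \<tau>: "dens ((\<Prod>j\<in>{1..n}. dL j) * (dS * dE)) (\<tau> n)" "subdens (dS * dE) (\<tau> 0)"
    using dens_ptrace_fst[OF ev[of n]] dens_ptrace_fst[OF state]
    by (simp_all add: \<tau>_def dimK_def dens_imp_subdens)
  \<comment> \<open>The state reached before step i is one of the admissible inputs, so the supremum
    is not over an empty set and cannot be -\<infinity>.\<close>
  have S0: "0 \<le> S i" if i: "i \<in> {1..n}" for i
  proof -
    have d: "dens (dR (i - 1) * ?K (i - 1)) (evolve M dR dL dS dE \<rho> (i - 1))" using i by (intro ev) auto
    have "channel (dR (i - 1)) (dR i * dL i) (M i)" using chans i by auto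
    from Idown_nonneg[OF emit_dens[OF this dimK_pos[OF dims(2-4)] d] alpha]
    show ?thesis unfolding S_def by (rule SUP_upper2[rotated]) (use d in simp)
  qed
  have "?I \<le> (\<Sum>i\<in>{1..n}. S i) - g_eps \<epsilon> / ereal (\<alpha> - 1)"
  \<comment> \<open>In these cases the right-hand side is \<infinity>; in all others every S i is a
    real number and g(\<epsilon>) is finite.\<close>
  proof (cases "\<epsilon> = 0 \<or> (\<exists>i\<in>{1..n}. S i = \<infinity>)")
    case True
    have "g_eps \<epsilon> \<noteq> \<infinity>" by (simp add: g_eps_def elog2_def)
    moreover have "\<epsilon> = 0 \<Longrightarrow> g_eps \<epsilon> = - \<infinity>" by (simp add: g_eps_def elog2_def)
    moreover have "(\<exists>i\<in>{1..n}. S i = \<infinity>) \<Longrightarrow> (\<Sum>i\<in>{1..n}. S i) = \<infinity>" by (subst sum_Pinfty) simp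
    ultimately consider "g_eps \<epsilon> = - \<infinity>" | "(\<Sum>i\<in>{1..n}. S i) = \<infinity>" "g_eps \<epsilon> \<noteq> \<infinity>"
      using True by blast
    then have "(\<Sum>i\<in>{1..n}. S i) - g_eps \<epsilon> / ereal (\<alpha> - 1) = \<infinity>"
    proof cases
      case 1
      then show ?thesis using alpha by simp
    next
      case 2
      then show ?thesis unfolding 2(1) using alpha by (cases "g_eps \<epsilon>") auto
    qed
    then show ?thesis by simp
  next
    case False
    then have \<epsilon>: "0 < \<epsilon>" and fin: "\<And>i. i \<in> {1..n} \<Longrightarrow> S i \<noteq> \<infinity>" using eps by auto
    have Sr: "S i = ereal (real_of_ereal (S i))" if "i \<in> {1..n}" for i
      using S0[OF that] fin[OF that] by (cases "S i") auto
    let ?e = "1 - sqrt (1 - \<epsilon>\<^sup>2)"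
    have "\<epsilon>\<^sup>2 > 0" using \<epsilon> by simp
    then have e0: "?e \<noteq> 0" by simp
    have sumS: "(\<Sum>i\<in>{1..n}. S i) = ereal (\<Sum>i\<in>{1..n}. real_of_ereal (S i))"
      unfolding sum_ereal[symmetric] by (rule sum.cong[OF refl Sr])
    have rhs: "(\<Sum>i\<in>{1..n}. S i) - g_eps \<epsilon> / ereal (\<alpha> - 1)
        = ereal ((\<Sum>i\<in>{1..n}. real_of_ereal (S i)) - log 2 ?e / (\<alpha> - 1))"
      unfolding sumS g_eps_def elog2_def using e0 alpha by simp
    show ?thesis unfolding rhs
    proof (rule ereal_le_epsilon2)
      fix \<delta> :: real assume \<delta>: "0 < \<delta>"
      \<comment> \<open>The strict bounds needed for witnesses cost a slack that sums to at most
        \<delta>; the denominator n + 1 also covers n = 0.\<close>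
      define x where "x i = real_of_ereal (S i) + \<delta> / (n + 1)" for i
      have xS: "S i < ereal (x i)" if "i \<in> {1..n}" for i
        by (subst Sr[OF that]) (use \<delta> in \<open>simp add: x_def\<close>)
      have "\<forall>i\<in>{1..n}. \<forall>\<sigma>. dens (dR (i - 1) * ?K (i - 1)) \<sigma> \<longrightarrow>
        Idown \<alpha> (dL i) (?K (i - 1)) (emit (M i) (dR (i - 1)) (dR i) (dL i) (?K (i - 1)) \<sigma>) < ereal (x i)"
      proof (intro ballI allI impI)
        fix i \<sigma> assume i: "i \<in> {1..n}" and "dens (dR (i - 1) * ?K (i - 1)) \<sigma>"
        then have "Idown \<alpha> (dL i) (?K (i - 1)) (emit (M i) (dR (i - 1)) (dR i) (dL i) (?K (i - 1)) \<sigma>) \<le> S i"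
          unfolding S_def by (intro SUP_upper) simp
        then show "Idown \<alpha> (dL i) (?K (i - 1)) (emit (M i) (dR (i - 1)) (dR i) (dL i) (?K (i - 1)) \<sigma>) < ereal (x i)"
          using xS[OF i] by (rule le_less_trans)
      qed
      from exists_product_reference[OF dims(2-4) chans state alpha this order_refl, folded \<tau>_def]
      obtain \<omega> where \<omega>: "subdens (\<Prod>j\<in>{1..n}. dL j) \<omega>" "supp_le (\<tau> n) (kron \<omega> (\<tau> 0))"
        "sandwich \<alpha> (\<tau> n) (kron \<omega> (\<tau> 0)) \<le> 2 powr ((\<alpha> - 1) * (\<Sum>j\<in>{1..n}. x j))"
        unfolding \<tau>_def by blast
      have "?I \<le> ereal ((\<Sum>j\<in>{1..n}. x j) - log 2 ?e / (\<alpha> - 1))"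
        by (rule Imax_smooth_le[OF \<tau>(1) \<omega>(1) \<tau>(2) \<omega>(2) alpha \<epsilon> eps(2) \<omega>(3)])
      also have "(\<Sum>j\<in>{1..n}. x j) \<le> (\<Sum>i\<in>{1..n}. real_of_ereal (S i)) + \<delta>"
      proof -
        have "real n * (\<delta> / (n + 1)) \<le> \<delta>" using \<delta> by (simp add: divide_le_eq mult.commute distrib_left)
        then show ?thesis by (simp add: x_def sum.distrib)
      qed
      then have "ereal ((\<Sum>j\<in>{1..n}. x j) - log 2 ?e / (\<alpha> - 1))
          \<le> ereal ((\<Sum>i\<in>{1..n}. real_of_ereal (S i)) - log 2 ?e / (\<alpha> - 1)) + ereal \<delta>" by simp
      finally show "?I \<le> ereal ((\<Sum>i\<in>{1..n}. real_of_ereal (S i)) - log 2 ?e / (\<alpha> - 1)) + ereal \<delta>" .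
    qed
  qed
  then show ?thesis unfolding S_def \<tau>_def emit_def .
qed

end
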